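(* (Existence of asymptotic solutions.) Let $q\in\mathbf{C}$, $|q|>1$, let $A\in\mathrm{GL}_n(\mathbf{C}(\{z\}))$ and let $\hat X\in\mathbf{C}[[z]]^n$ be a formal solution of the system $\sigma_qX=AX$. For any adequate open subset $U\subset\mathbf{C}^*$, with $U_\infty=p(U)$, there exists a solution $X\in\mathscr{A}(U_\infty)^n$ of the system $\sigma_qX=AX$ which is asymptotic to $\hat X$.
   Context: $\mathbf{C}(\{z\})$ is the field of germs at $0$ of meromorphic functions; $\sigma_qf(z)=f(qz)$; $p:\mathbf{C}^*\to\mathbf{E}_q=\mathbf{C}^*/q^{\mathbf{Z}}$ is the projection. An open subset $U\subset\mathbf{C}^*$ is adequate if $U=\bigcup_{k\ge0}q^{-k}U_0$ for an open set $U_0$ such that the $q^{-k}U_0$, $k\ge0$, are pairwise disjoint. An open set $U\subset\mathbf{C}^*$ is invariant if $q^{-1}U\subset U$; an invariant strict subset of $U$ is a set $\bigcup_{m\ge0}q^{-m}K'$ with $K'\subset U$ compact. A holomorphic function $f$ on an invariant open $U$ is ($q$-)asymptotic to $\hat f=\sum_{m\ge0}a_mz^m\in\mathbf{C}[[z]]$ if for all $m\in\mathbf{N}$ and every invariant strict subset $K\subset U$, $z^{-m}\bigl(f(z)-\sum_{j<m}a_jz^j\bigr)$ is bounded on $K$; $\mathscr{A}(U)$ is the algebra of holomorphic functions on $U$ admitting such an expansion. For an open $U_\infty\subset\mathbf{E}_q$, $\mathscr{A}(U_\infty)=\varinjlim\mathscr{A}(U)$ over the invariant open $U\subset\mathbf{C}^*$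 with $p(U)=U_\infty$ (so its elements are germs near $0$, on which $\sigma_q$ acts). Vectors are treated componentwise. *)

theory Defs
  imports "HOL-Complex_Analysis.Complex_Analysis"
begin

(* The projection p from C^* to E_q = C^*/q^Z: a point of E_q is its orbit under q^Z. *)
definition Eq_proj :: "complex \<Rightarrow> complex \<Rightarrow> complex set" where
  "Eq_proj q z = range (\<lambda>k::int. q powi k * z)"

definition adequate :: "complex \<Rightarrow> complex set \<Rightarrow> bool" where
  "adequate q U \<longleftrightarrow> 0 \<notin> U \<and>
     (\<exists>U0. open U0 \<and> disjoint_family (\<lambda>k::nat. (\<lambda>z. z / q ^ k) ` U0) \<and>
           U = (\<Union>k::nat. (\<lambda>z. z / q ^ k) ` U0))"

definition q_invariant_open :: "complex \<Rightarrow> complex set \<Rightarrow> bool" where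
  "q_invariant_open q U \<longleftrightarrow> open U \<and> 0 \<notin> U \<and> (\<lambda>z. z / q) ` U \<subseteq> U"

definition invariant_strict_subset :: "complex \<Rightarrow> complex set \<Rightarrow> complex set \<Rightarrow> bool" where
  "invariant_strict_subset q U K \<longleftrightarrow>
     (\<exists>K'. compact K' \<and> K' \<subseteq> U \<and> K = (\<Union>m::nat. (\<lambda>z. z / q ^ m) ` K'))"

definition q_asymptotic ::
    "complex \<Rightarrow> complex set \<Rightarrow> (complex \<Rightarrow> complex) \<Rightarrow> complex fps \<Rightarrow> bool" where
  "q_asymptotic q U f F \<longleftrightarrow>
     (\<forall>m K. invariant_strict_subset q U K \<longrightarrow>
        bounded ((\<lambda>z. (f z - (\<Sum>j<m. fps_nth F j * z ^ j)) / z ^ m) ` K))"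

definition asymp_alg :: "complex \<Rightarrow> complex set \<Rightarrow> (complex \<Rightarrow> complex) set" where
  "asymp_alg q U = {f. f holomorphic_on U \<and> (\<exists>F. q_asymptotic q U f F)}"

definition invariant_opens_over :: "complex \<Rightarrow> complex set set \<Rightarrow> complex set set" where
  "invariant_opens_over q Uinf = {V. q_invariant_open q V \<and> Eq_proj q ` V = Uinf}"

(* The direct limit of asymp_alg q V over the invariant open V above Uinf, constructed as the set
   of classes of pairs (V, f); two pairs are identified when the functions agree on a smaller such
   open set. In particular the values of f outside V play no role. *)
type_synonym section_germ = "(complex set \<times> (complex \<Rightarrow> complex)) set"

definition germ_rel :: "complex \<Rightarrow> complex set set \<Rightarrow>
    ((complex set \<times> (complex \<Rightarrow> complex)) \<times> (complex set \<times> (complex \<Rightarrow> complex))) set" where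
  "germ_rel q Uinf =
     {((V, f), (V', f')) | V f V' f'.
        V \<in> invariant_opens_over q Uinf \<and> f \<in> asymp_alg q V \<and>
        V' \<in> invariant_opens_over q Uinf \<and> f' \<in> asymp_alg q V' \<and>
        (\<exists>W \<in> invariant_opens_over q Uinf. W \<subseteq> V \<inter> V' \<and> (\<forall>z\<in>W. f z = f' z))}"

definition asymp_germs :: "complex \<Rightarrow> complex set set \<Rightarrow> section_germ set" where
  "asymp_germs q Uinf = Sigma (invariant_opens_over q Uinf) (asymp_alg q) // germ_rel q Uinf"

definition germ_asymptotic :: "complex \<Rightarrow> section_germ \<Rightarrow> complex fps \<Rightarrow> bool" where
  "germ_asymptotic q \<phi> F \<longleftrightarrow> (\<exists>(V, f) \<in> \<phi>. q_asymptotic q V f F)"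

(* sigma_q X = A X. The entries of A may have a pole at 0, so A X need not consist of elements of
   asymp_germs; the equation is an equality of germs of functions along the same direct system.
   It does not depend on the representatives (V i, f i). *)
definition germ_solution ::
    "complex \<Rightarrow> complex set set \<Rightarrow> (complex \<Rightarrow> complex^'n^'n) \<Rightarrow> section_germ^'n \<Rightarrow> bool" where
  "germ_solution q Uinf A X \<longleftrightarrow>
     (\<exists>V f. (\<forall>i. (V i, f i) \<in> X $ i) \<and>
        (\<exists>W \<in> invariant_opens_over q Uinf.
           \<forall>z\<in>W. (\<forall>i. z \<in> V i \<and> q * z \<in> V i) \<and>
                  (\<chi> i. f i (q * z)) = A z *v (\<chi> i. f i z)))"

(* Matrices over C({z}), the germs at 0 of meromorphic functions, are given by representatives;
   their values at 0 play no role. *)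
definition merom_mat :: "(complex \<Rightarrow> complex^'n^'n) \<Rightarrow> bool" where
  "merom_mat A \<longleftrightarrow> (\<forall>i j. (\<lambda>z. A z $ i $ j) meromorphic_on {0})"

definition merom_GL :: "(complex \<Rightarrow> complex^'n^'n) \<Rightarrow> bool" where
  "merom_GL A \<longleftrightarrow> merom_mat A \<and>
     (\<exists>B. merom_mat B \<and> (\<forall>\<^sub>F z in at 0. A z ** B z = mat 1 \<and> B z ** A z = mat 1))"

(* The equation takes place in C((z))^n, where A acts through its Laurent expansion at 0. *)
definition formal_solution ::
    "complex \<Rightarrow> (complex \<Rightarrow> complex^'n^'n) \<Rightarrow> complex fps^'n \<Rightarrow> bool" where
  "formal_solution q A F \<longleftrightarrow>
     (\<chi> i. fps_to_fls (fps_compose (F $ i) (fps_const q * fps_X))) =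
     (\<chi> i j. laurent_expansion (\<lambda>z. A z $ i $ j) 0) *v (\<chi> j. fps_to_fls (F $ j))"

end

theory Submission
  imports Defs
begin

text \<open>
  On an adequate set the functions on the pieces \<open>q\<^sup>-\<^sup>k U\<^sub>0\<close> are independent of each other, so a
  solution may be sought as a sequence of power series \<open>X\<^sub>k\<close>, one for each \<open>k\<close>, with
  \<open>X\<^bsub>k-1\<^esub>(q z) = A(z) X\<^sub>k(z)\<close> for large \<open>k\<close>. What is needed is that \<open>X\<^sub>k\<close> converges on discs of
  radius \<open>|q|\<^bsup>-(1-\<epsilon>)k\<^esup>\<close>, and that \<open>X\<^sub>k\<close> agrees with the given formal solution up to an order that
  tends to infinity with \<open>k\<close>. Truncating the formal solution gives a first approximation whose error
  is flat, that is, of \<open>z\<close>-order tending to infinity, so it remains to solve the inhomogeneous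
  system in flat sequences. Cyclic vectors reduce it to scalar equations
  \<open>\<Sum>\<^bsub>i\<le>d\<^esub> b\<^sub>i \<sigma>\<^sup>i x = g\<close>. Let \<open>I\<close> be the largest index for which \<open>b\<^sub>i\<close> has minimal valuation. On the
  monomial \<open>z\<^sup>n\<close> of the \<open>k\<close>-th series the term \<open>i = I\<close> dominates if \<open>n < c k\<close> and the term \<open>i = d\<close>
  dominates if \<open>n \<ge> c k\<close>, with respect to a weight with a concave kink along the line \<open>n = c k\<close>.
  Inverting the dominant terms gives a parametrix, and a Neumann series finishes the proof.
\<close>

section \<open>Convergent Laurent germs\<close>

text \<open>Why the kink: with the plain weight \<open>Q^((1 - \<epsilon>) k n)\<close>, inverting
  the term \<open>i = I\<close> leaves terms with \<open>j = i - I > 0\<close> that lose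
  \<open>\<epsilon> j n\<close> in the exponent and gain only a multiple of k from the zero of
  \<open>b i\<close>; this contracts up to about \<open>n = k / (4 d \<epsilon>)\<close>. Inverting
  the top term divides by \<open>b d\<close> and creates poles, of order w say, which cost
  \<open>w k\<close> against a gain of about \<open>\<epsilon> n\<close>; this contracts only from
  about \<open>n = w k / \<epsilon>\<close> on. Both thresholds scale like
  \<open>1 / \<epsilon>\<close>, so for large d or w a gap remains between them for every
  \<epsilon>. The term \<open>- \<delta> / 2 (min n (c k))^2\<close> of the weight is unaffected by
  shifts in k below the line, and above it pays about \<open>\<delta> c^2 k\<close> per shift,
  whatever \<epsilon> is. Hence c is fixed first, from w and the growth exponent of the right-hand
  side, and \<epsilon> is then taken small against \<open>1 / (d c)\<close>.\<close>

lemma fls_conv_radius_inverse_pos: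
  assumes "fls_conv_radius F > 0"
  shows "fls_conv_radius (inverse F) > 0"
proof -
  have "(\<lambda>z. inverse (eval_fls F z)) has_laurent_expansion inverse F"
    by (intro laurent_expansion_intros assms)
  thus ?thesis by (simp add: has_laurent_expansion_def)
qed

text \<open>The reduction to scalar equations is linear algebra over C({z}). As a type of its own
  this field can be used with the vector space theory \<open>vec\<close>; over all of
  \<open>complex fls\<close> the coefficients produced by spans and annihilators could
  diverge.\<close>

typedef conv_germ = "{F :: complex fls. fls_conv_radius F > 0}"
  by (rule exI[of _ 0]) simp

lemma Rep_conv_germ_pos [simp]: "fls_conv_radius (Rep_conv_germ a) > 0"
  using Rep_conv_germ by auto

instantiation conv_germ :: field
begin

definition "0 = Abs_conv_germ 0"
definition "1 = Abs_conv_germ 1"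
definition "a + b = Abs_conv_germ (Rep_conv_germ a + Rep_conv_germ b)"
definition "a - b = Abs_conv_germ (Rep_conv_germ a - Rep_conv_germ b)"
definition "- a = Abs_conv_germ (- Rep_conv_germ a)"
definition "a * b = Abs_conv_germ (Rep_conv_germ a * Rep_conv_germ b)"
definition "inverse a = Abs_conv_germ (inverse (Rep_conv_germ a))"
definition "a div b = Abs_conv_germ (Rep_conv_germ a * inverse (Rep_conv_germ b))"

lemma Rep_conv_germ_arith:
  "Rep_conv_germ 0 = 0" "Rep_conv_germ 1 = 1"
  "Rep_conv_germ (a + b) = Rep_conv_germ a + Rep_conv_germ b"
  "Rep_conv_germ (a - b) = Rep_conv_germ a - Rep_conv_germ b"
  "Rep_conv_germ (- a) = - Rep_conv_germ a"
  "Rep_conv_germ (a * b) = Rep_conv_germ a * Rep_conv_germ b"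
  "Rep_conv_germ (inverse a) = inverse (Rep_conv_germ a)"
proof -
  have min_pos: "min (fls_conv_radius (Rep_conv_germ a)) (fls_conv_radius (Rep_conv_germ b)) > 0"
    by simp
  show "Rep_conv_germ 0 = 0" "Rep_conv_germ 1 = 1"
    unfolding zero_conv_germ_def one_conv_germ_def by (simp_all add: Abs_conv_germ_inverse)
  show "Rep_conv_germ (a + b) = Rep_conv_germ a + Rep_conv_germ b"
    unfolding plus_conv_germ_def using less_le_trans[OF min_pos fls_conv_radius_add]
    by (simp add: Abs_conv_germ_inverse)
  show "Rep_conv_germ (a - b) = Rep_conv_germ a - Rep_conv_germ b"
    unfolding minus_conv_germ_def using less_le_trans[OF min_pos fls_conv_radius_diff]
    by (simp add: Abs_conv_germ_inverse)
  show "Rep_conv_germ (- a) = - Rep_conv_germ a"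
    unfolding uminus_conv_germ_def by (simp add: Abs_conv_germ_inverse)
  show "Rep_conv_germ (a * b) = Rep_conv_germ a * Rep_conv_germ b"
    unfolding times_conv_germ_def using less_le_trans[OF min_pos fls_conv_radius_mult]
    by (simp add: Abs_conv_germ_inverse)
  show "Rep_conv_germ (inverse a) = inverse (Rep_conv_germ a)"
    unfolding inverse_conv_germ_def
    by (simp add: Abs_conv_germ_inverse fls_conv_radius_inverse_pos)
qed

lemma conv_germ_divide_eq: "a div b = a * inverse (b :: conv_germ)"
  by (simp add: divide_conv_germ_def times_conv_germ_def Rep_conv_germ_arith)

instance
  by standard
    (simp_all add: Rep_conv_germ_inject[symmetric] Rep_conv_germ_arith conv_germ_divide_eq
      algebra_simps)

end

lemmas Rep_conv_germ_simps [simp] = Rep_conv_germ_arith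

lemma Rep_conv_germ_sum [simp]: "Rep_conv_germ (sum f I) = (\<Sum>i\<in>I. Rep_conv_germ (f i))"
  by (induction I rule: infinite_finite_induct) simp_all

lemma Rep_conv_germ_eq_0_iff [simp]: "Rep_conv_germ a = 0 \<longleftrightarrow> a = 0"
  using Rep_conv_germ_inject[of a 0] by simp

unbundle no fps_syntax
notation fls_nth (infixl "$$" 75)

section \<open>Dilation of Laurent series and growth of their coefficients\<close>

definition fls_dilate :: "complex \<Rightarrow> complex fls \<Rightarrow> complex fls" where
  "fls_dilate c f = Abs_fls (\<lambda>n. c powi n * f $$ n)"

lemma fls_dilate_nth [simp]: "fls_dilate c f $$ n = c powi n * f $$ n"
  unfolding fls_dilate_def
  by (rule nth_Abs_fls_lower_bound[of "fls_subdegree f"]) simp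

lemma fls_dilate_add: "fls_dilate c (f + g) = fls_dilate c f + fls_dilate c g"
  and fls_dilate_diff: "fls_dilate c (f - g) = fls_dilate c f - fls_dilate c g"
  and fls_dilate_0 [simp]: "fls_dilate c 0 = 0"
  and fls_dilate_1 [simp]: "fls_dilate 1 f = f"
  by (simp_all add: fls_eq_iff algebra_simps)

lemma fls_dilate_dilate: "fls_dilate c (fls_dilate d f) = fls_dilate (c * d) f"
  by (simp add: fls_eq_iff power_int_mult_distrib)

lemma fls_dilate_sum: "fls_dilate c (sum f I) = (\<Sum>i\<in>I. fls_dilate c (f i))"
  by (induction I rule: infinite_finite_induct) (simp_all add: fls_dilate_add)

lemma fls_subdegree_dilate [simp]:
  assumes "c \<noteq> 0"
  shows "fls_subdegree (fls_dilate c f) = fls_subdegree f"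
proof (cases "f = 0")
  case False
  thus ?thesis using assms by (intro fls_subdegree_eqI) auto
qed simp

lemma fls_dilate_mult:
  assumes "c \<noteq> 0"
  shows "fls_dilate c (f * g) = fls_dilate c f * fls_dilate c g"
proof (rule fls_eqI)
  fix n
  have "c powi n * (f $$ i * g $$ (n - i)) = c powi i * f $$ i * (c powi (n - i) * g $$ (n - i))" for i
    using assms power_int_add[of c i "n - i"] by (simp add: algebra_simps)
  thus "fls_dilate c (f * g) $$ n = (fls_dilate c f * fls_dilate c g) $$ n"
    by (simp only: fls_times_nth(2) sum_distrib_left fls_dilate_nth fls_subdegree_dilate[OF assms])
qed

text \<open>A Cauchy estimate with its constants turned into exponents of \<open>Q\<close>, so that
  later comparisons become linear inequalities between exponents. Nonnegative constants can be added
  up to serve several series at once.\<close>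

lemma fls_nth_powr_bound:
  fixes Q :: real
  assumes "fls_conv_radius F > 0" "Q > 1"
  obtains \<mu> \<alpha> where "\<mu> \<ge> 0" "\<alpha> \<ge> 0" "\<And>n. norm (F $$ n) \<le> Q powr (\<alpha> + \<mu> * of_int n)"
proof -
  define sd where "sd = fls_subdegree F"
  obtain r where r: "r > 0" "ereal r < fls_conv_radius F"
    using ereal_dense2[OF assms(1)] by (auto simp: zero_ereal_def)
  have "summable (\<lambda>n. norm (F $$ (int n + sd) * complex_of_real r ^ n))"
    unfolding sd_def by (rule norm_summable_fls') (use r in auto)
  hence "(\<lambda>n. norm (F $$ (int n + sd) * complex_of_real r ^ n)) \<longlonglongrightarrow> 0"
    by (rule summable_LIMSEQ_zero)
  hence "Bseq (\<lambda>n. norm (F $$ (int n + sd) * complex_of_real r ^ n))"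
    by (intro convergent_imp_Bseq convergentI)
  then obtain C where C: "C > 0" "\<And>n. norm (F $$ (int n + sd)) * r ^ n \<le> C"
    using r by (auto simp: Bseq_def norm_mult norm_power)
  define \<mu> where "\<mu> = max 0 (- log Q r)"
  define \<beta> where "\<beta> = log Q C"
  have bound: "norm (F $$ n) \<le> Q powr (\<beta> + \<mu> * of_int (n - sd))" for n
  proof (cases "n < sd")
    case False
    define m where "m = nat (n - sd)"
    have m: "n = int m + sd" using False by (simp add: m_def)
    have rp: "r = Q powr (log Q r)" using r assms by simp
    have "r ^ m = Q powr (real m * log Q r)"
      by (subst rp) (use assms in \<open>simp add: powr_realpow[symmetric] powr_powr mult.commute\<close>)
    moreover have "real m * log Q r \<ge> real m * (- \<mu>)"
      by (intro mult_left_mono) (auto simp: \<mu>_def)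
    ultimately have "Q powr (- (real m * \<mu>)) \<le> r ^ m"
      using assms by simp
    hence "norm (F $$ n) * Q powr (- (real m * \<mu>)) \<le> C"
      using C(2)[of m] m by (metis mult_left_mono norm_ge_zero order_trans)
    hence "norm (F $$ n) \<le> C * Q powr (real m * \<mu>)"
      using assms by (simp add: powr_minus divide_simps mult.commute split: if_splits)
    also have "\<dots> = Q powr (\<beta> + \<mu> * of_int (n - sd))"
      using C assms by (simp add: powr_add \<beta>_def m mult.commute)
    finally show ?thesis .
  qed (simp add: sd_def)
  show ?thesis
  proof (rule that[of \<mu> "max 0 (\<beta> - \<mu> * of_int sd)"])
    show "norm (F $$ n) \<le> Q powr (max 0 (\<beta> - \<mu> * of_int sd) + \<mu> * of_int n)" for n
      by (rule order_trans[OF bound]) (use assms in \<open>simp add: algebra_simps\<close>)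
  qed (auto simp: \<mu>_def)
qed

lemma fls_conv_radius_dilate_pos:
  assumes "c \<noteq> 0" "fls_conv_radius F > 0"
  shows "fls_conv_radius (fls_dilate c F) > 0"
proof -
  obtain \<alpha> \<mu> where b: "\<And>n. norm (F $$ n) \<le> 2 powr (\<alpha> + \<mu> * of_int n)"
    using fls_nth_powr_bound[OF assms(2), of 2] by (metis one_less_numeral_iff semiring_norm(76))
  define r where "r = inverse (2 * norm c * 2 powr \<mu>)"
  have r: "r > 0" using assms by (simp add: r_def)
  have "summable (\<lambda>n. (fls_dilate c F) $$ (int n) * of_real r ^ n)"
  proof (rule summable_comparison_test')
    show "summable (\<lambda>n. 2 powr \<alpha> * (1/2) ^ n :: real)" by (intro summable_mult summable_geometric) auto
    fix n :: nat
    have "norm (fls_dilate c F $$ int n * of_real r ^ n) = norm c ^ n * norm (F $$ int n) * r ^ n"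
      using r by (simp add: norm_mult norm_power)
    also have "\<dots> \<le> norm c ^ n * 2 powr (\<alpha> + \<mu> * real n) * r ^ n"
      using b[of "int n"] r by (intro mult_right_mono mult_left_mono) auto
    also have "\<dots> = 2 powr \<alpha> * (norm c * 2 powr \<mu> * r) ^ n"
      by (simp add: powr_add powr_powr[symmetric] powr_realpow power_mult_distrib)
    also have "norm c * 2 powr \<mu> * r = 1/2" using assms by (simp add: r_def field_simps)
    finally show "norm (fls_dilate c F $$ int n * of_real r ^ n) \<le> 2 powr \<alpha> * (1/2) ^ n" .
  qed
  hence "conv_radius (\<lambda>n. fls_dilate c F $$ (int n)) \<ge> ereal (norm (of_real r :: complex))"
    by (rule conv_radius_geI)
  hence "fls_conv_radius (fls_dilate c F) \<ge> ereal r"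
    using r by (simp add: fls_conv_radius_def fps_conv_radius_def)
  thus ?thesis using r by (metis ereal_less(2) less_le_trans)
qed

definition germ_dilate :: "complex \<Rightarrow> conv_germ \<Rightarrow> conv_germ" where
  "germ_dilate c a = Abs_conv_germ (fls_dilate c (Rep_conv_germ a))"

lemma Rep_germ_dilate [simp]:
  "c \<noteq> 0 \<Longrightarrow> Rep_conv_germ (germ_dilate c a) = fls_dilate c (Rep_conv_germ a)"
  unfolding germ_dilate_def by (simp add: Abs_conv_germ_inverse fls_conv_radius_dilate_pos)

section \<open>Sequences of Laurent series\<close>

definition coeff_below :: "complex fls \<Rightarrow> int \<Rightarrow> bool" where
  "coeff_below f N \<longleftrightarrow> (\<forall>n<N. f $$ n = 0)"

lemma coeff_below_mult:
  assumes "coeff_below f M" "coeff_below g N"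
  shows "coeff_below (f * g) (M + N)"
proof -
  have "(f * g) $$ n = 0" if n: "n < M + N" for n
    unfolding fls_times_nth(2)
  proof (intro sum.neutral ballI)
    fix i
    show "f $$ i * g $$ (n - i) = 0"
      using assms n by (cases "i < M") (auto simp: coeff_below_def)
  qed
  thus ?thesis by (simp add: coeff_below_def)
qed

lemma sum_powr_neg_le:
  fixes Q :: real and a b :: int
  assumes "Q > 1"
  shows "(\<Sum>i=a..b. Q powr (- of_int (i - a))) \<le> Q / (Q - 1)"
proof -
  have "(\<Sum>i=a..b. Q powr (- of_int (i - a))) = (\<Sum>i<nat (b - a + 1). (1 / Q) ^ i)"
    by (rule sum.reindex_bij_witness[of _ "\<lambda>i. a + int i" "\<lambda>i. nat (i - a)"])
      (use assms in \<open>auto simp: powr_diff power_divide simp flip: powr_realpow\<close>)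
  also have "\<dots> \<le> (\<Sum>i. (1 / Q) ^ i)"
    by (rule sum_le_suminf) (use assms in \<open>auto intro!: summable_geometric\<close>)
  also have "\<dots> = Q / (Q - 1)"
    by (subst suminf_geometric) (use assms in \<open>auto simp: field_simps\<close>)
  finally show ?thesis .
qed

locale q_gt_one =
  fixes q :: complex
  assumes q_gt_1: "norm q > 1"
begin

abbreviation Q :: real where "Q \<equiv> norm q"

lemma q_nonzero [simp]: "q \<noteq> 0" using q_gt_1 by auto

lemma Q_pos [simp]: "Q > 0" by simp

lemma norm_q_powi: "norm (q powi n) = Q powr of_int n"
  by (simp add: norm_power_int powr_real_of_int' )

lemma Q_powr_le_iff [simp]: "Q powr a \<le> Q powr b \<longleftrightarrow> a \<le> b"
  using q_gt_1 by simp

lemma eventually_real_of_int_ge: "\<forall>\<^sub>F k in at_top. (C :: real) \<le> of_int k"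
  using eventually_ge_at_top[of "\<lceil>C\<rceil>"] by eventually_elim linarith

lemma eventually_at_top_shift:
  "eventually P at_top \<Longrightarrow> \<forall>\<^sub>F k :: int in at_top. P (k - j)"
proof -
  assume "eventually P at_top"
  then obtain N where N: "\<And>k. k \<ge> N \<Longrightarrow> P k" by (auto simp: eventually_at_top_linorder)
  show ?thesis using eventually_ge_at_top[of "N + j"] by eventually_elim (auto intro: N)
qed

text \<open>The component with index \<open>k\<close> of a sequence stands for a function on \<open>q\<^sup>-\<^sup>k U\<^sub>0\<close>, so
  \<open>shift 1\<close> is \<open>\<sigma>\<^sub>q\<close>.\<close>

definition shift :: "int \<Rightarrow> (int \<Rightarrow> complex fls) \<Rightarrow> int \<Rightarrow> complex fls" where
  "shift j x k = fls_dilate (q powi j) (x (k - j))"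

lemma shift_nth [simp]: "shift j x k $$ n = q powi (j * n) * x (k - j) $$ n"
  by (simp add: shift_def power_int_mult)

lemma shift_shift: "shift i (shift j x) = shift (i + j) x"
  by (rule ext) (simp add: shift_def fls_dilate_dilate power_int_add algebra_simps)

lemma shift_0 [simp]: "shift 0 x = x"
  by (rule ext) (simp add: shift_def)

text \<open>Tempered sequences converge on discs of radius \<open>Q\<^bsup>-(1-\<epsilon>)k\<^esup>\<close>, which contain
  \<open>q\<^sup>-\<^sup>k K\<close> eventually for every compact \<open>K\<close>.\<close>

definition tempered_by :: "real \<Rightarrow> real \<Rightarrow> (int \<Rightarrow> complex fls) \<Rightarrow> bool" where
  "tempered_by \<epsilon> v x \<longleftrightarrow> (\<forall>\<^sub>F k in at_top. \<forall>n.
     norm (x k $$ n) \<le> Q powr (of_int k * ((1 - \<epsilon>) * of_int n + v)) \<and>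
     (of_int n < -v \<longrightarrow> x k $$ n = 0))"

definition tempered :: "(int \<Rightarrow> complex fls) \<Rightarrow> bool" where
  "tempered x \<longleftrightarrow> (\<exists>\<epsilon> v. 0 < \<epsilon> \<and> \<epsilon> < 1 \<and> v \<ge> 0 \<and> tempered_by \<epsilon> v x)"

text \<open>The factor 2 is due to negative n: there a smaller \<epsilon> lowers
  \<open>(1 - \<epsilon>) n\<close>, but by at most v, because the coefficients below
  \<open>-v\<close> vanish.\<close>

lemma tempered_by_weaken:
  assumes "tempered_by \<epsilon> v x" "\<epsilon>' \<le> \<epsilon>" "0 \<le> \<epsilon>'" "\<epsilon> \<le> 1" "v \<ge> 0" "2 * v \<le> v'"
  shows "tempered_by \<epsilon>' v' x"
  using assms(1) eventually_ge_at_top[of 0] unfolding tempered_by_def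
  apply eventually_elim
  apply (rule allI)
  subgoal premises elim for k n
  proof -
  have "norm (x k $$ n) \<le> Q powr (of_int k * ((1 - \<epsilon>') * of_int n + v'))"
  proof (cases "of_int n < -v")
    case False
    have "- ((\<epsilon> - \<epsilon>') * of_int n) \<le> (\<epsilon> - \<epsilon>') * v"
      using mult_left_mono[of "- of_int n" v "\<epsilon> - \<epsilon>'"] False assms by simp
    also have "\<dots> \<le> 1 * v" using assms by (intro mult_right_mono) auto
    finally have "of_int k * ((1 - \<epsilon>) * of_int n + v) \<le> of_int k * ((1 - \<epsilon>') * of_int n + v')"
      using elim(2) assms by (intro mult_left_mono) (auto simp: algebra_simps)
    thus ?thesis using elim(1) by (meson Q_powr_le_iff order_trans)
  qed (use elim in auto)
  thus ?thesis using elim assms by force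
  qed
  done

lemma tempered_common:
  assumes "finite I" "\<And>i. i \<in> I \<Longrightarrow> tempered (x i)"
  obtains \<epsilon> v where "0 < \<epsilon>" "\<epsilon> < 1" "v \<ge> 0" "\<And>i. i \<in> I \<Longrightarrow> tempered_by \<epsilon> v (x i)"
proof -
  have "\<exists>\<epsilon> v. 0 < \<epsilon> \<and> \<epsilon> < 1 \<and> v \<ge> 0 \<and> (\<forall>i\<in>I. tempered_by \<epsilon> v (x i))"
    using assms
  proof (induction I rule: finite_induct)
    case empty
    show ?case by (intro exI[of _ "1/2"] exI[of _ 0]) auto
  next
    case (insert j I)
    then obtain \<epsilon> v where 1: "0 < \<epsilon>" "\<epsilon> < 1" "v \<ge> 0" "\<forall>i\<in>I. tempered_by \<epsilon> v (x i)" by auto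
    obtain \<epsilon>' v' where 2: "0 < \<epsilon>'" "\<epsilon>' < 1" "v' \<ge> 0" "tempered_by \<epsilon>' v' (x j)"
      using insert.prems[of j] by (auto simp: tempered_def)
    have "tempered_by (min \<epsilon> \<epsilon>') (2 * v + 2 * v') (x i)" if "i \<in> insert j I" for i
    proof (cases "i = j")
      case True
      show ?thesis unfolding True by (rule tempered_by_weaken[OF 2(4)]) (use 1 2 in auto)
    next
      case False
      hence "tempered_by \<epsilon> v (x i)" using that 1 by auto
      thus ?thesis by (rule tempered_by_weaken) (use 1 2 in auto)
    qed
    thus ?case using 1 2 by (intro exI[of _ "min \<epsilon> \<epsilon>'"] exI[of _ "2 * v + 2 * v'"]) auto
  qed
  thus ?thesis using that by blast
qed

lemma tempered_cong:
  assumes "tempered x" "\<forall>\<^sub>F k in at_top. \<forall>n. norm (y k $$ n) \<le> norm (x k $$ n)"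
  shows "tempered y"
proof -
  obtain \<epsilon> v where 1: "0 < \<epsilon>" "\<epsilon> < 1" "v \<ge> 0" "tempered_by \<epsilon> v x"
    using assms(1) by (auto simp: tempered_def)
  have "tempered_by \<epsilon> v y"
    using 1(4) assms(2) unfolding tempered_by_def
  proof eventually_elim
    case (elim k)
    show ?case
    proof (intro allI conjI impI)
      fix n
      show "norm (y k $$ n) \<le> Q powr (of_int k * ((1 - \<epsilon>) * of_int n + v))"
        using elim by (blast intro: order_trans)
      show "y k $$ n = 0" if "of_int n < - v"
      proof -
        have "norm (y k $$ n) \<le> norm (x k $$ n)" "x k $$ n = 0" using elim that by blast+
        thus ?thesis by simp
      qed
    qed
  qed
  thus ?thesis using 1 by (auto simp: tempered_def)
qed

lemma tempered_add:
  assumes "tempered x" "tempered y"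
  shows "tempered (\<lambda>k. x k + y k)"
proof -
  have "tempered (if i then x else y)" for i using assms by simp
  from tempered_common[of "UNIV :: bool set" "\<lambda>i. if i then x else y", OF finite this]
  obtain \<epsilon> v where 1: "0 < \<epsilon>" "\<epsilon> < 1" "v \<ge> 0"
      and b: "\<And>i. i \<in> UNIV \<Longrightarrow> tempered_by \<epsilon> v (if i then x else y)"
    by blast
  have bx: "tempered_by \<epsilon> v x" and "by": "tempered_by \<epsilon> v y"
    using b[of True] b[of False] by simp_all
  \<comment> \<open>For large k the factor 2 is at most \<open>Q^k\<close>, which raising v by 1
    provides. Other constants are absorbed in the same way.\<close>
  have "tempered_by \<epsilon> (v + 1) (\<lambda>k. x k + y k)"
    using bx "by" eventually_real_of_int_ge[of "log Q 2"] unfolding tempered_by_def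
    apply eventually_elim
    apply (rule allI)
    subgoal premises elim for k n
    proof -
    let ?e = "of_int k * ((1 - \<epsilon>) * of_int n + v)"
    have "norm ((x k + y k) $$ n) \<le> norm (x k $$ n) + norm (y k $$ n)"
      by (simp add: norm_triangle_ineq)
    also have "norm (x k $$ n) \<le> Q powr ?e" using elim(1) by blast
    also have "norm (y k $$ n) \<le> Q powr ?e" using elim(2) by blast
    also have "Q powr ?e + Q powr ?e = 2 * Q powr ?e" by simp
    also have "\<dots> = Q powr (log Q 2 + ?e)" using q_gt_1 by (simp add: powr_add)
    also have "\<dots> \<le> Q powr (of_int k * ((1 - \<epsilon>) * of_int n + (v + 1)))"
      using elim(3) by (simp add: algebra_simps)
    finally show ?thesis using elim 1 by auto
    qed
    done
  thus ?thesis using 1 unfolding tempered_def by (intro exI[of _ \<epsilon>] exI[of _ "v + 1"]) auto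
qed

text \<open>For large k the growth rate \<mu> of \<open>a\<close> is beaten by the rate
  \<open>(1 - \<epsilon>) k\<close> of \<open>x k\<close>, so the convolution is dominated by a
  geometric series starting at the lowest index \<open>i = -w\<close>. That first term costs at most
  \<open>k w\<close> in the exponent, hence the new constant \<open>v + w + 1\<close>.\<close>

lemma tempered_mult:
  assumes "fls_conv_radius a > 0" "tempered x"
  shows "tempered (\<lambda>k. a * x k)"
proof -
  obtain \<epsilon> v where 1: "0 < \<epsilon>" "\<epsilon> < 1" "v \<ge> 0" "tempered_by \<epsilon> v x"
    using assms(2) by (auto simp: tempered_def)
  obtain \<mu> \<alpha> where a: "\<mu> \<ge> 0" "\<alpha> \<ge> 0" "\<And>n. norm (a $$ n) \<le> Q powr (\<alpha> + \<mu> * of_int n)"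
    using fls_nth_powr_bound[OF assms(1) q_gt_1] by metis
  define w where "w = max 0 (- fls_subdegree a)"
  have w: "w \<ge> 0" "- w \<le> fls_subdegree a" by (auto simp: w_def)
  define \<beta> where "\<beta> = log Q (Q / (Q - 1))"
  have "tempered_by \<epsilon> (v + w + 1) (\<lambda>k. a * x k)"
    using 1(4) eventually_real_of_int_ge[of "\<alpha> + \<beta>"] eventually_real_of_int_ge[of "(\<mu> + 1) / (1 - \<epsilon>)"]
      eventually_ge_at_top[of 0]
    unfolding tempered_by_def
    apply eventually_elim
    apply (rule allI)
    subgoal premises elim for k n
    proof -
    define E where "E = of_int k * ((1 - \<epsilon>) * of_int n + v + of_int w) + \<alpha>"
    have k: "\<mu> + 1 \<le> of_int k * (1 - \<epsilon>)" using elim(3) 1 by (simp add: field_simps)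
    have k': "of_int k * (1 - \<epsilon>) \<le> of_int k" using elim(4) 1 mult_left_mono[of "1 - \<epsilon>" 1 "of_int k"] by simp
    define S where "S = {fls_subdegree a..n - fls_subdegree (x k)}"
    have bound: "norm (a $$ i * x k $$ (n - i)) \<le> Q powr E * Q powr (- of_int (i - (-w)))"
      if "i \<in> S" for i
    proof -
      have i: "i + w \<ge> 0" using that w by (auto simp: S_def)
      have "norm (a $$ i * x k $$ (n - i)) \<le>
          Q powr (\<alpha> + \<mu> * of_int i) * Q powr (of_int k * ((1 - \<epsilon>) * of_int (n - i) + v))"
        unfolding norm_mult using a(3)[of i] elim(1)[rule_format, of "n - i"]
        by (intro mult_mono) auto
      also have "\<dots> = Q powr (\<alpha> + \<mu> * of_int i + of_int k * ((1 - \<epsilon>) * of_int (n - i) + v))"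
        by (simp add: powr_add)
      also have "\<alpha> + \<mu> * of_int i + of_int k * ((1 - \<epsilon>) * of_int (n - i) + v) =
          \<alpha> + of_int k * ((1 - \<epsilon>) * of_int n + v)
            - (of_int k * (1 - \<epsilon>) - \<mu>) * (of_int i + of_int w) + (of_int k * (1 - \<epsilon>) - \<mu>) * of_int w"
        by (simp add: algebra_simps)
      also have "\<dots> \<le> \<alpha> + of_int k * ((1 - \<epsilon>) * of_int n + v)
            - 1 * (of_int i + of_int w) + of_int k * of_int w"
      proof -
        have "1 * (of_int i + of_int w) \<le> (of_int k * (1 - \<epsilon>) - \<mu>) * (of_int i + of_int w)"
          using k i by (intro mult_right_mono) (auto simp flip: of_int_add)
        moreover have "(of_int k * (1 - \<epsilon>) - \<mu>) * of_int w \<le> of_int k * of_int w"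
          using k' a w by (intro mult_right_mono) auto
        ultimately show ?thesis by linarith
      qed
      also have "\<dots> = E + - of_int (i - (-w))" by (simp add: E_def algebra_simps)
      finally show ?thesis by (simp add: powr_add)
    qed
    have "norm ((a * x k) $$ n) \<le> (\<Sum>i\<in>S. norm (a $$ i * x k $$ (n - i)))"
      unfolding fls_times_nth(2) S_def by (rule norm_sum)
    also have "\<dots> \<le> (\<Sum>i\<in>S. Q powr E * Q powr (- of_int (i - (-w))))"
      by (intro sum_mono bound)
    also have "\<dots> \<le> (\<Sum>i=-w..n - fls_subdegree (x k). Q powr E * Q powr (- of_int (i - (-w))))"
      using w by (intro sum_mono2) (auto simp: S_def)
    also have "\<dots> \<le> Q powr E * (Q / (Q - 1))"
      unfolding sum_distrib_left[symmetric] by (intro mult_left_mono sum_powr_neg_le q_gt_1) auto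
    also have "\<dots> = Q powr (E + \<beta>)" using q_gt_1 by (simp add: powr_add \<beta>_def)
    also have "\<dots> \<le> Q powr (of_int k * ((1 - \<epsilon>) * of_int n + (v + of_int w + 1)))"
      using elim(2) by (simp add: E_def algebra_simps)
    finally have "norm ((a * x k) $$ n) \<le> \<dots>" .
    moreover have "(a * x k) $$ n = 0" if "of_int n < - (v + of_int w + 1)"
    proof -
      have "coeff_below a (-w)" using w by (auto simp: coeff_below_def)
      moreover have "coeff_below (x k) (\<lceil>-v\<rceil>)"
        using elim(1) unfolding coeff_below_def less_ceiling_iff by blast
      ultimately have "coeff_below (a * x k) (- w + \<lceil>-v\<rceil>)" by (rule coeff_below_mult)
      moreover have "n < - w + \<lceil>-v\<rceil>" using that by linarith
      ultimately show ?thesis by (auto simp: coeff_below_def)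
    qed
    ultimately show ?thesis by (intro conjI impI) auto
    qed
    done
  moreover have "v + w + 1 \<ge> 0" using 1 w by simp
  ultimately show ?thesis
    using 1 unfolding tempered_def by (intro exI[of _ \<epsilon>] exI[of _ "v + of_int w + 1"]) auto
qed

text \<open>The factor \<open>Q^(j n)\<close> and the lag in k together change the exponent by
  \<open>\<epsilon> j n - j v\<close>. Halving \<epsilon> pays for the first part once
  \<open>k \<ge> 2 |j|\<close>; the constant \<open>3 v\<close> covers the second part and the
  negative n.\<close>

lemma tempered_shift:
  assumes "tempered x"
  shows "tempered (shift j x)"
proof -
  obtain \<epsilon> v where 1: "0 < \<epsilon>" "\<epsilon> < 1" "v \<ge> 0" "tempered_by \<epsilon> v x"
    using assms by (auto simp: tempered_def)
  have "tempered_by (\<epsilon> / 2) (3 * v) (shift j x)"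
    using 1(4)[unfolded tempered_by_def, THEN eventually_at_top_shift, of j]
      eventually_ge_at_top[of "2 * \<bar>j\<bar>"]
    unfolding tempered_by_def
    apply eventually_elim
    apply (rule allI)
    subgoal premises elim for k n
    proof -
    have k: "of_int k \<ge> 2 * \<bar>of_int j :: real\<bar>" using elim(2) by linarith
    show ?thesis
    proof (cases "of_int n < -v")
      case False
      define m where "m = of_int n + v"
      have m: "m \<ge> 0" "of_int n = m - v" using False by (auto simp: m_def)
      have 2: "(of_int k / 2 - of_int j) * (\<epsilon> * m) \<ge> 0"
        using k m 1 by (intro mult_nonneg_nonneg) auto
      have "of_int j * ((-1 - \<epsilon>) * v) \<le> \<bar>of_int j * ((-1 - \<epsilon>) * v)\<bar>" by simp
      also have "\<dots> = \<bar>of_int j\<bar> * ((1 + \<epsilon>) * v)" using 1 by (simp add: abs_mult)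
      also have "\<dots> \<le> (of_int k / 2) * (2 * v)" using k 1 by (intro mult_mono) auto
      finally have 3: "of_int j * ((-1 - \<epsilon>) * v) \<le> of_int k * v" by simp
      have 4: "of_int k * (\<epsilon> * v) \<le> of_int k * (2 * v)" using k 1 by (intro mult_left_mono mult_right_mono) auto
      have "norm (shift j x k $$ n) = Q powr (of_int j * of_int n) * norm (x (k - j) $$ n)"
        by (simp add: norm_mult norm_q_powi)
      also have "\<dots> \<le> Q powr (of_int j * of_int n) * Q powr (of_int (k - j) * ((1 - \<epsilon>) * of_int n + v))"
        using elim(1)[rule_format, of n] by (intro mult_left_mono) auto
      also have "\<dots> = Q powr (of_int j * of_int n + of_int (k - j) * ((1 - \<epsilon>) * of_int n + v))"
        by (simp add: powr_add)
      also have "\<dots> \<le> Q powr (of_int k * ((1 - \<epsilon> / 2) * of_int n + 3 * v))"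
      proof -
        have "of_int k * ((1 - \<epsilon> / 2) * (m - v) + 3 * v) -
            (of_int j * (m - v) + of_int (k - j) * ((1 - \<epsilon>) * (m - v) + v)) =
            (of_int k / 2 - of_int j) * (\<epsilon> * m) + (of_int k * v - of_int j * ((-1 - \<epsilon>) * v))
            + (of_int k * (2 * v) - of_int k * (\<epsilon> * v)) / 2"
          by (simp add: field_simps)
        also have "\<dots> \<ge> 0" using 2 3 4 by (intro add_nonneg_nonneg) auto
        finally show ?thesis unfolding Q_powr_le_iff m(2) by (simp only: diff_ge_0_iff_ge)
      qed
      finally show ?thesis using 1 False by auto
    qed (use elim 1 in auto)
    qed
    done
  thus ?thesis using 1 unfolding tempered_def by (intro exI[of _ "\<epsilon> / 2"] exI[of _ "3 * v"]) auto
qed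

section \<open>Flat sequences\<close>

definition vanishing :: "(int \<Rightarrow> complex fls) \<Rightarrow> bool" where
  "vanishing x \<longleftrightarrow> (\<forall>N. \<forall>\<^sub>F k in at_top. coeff_below (x k) N)"

definition flat :: "(int \<Rightarrow> complex fls) \<Rightarrow> bool" where
  "flat x \<longleftrightarrow> tempered x \<and> vanishing x"

lemma vanishing_cong:
  assumes "vanishing x" "\<forall>\<^sub>F k in at_top. \<forall>n. norm (y k $$ n) \<le> norm (x k $$ n)"
  shows "vanishing y"
  unfolding vanishing_def
proof
  fix N
  have "\<forall>\<^sub>F k in at_top. coeff_below (x k) N" using assms by (auto simp: vanishing_def)
  thus "\<forall>\<^sub>F k in at_top. coeff_below (y k) N"
    using assms(2)
  proof eventually_elim
    case (elim k)
    have "y k $$ n = 0" if "n < N" for n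
    proof -
      have "norm (y k $$ n) \<le> norm (x k $$ n)" "x k $$ n = 0"
        using elim that unfolding coeff_below_def by blast+
      thus ?thesis by simp
    qed
    thus ?case by (simp add: coeff_below_def)
  qed
qed

lemma vanishing_zero: "vanishing (\<lambda>k. 0)"
  by (simp add: vanishing_def coeff_below_def)

lemma vanishing_add:
  assumes "vanishing x" "vanishing y"
  shows "vanishing (\<lambda>k. x k + y k)"
  unfolding vanishing_def
proof
  fix N
  have "\<forall>\<^sub>F k in at_top. coeff_below (x k) N" "\<forall>\<^sub>F k in at_top. coeff_below (y k) N"
    using assms by (auto simp: vanishing_def)
  thus "\<forall>\<^sub>F k in at_top. coeff_below (x k + y k) N"
    by eventually_elim (auto simp: coeff_below_def)
qed

lemma vanishing_mult:
  assumes "vanishing x"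
  shows "vanishing (\<lambda>k. a * x k)"
  unfolding vanishing_def
proof
  fix N
  have "\<forall>\<^sub>F k in at_top. coeff_below (x k) (N - fls_subdegree a)"
    using assms by (auto simp: vanishing_def)
  thus "\<forall>\<^sub>F k in at_top. coeff_below (a * x k) N"
  proof eventually_elim
    case (elim k)
    have "coeff_below a (fls_subdegree a)" by (auto simp: coeff_below_def)
    from coeff_below_mult[OF this elim] show ?case by simp
  qed
qed

lemma vanishing_shift:
  assumes "vanishing x"
  shows "vanishing (shift j x)"
  unfolding vanishing_def
proof
  fix N
  have "\<forall>\<^sub>F k in at_top. coeff_below (x k) N" using assms by (auto simp: vanishing_def)
  hence "\<forall>\<^sub>F k in at_top. coeff_below (x (k - j)) N" by (rule eventually_at_top_shift)
  thus "\<forall>\<^sub>F k in at_top. coeff_below (shift j x k) N"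
    by eventually_elim (auto simp: coeff_below_def)
qed

lemma vanishing_uminus: "vanishing x \<Longrightarrow> vanishing (\<lambda>k. - x k)"
  by (erule vanishing_cong) auto

lemma vanishing_diff: "vanishing x \<Longrightarrow> vanishing y \<Longrightarrow> vanishing (\<lambda>k. x k - y k)"
  using vanishing_add[of x "\<lambda>k. - y k"] vanishing_uminus[of y] by simp

lemma vanishing_sum:
  "(\<And>i. i \<in> I \<Longrightarrow> vanishing (x i)) \<Longrightarrow> vanishing (\<lambda>k. \<Sum>i\<in>I. x i k)"
  by (induction I rule: infinite_finite_induct) (auto intro: vanishing_add vanishing_zero)

lemma tempered_zero: "tempered (\<lambda>k. 0)"
  unfolding tempered_def tempered_by_def
  by (intro exI[of _ "1/2"] exI[of _ 0]) auto

lemma tempered_uminus: "tempered x \<Longrightarrow> tempered (\<lambda>k. - x k)"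
  by (erule tempered_cong) auto

lemma tempered_diff: "tempered x \<Longrightarrow> tempered y \<Longrightarrow> tempered (\<lambda>k. x k - y k)"
  using tempered_add[of x "\<lambda>k. - y k"] tempered_uminus[of y] by simp

lemma tempered_sum:
  "(\<And>i. i \<in> I \<Longrightarrow> tempered (x i)) \<Longrightarrow> tempered (\<lambda>k. \<Sum>i\<in>I. x i k)"
  by (induction I rule: infinite_finite_induct) (auto intro: tempered_add tempered_zero)

lemma flat_zero: "flat (\<lambda>k. 0)"
  by (simp add: flat_def tempered_zero vanishing_zero)

lemma flat_add: "flat x \<Longrightarrow> flat y \<Longrightarrow> flat (\<lambda>k. x k + y k)"
  by (simp add: flat_def tempered_add vanishing_add)

lemma flat_mult: "fls_conv_radius a > 0 \<Longrightarrow> flat x \<Longrightarrow> flat (\<lambda>k. a * x k)"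
  by (simp add: flat_def tempered_mult vanishing_mult)

lemma flat_shift: "flat x \<Longrightarrow> flat (shift j x)"
  by (simp add: flat_def tempered_shift vanishing_shift)

lemma flat_diff: "flat x \<Longrightarrow> flat y \<Longrightarrow> flat (\<lambda>k. x k - y k)"
  by (simp add: flat_def tempered_diff vanishing_diff)

lemma flat_sum: "(\<And>i. i \<in> I \<Longrightarrow> flat (x i)) \<Longrightarrow> flat (\<lambda>k. \<Sum>i\<in>I. x i k)"
  by (simp add: flat_def tempered_sum vanishing_sum)

text \<open>For large k only degrees \<open>n \<ge> 2 v / \<epsilon>\<close> survive, and there
  \<open>v \<le> \<epsilon> n / 2\<close>: flatness trades the constant v for half of
  \<epsilon>.\<close>

lemma flat_bound:
  assumes "flat x"
  obtains \<epsilon> where "0 < \<epsilon>" "\<epsilon> < 1"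
    "\<forall>\<^sub>F k in at_top. \<forall>n. norm (x k $$ n) \<le> Q powr ((1 - \<epsilon>) * of_int k * of_int n)"
proof -
  obtain \<epsilon> v where 1: "0 < \<epsilon>" "\<epsilon> < 1" "v \<ge> 0" "tempered_by \<epsilon> v x"
    using assms by (auto simp: tempered_def flat_def)
  have "\<forall>\<^sub>F k in at_top. coeff_below (x k) \<lceil>2 * v / \<epsilon>\<rceil>" using assms by (auto simp: flat_def vanishing_def)
  hence "\<forall>\<^sub>F k in at_top. \<forall>n. norm (x k $$ n) \<le> Q powr ((1 - \<epsilon> / 2) * of_int k * of_int n)"
    using 1(4) eventually_ge_at_top[of 0] unfolding tempered_by_def
    apply eventually_elim
    apply (rule allI)
    subgoal premises elim for k n
    proof -
    show ?thesis
    proof (cases "n < \<lceil>2 * v / \<epsilon>\<rceil>")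
      case True
      thus ?thesis using elim(1) by (simp add: coeff_below_def)
    next
      case False
      hence "2 * v / \<epsilon> \<le> of_int n" by linarith
      hence "v \<le> \<epsilon> / 2 * of_int n" using 1 by (simp add: field_simps)
      hence "of_int k * ((1 - \<epsilon>) * of_int n + v) \<le> of_int k * ((1 - \<epsilon> / 2) * of_int n)"
        using elim(3) by (intro mult_left_mono) (auto simp: algebra_simps)
      hence "Q powr (of_int k * ((1 - \<epsilon>) * of_int n + v)) \<le> Q powr ((1 - \<epsilon> / 2) * of_int k * of_int n)"
        by (simp add: mult.assoc mult.left_commute)
      thus ?thesis using elim(2) by (meson order_trans)
    qed
    qed
    done
  thus ?thesis using 1 by (intro that[of "\<epsilon> / 2"]) auto
qed

end

section \<open>Scalar equations\<close>

text \<open>The Neumann series converges pointwise and the weighted bound is carried along at every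
  point, so no normed space of sequences is set up. The weight may vanish, and then forces the
  solution to vanish there: \<open>u\<close> prescribes a support as well as a size.\<close>

lemma weighted_neumann:
  fixes R :: "('p \<Rightarrow> complex) \<Rightarrow> 'p \<Rightarrow> complex" and u :: "'p \<Rightarrow> real"
  assumes diff: "\<And>x y. R (\<lambda>p. x p - y p) = (\<lambda>p. R x p - R y p)"
    and contr: "\<And>x C p. C \<ge> 0 \<Longrightarrow> (\<And>p. norm (x p) \<le> C * u p) \<Longrightarrow> norm (R x p) \<le> C / 2 * u p"
    and g: "\<And>p. norm (g p) \<le> u p"
  obtains y where "\<forall>p. norm (y p) \<le> 2 * u p" "\<forall>p. y p + R y p = g p"
proof -
  have u: "u p \<ge> 0" for p using g[of p] norm_ge_zero order_trans by blast
  define s where "s = rec_nat (\<lambda>p. 0) (\<lambda>_ x p. g p - R x p)"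
  have s0: "s 0 = (\<lambda>p. 0)" and sS: "s (Suc t) = (\<lambda>p. g p - R (s t) p)" for t
    by (simp_all add: s_def)
  have R0: "R (\<lambda>p. 0) p = 0" for p
    using contr[of 0 "\<lambda>p. 0" p] by simp
  have step: "norm (s (Suc t) p - s t p) \<le> (1 / 2) ^ t * u p" for t p
  proof (induction t arbitrary: p)
    case 0
    show ?case using g[of p] by (simp add: s0 sS R0)
  next
    case (Suc t)
    have "norm (R (\<lambda>p. s (Suc t) p - s t p) p) \<le> (1 / 2) ^ t / 2 * u p"
      by (rule contr) (use Suc in auto)
    moreover have "R (\<lambda>p. s (Suc t) p - s t p) p = R (s (Suc t)) p - R (s t) p"
      using diff[of "s (Suc t)" "s t"] by simp
    moreover have "s (Suc (Suc t)) p = g p - R (s (Suc t)) p" "s (Suc t) p = g p - R (s t) p"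
      by (simp_all only: sS)
    ultimately show ?case by (simp add: norm_minus_commute)
  qed
  \<comment> \<open>The partial geometric sum is kept exactly, since the bound
    \<open>2 * (1 / 2) ^ t\<close> alone would not survive the induction on m.\<close>
  have far: "norm (s (t + m) p - s t p) \<le> (2 - 2 * (1 / 2) ^ m) * (1 / 2) ^ t * u p" for t m p
  proof (induction m)
    case (Suc m)
    have "norm (s (t + Suc m) p - s t p) \<le>
        norm (s (Suc (t + m)) p - s (t + m) p) + norm (s (t + m) p - s t p)"
      using norm_triangle_ineq[of "s (Suc (t + m)) p - s (t + m) p" "s (t + m) p - s t p"] by simp
    also have "\<dots> \<le> (1 / 2) ^ (t + m) * u p + (2 - 2 * (1 / 2) ^ m) * (1 / 2) ^ t * u p"
      by (intro add_mono step Suc)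
    also have "\<dots> = (2 - 2 * (1 / 2) ^ Suc m) * (1 / 2) ^ t * u p"
      by (simp add: power_add algebra_simps)
    finally show ?case .
  qed simp
  have far': "norm (s (t + m) p - s t p) \<le> 2 * (1 / 2) ^ t * u p" for t m p
    by (rule order_trans[OF far]) (use u[of p] in \<open>auto intro!: mult_right_mono\<close>)
  define y where "y p = lim (\<lambda>t. s t p)" for p
  have y: "(\<lambda>t. s t p) \<longlonglongrightarrow> y p" for p
  proof -
    have "summable (\<lambda>t. s (Suc t) p - s t p)"
      by (rule summable_comparison_test'[where g = "\<lambda>t. (1 / 2) ^ t * u p"])
        (use step in \<open>auto intro!: summable_mult2 summable_geometric\<close>)
    hence "convergent (\<lambda>n. \<Sum>t<n. s (Suc t) p - s t p)"
      by (simp add: summable_iff_convergent)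
    moreover have "(\<Sum>t<n. s (Suc t) p - s t p) = s n p" for n
      by (induction n) (simp_all add: s0)
    ultimately show ?thesis by (simp add: y_def convergent_LIMSEQ_iff)
  qed
  have near: "norm (y p - s t p) \<le> 2 * (1 / 2) ^ t * u p" for p t
  proof (rule LIMSEQ_le_const2)
    show "(\<lambda>m. norm (s (m + t) p - s t p)) \<longlonglongrightarrow> norm (y p - s t p)"
      by (intro tendsto_norm tendsto_diff LIMSEQ_ignore_initial_segment[OF y] tendsto_const)
    show "\<exists>N. \<forall>m\<ge>N. norm (s (m + t) p - s t p) \<le> 2 * (1 / 2) ^ t * u p"
      using far'[of t _ p] by (intro exI[of _ 0] allI impI) (simp add: add.commute)
  qed
  have "y p + R y p = g p" for p
  proof -
    have small: "norm (y p + R y p - g p) \<le> (1 / 2) ^ t * (2 * u p)" for t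
    proof -
      have "norm (R (\<lambda>p. y p - s t p) p) \<le> 2 * (1 / 2) ^ t / 2 * u p"
        by (rule contr) (use near in auto)
      hence "norm (R y p - R (s t) p) \<le> (1 / 2) ^ t * u p" by (simp add: diff)
      moreover have "norm (y p - s (Suc t) p) \<le> (1 / 2) ^ t * u p"
        using near[of p "Suc t"] by simp
      moreover have eq: "y p + R y p - g p = (y p - s (Suc t) p) + (R y p - R (s t) p)"
        by (simp add: sS)
      ultimately show ?thesis
        unfolding eq using norm_triangle_ineq[of "y p - s (Suc t) p" "R y p - R (s t) p"] by linarith
    qed
    have "(\<lambda>t. (1 / 2) ^ t * (2 * u p)) \<longlonglongrightarrow> 0 * (2 * u p)"
      by (intro tendsto_mult tendsto_const LIMSEQ_power_zero) simp
    hence "norm (y p + R y p - g p) \<le> 0"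
      using small by (intro LIMSEQ_le_const[of _ 0]) auto
    thus ?thesis by simp
  qed
  moreover have "norm (y p) \<le> 2 * u p" for p using near[of p 0] by (simp add: s0)
  ultimately show ?thesis using that by blast
qed

text \<open>\<open>N k\<close> will be an order to which the k-th component vanishes, growing so
  slowly that a lag of d indices costs at most one order; a simple zero of \<open>b i\<close> for
  \<open>i > I\<close> repays it. The bound \<open>N k \<le> k\<close> will keep the high-degree
  part away from the range \<open>n < N k\<close>.\<close>

lemma slow_sequence:
  fixes P :: "int \<Rightarrow> int \<Rightarrow> bool" and d :: nat
  assumes "\<And>N. \<forall>\<^sub>F k in at_top. P k N"
  obtains N :: "int \<Rightarrow> int" where "mono N" "\<forall>k. N k \<ge> 0" "\<forall>k\<ge>0. N k \<le> k"
    "\<forall>k. N k \<le> N (k - int d) + 1" "filterlim N at_top at_top" "\<forall>\<^sub>F k in at_top. P k (N k)"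
proof -
  obtain t where t: "\<And>m :: nat. \<And>k. k \<ge> t m \<Longrightarrow> P k (int m)"
  proof -
    have "\<forall>m :: nat. \<exists>t. \<forall>k\<ge>t. P k (int m)"
      using assms unfolding eventually_at_top_linorder by blast
    thus ?thesis using that by metis
  qed
  \<comment> \<open>Consecutive thresholds are more than d apart, which gives
    \<open>N k \<le> N (k - d) + 1\<close>; they also satisfy \<open>T m \<ge> m\<close>, which
    gives \<open>N k \<le> k\<close>.\<close>
  define T where "T = rec_nat (max 0 (t 0)) (\<lambda>m s. max (s + int d + 1) (t (Suc m)))"
  have T0: "T 0 = max 0 (t 0)" and TS: "T (Suc m) = max (T m + int d + 1) (t (Suc m))" for m
    by (simp_all add: T_def)
  have T_ge: "int m \<le> T m" for m by (induction m) (auto simp: T0 TS)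
  have T_t: "t m \<le> T m" for m by (cases m) (auto simp: T0 TS)
  \<comment> \<open>The alternative \<open>m = 0\<close> keeps the set nonempty for small k, where
    no threshold has been passed.\<close>
  define M where "M k = Max {m. m = 0 \<or> T m \<le> k}" for k
  have fin: "finite {m. m = 0 \<or> T m \<le> k}" for k
  proof (rule finite_subset)
    show "{m. m = 0 \<or> T m \<le> k} \<subseteq> {..nat k}"
    proof
      fix m assume "m \<in> {m. m = 0 \<or> T m \<le> k}"
      thus "m \<in> {..nat k}" using T_ge[of m] by auto
    qed
  qed simp
  have M_in: "M k = 0 \<or> T (M k) \<le> k" for k
    using Max_in[OF fin[of k]] unfolding M_def by blast
  have M_ge: "m \<le> M k" if "T m \<le> k" for m k
    unfolding M_def by (rule Max_ge[OF fin]) (use that in auto)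
  show ?thesis
  proof (rule that[of "\<lambda>k. int (M k)"])
    show "mono (\<lambda>k. int (M k))"
    proof (rule monoI)
      fix k k' :: int assume "k \<le> k'"
      thus "int (M k) \<le> int (M k')" using M_in[of k] M_ge[of "M k" k'] by force
    qed
    have "int (M k) \<le> k" if "k \<ge> 0" for k
      using M_in[of k] T_ge[of "M k"] that by force
    thus "\<forall>k\<ge>0. int (M k) \<le> k" by blast
    have "int (M k) \<le> int (M (k - int d)) + 1" for k
    proof (cases "M k")
      case (Suc m)
      hence "T (Suc m) \<le> k" using M_in[of k] by auto
      hence "T m \<le> k - int d" by (simp add: TS)
      thus ?thesis using M_ge[of m] Suc by force
    qed simp
    thus "\<forall>k. int (M k) \<le> int (M (k - int d)) + 1" by blast
    show "filterlim (\<lambda>k. int (M k)) at_top at_top"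
      unfolding filterlim_at_top
    proof
      fix Z :: int
      show "\<forall>\<^sub>F k in at_top. Z \<le> int (M k)"
        using eventually_ge_at_top[of "T (nat Z)"] by eventually_elim (use M_ge in force)
    qed
    show "\<forall>\<^sub>F k in at_top. P k (int (M k))"
      using eventually_ge_at_top[of "T 0"]
    proof eventually_elim
      case (elim k)
      hence "T (M k) \<le> k" using M_in[of k] by auto
      thus ?case using T_t[of "M k"] by (intro t) auto
    qed
  qed simp
qed

context q_gt_one
begin

text \<open>Sums of the individual constants serve all series at once. Measuring the degree from the
  common lower end \<open>-w\<close> makes \<open>n + w\<close> nonnegative, so that enlarging \<mu>
  only weakens the bound.\<close>

lemma germs_common_bound:
  assumes "finite I" "\<And>i. i \<in> I \<Longrightarrow> fls_conv_radius (F i) > 0"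
  obtains \<alpha> \<mu> :: real and w :: int where "\<mu> \<ge> 0" "w \<ge> 0" "\<forall>i\<in>I. coeff_below (F i) (-w)"
    "\<forall>i\<in>I. \<forall>n. norm (F i $$ n) \<le> Q powr (\<alpha> + \<mu> * of_int (n + w))"
proof -
  have "\<exists>\<alpha> \<mu>. \<mu> \<ge> 0 \<and> \<alpha> \<ge> 0 \<and> (\<forall>n. norm (F i $$ n) \<le> Q powr (\<alpha> + \<mu> * of_int n))" if "i \<in> I" for i
    using fls_nth_powr_bound[OF assms(2)[OF that] q_gt_1] by metis
  then obtain \<alpha> \<mu> where b: "\<And>i. i \<in> I \<Longrightarrow> \<mu> i \<ge> 0" "\<And>i. i \<in> I \<Longrightarrow> \<alpha> i \<ge> 0"
    "\<And>i n. i \<in> I \<Longrightarrow> norm (F i $$ n) \<le> Q powr (\<alpha> i + \<mu> i * of_int n)"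
    by metis
  define w where "w = (\<Sum>i\<in>I. \<bar>fls_subdegree (F i)\<bar>)"
  have w: "- w \<le> fls_subdegree (F i)" if "i \<in> I" for i
    using member_le_sum[OF that, of "\<lambda>i. \<bar>fls_subdegree (F i)\<bar>"] assms(1) by (auto simp: w_def)
  have below: "coeff_below (F i) (-w)" if "i \<in> I" for i
    using w[OF that] by (auto simp: coeff_below_def)
  have w0: "w \<ge> 0" unfolding w_def by (intro sum_nonneg) auto
  show ?thesis
  proof (rule that[of "\<Sum>i\<in>I. \<mu> i" w "\<Sum>i\<in>I. \<alpha> i"], goal_cases)
    case 4
    show ?case
    proof (intro ballI allI)
      fix i n assume i: "i \<in> I"
      show "norm (F i $$ n) \<le> Q powr ((\<Sum>i\<in>I. \<alpha> i) + (\<Sum>i\<in>I. \<mu> i) * of_int (n + w))"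
      proof (cases "n < -w")
        case True
        thus ?thesis using below[OF i] by (simp add: coeff_below_def)
      next
        case False
        have "\<alpha> i \<le> (\<Sum>i\<in>I. \<alpha> i)" "\<mu> i \<le> (\<Sum>i\<in>I. \<mu> i)"
          using assms(1) b i by (auto intro!: member_le_sum)
        moreover have "\<mu> i * of_int n \<le> \<mu> i * of_int (n + w)"
          using b(1)[OF i] w0 by (intro mult_left_mono) auto
        moreover have "\<mu> i * of_int (n + w) \<le> (\<Sum>i\<in>I. \<mu> i) * of_int (n + w)"
          using False calculation by (intro mult_right_mono) (auto simp flip: of_int_add)
        ultimately have "\<alpha> i + \<mu> i * of_int n \<le> (\<Sum>i\<in>I. \<alpha> i) + (\<Sum>i\<in>I. \<mu> i) * of_int (n + w)"
          by linarith
        thus ?thesis using b(3)[OF i, of n] by (meson Q_powr_le_iff order_trans)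
      qed
    qed
  qed (use b w0 below in \<open>auto intro: sum_nonneg\<close>)
qed

text \<open>The coefficients of \<open>a\<close> grow at rate \<mu> in m while the bound on
  \<open>f\<close> decays at rate \<open>k \<ge> \<mu> + 1\<close>, so the convolution is dominated
  by a geometric series of ratio \<open>1 / Q\<close>. The offset w makes the decay start at the
  first index \<open>m = -w\<close>.\<close>

lemma mult_coeff_bound:
  fixes k :: real
  assumes a: "\<And>m. norm (a $$ m) \<le> Q powr (\<alpha> + \<mu> * of_int (m + w))" "coeff_below a (-w)"
    and k: "\<mu> + 1 \<le> k" and C: "C \<ge> 0"
    and f: "\<And>m. m \<ge> -w \<Longrightarrow> norm (f $$ (n - m)) \<le> C * Q powr (E - k * of_int (m + w))"
  shows "norm ((a * f) $$ n) \<le> C * Q powr (E + \<alpha>) * (Q / (Q - 1))"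
proof -
  have bound: "norm (a $$ m * f $$ (n - m)) \<le> (if m \<ge> -w then C * Q powr (E + \<alpha>) * Q powr (- of_int (m - (-w))) else 0)" for m
  proof (cases "m < -w")
    case True
    thus ?thesis using a(2) by (simp add: coeff_below_def)
  next
    case False
    hence "norm (a $$ m * f $$ (n - m)) \<le>
        Q powr (\<alpha> + \<mu> * of_int (m + w)) * (C * Q powr (E - k * of_int (m + w)))"
      unfolding norm_mult using a(1)[of m] f[of m] C by (intro mult_mono) auto
    also have "\<dots> = C * Q powr (E + \<alpha> - (k - \<mu>) * of_int (m + w))"
      by (simp add: powr_add[symmetric] algebra_simps)
    also have "\<dots> \<le> C * Q powr (E + \<alpha> - 1 * of_int (m + w))"
    proof -
      have "1 * of_int (m + w) \<le> (k - \<mu>) * real_of_int (m + w)"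
        using k False by (intro mult_right_mono) (auto simp flip: of_int_add)
      thus ?thesis using C by (intro mult_left_mono) auto
    qed
    also have "\<dots> = C * Q powr (E + \<alpha>) * Q powr (- of_int (m - (-w)))"
      by (simp add: powr_add[symmetric] algebra_simps)
    finally show ?thesis using False by simp
  qed
  define S where "S = {fls_subdegree a..n - fls_subdegree f}"
  have "norm ((a * f) $$ n) \<le> (\<Sum>m\<in>S. norm (a $$ m * f $$ (n - m)))"
    unfolding fls_times_nth(2) S_def by (rule norm_sum)
  also have "\<dots> \<le> (\<Sum>m\<in>S. if m \<ge> -w then C * Q powr (E + \<alpha>) * Q powr (- of_int (m - (-w))) else 0)"
    by (intro sum_mono bound)
  also have "\<dots> = (\<Sum>m\<in>{m\<in>S. m \<ge> -w}. C * Q powr (E + \<alpha>) * Q powr (- of_int (m - (-w))))"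
    by (rule sum.inter_filter[symmetric]) (simp add: S_def)
  also have "\<dots> \<le> (\<Sum>m=-w..n - fls_subdegree f. C * Q powr (E + \<alpha>) * Q powr (- of_int (m - (-w))))"
    using C by (intro sum_mono2) (auto simp: S_def)
  also have "\<dots> \<le> C * Q powr (E + \<alpha>) * (Q / (Q - 1))"
    unfolding sum_distrib_left[symmetric] using C by (intro mult_left_mono sum_powr_neg_le q_gt_1) auto
  finally show ?thesis .
qed

end

text \<open>The kink along \<open>n = c k\<close> makes the term \<open>i = I\<close> of the equation dominant
  below the line and the term of highest order dominant above it.\<close>

definition wexp :: "real \<Rightarrow> real \<Rightarrow> real \<Rightarrow> real \<Rightarrow> real \<Rightarrow> real" where
  "wexp \<epsilon> \<delta> c k n = (1 - \<epsilon>) * k * n - \<delta> / 2 * (min n (c * k))\<^sup>2"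

text \<open>Below the line the quadratic term does not involve k, so the shift by j costs only
  \<open>\<epsilon> j t\<close>. Raising the degree by m gains \<open>(1 - \<epsilon>) k m\<close>,
  of which the quadratic term takes back at most
  \<open>\<delta> c k m + \<delta> c d m / 2\<close>.\<close>

lemma wexp_low:
  fixes d :: real
  assumes "0 < \<delta>" "0 < c" "0 \<le> t" "t < c * (k - j)" "\<bar>j\<bar> \<le> d" "0 \<le> m" "0 \<le> k"
  shows "wexp \<epsilon> \<delta> c (k - j) t + j * t \<le>
    wexp \<epsilon> \<delta> c k (t + m) + \<epsilon> * j * t - (1 - \<epsilon> - \<delta> * c) * k * m + \<delta> * c * d * m / 2"
proof -
  define M where "M = min (t + m) (c * k)"
  have ck: "c * k \<ge> 0" using assms by simp
  have "M\<^sup>2 - t\<^sup>2 \<le> m * (2 * c * k + c * d)"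
  proof (cases "M \<le> t")
    case True
    have "0 \<le> M" using assms ck by (auto simp: M_def)
    hence "M\<^sup>2 \<le> t\<^sup>2" using True by (intro power_mono) auto
    moreover have "0 \<le> m * (2 * c * k + c * d)"
      using assms by (intro mult_nonneg_nonneg add_nonneg_nonneg) auto
    ultimately show ?thesis by linarith
  next
    case False
    \<comment> \<open>For negative j the degree t may exceed \<open>c k\<close>, but only by less
      than \<open>c d\<close>; hence the extra summand.\<close>
    have "c * (k - j) \<le> c * (k + d)" using assms by (intro mult_left_mono) auto
    hence "M + t \<le> 2 * c * k + c * d" using assms by (simp add: M_def algebra_simps)
    moreover have "M - t \<le> m" by (simp add: M_def)
    moreover have "0 \<le> M + t" using False assms by simp
    ultimately have "(M - t) * (M + t) \<le> m * (2 * c * k + c * d)"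
      using False assms by (intro mult_mono) auto
    thus ?thesis by (simp add: power2_eq_square algebra_simps)
  qed
  hence "\<delta> / 2 * (M\<^sup>2 - t\<^sup>2) \<le> \<delta> / 2 * (m * (2 * c * k + c * d))"
    using assms by (intro mult_left_mono) auto
  moreover have "min t (c * (k - j)) = t" using assms by simp
  ultimately show ?thesis
    unfolding wexp_def M_def[symmetric] by (simp add: field_simps)
qed

text \<open>Above the line the quadratic term is \<open>(w + 2) / 2\<close> times the squared index,
  so passing from \<open>k + p\<close> to k gains at least \<open>(w + 2) k\<close>. Of this,
  \<open>w k\<close> pays for the degrees lost at a pole of order w, and \<open>2 k\<close> remains
  as a margin.\<close>

lemma wexp_high:
  assumes "0 < \<delta>" "0 < c" "0 < \<epsilon>" "\<epsilon> < 1" "1 \<le> p" "c * (k + p) \<le> t" "0 \<le> t + m" "0 \<le> k" "-w \<le> m" "0 \<le> w"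
    and "\<delta> * c\<^sup>2 = w + 2"
  shows "wexp \<epsilon> \<delta> c (k + p) t - p * t \<le> wexp \<epsilon> \<delta> c k (t + m) - (1 - \<epsilon>) * k * (m + w) - 2 * k"
proof -
  have ck: "c * k \<ge> 0" using assms by simp
  have "(min (t + m) (c * k))\<^sup>2 \<le> (c * k)\<^sup>2"
    using assms ck by (intro power_mono) auto
  hence "\<delta> / 2 * (min (t + m) (c * k))\<^sup>2 \<le> \<delta> / 2 * (c * k)\<^sup>2"
    using assms by (intro mult_left_mono) auto
  also have "\<dots> = (w + 2) * k\<^sup>2 / 2"
    unfolding assms(11)[symmetric] by (simp add: power_mult_distrib)
  finally have 1: "wexp \<epsilon> \<delta> c k (t + m) \<ge> (1 - \<epsilon>) * k * (t + m) - (w + 2) * k\<^sup>2 / 2"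
    by (simp add: wexp_def)
  have "wexp \<epsilon> \<delta> c (k + p) t = (1 - \<epsilon>) * (k + p) * t - \<delta> / 2 * (c * (k + p))\<^sup>2"
    using assms by (simp add: wexp_def min_absorb2)
  also have "\<delta> / 2 * (c * (k + p))\<^sup>2 = (w + 2) * (k + p)\<^sup>2 / 2"
    unfolding assms(11)[symmetric] by (simp add: power_mult_distrib)
  finally have 2: "wexp \<epsilon> \<delta> c (k + p) t = (1 - \<epsilon>) * (k + p) * t - (w + 2) * (k + p)\<^sup>2 / 2" .
  have "0 \<le> t" using assms ck by (smt (verit) mult_nonneg_nonneg)
  hence 3: "0 \<le> \<epsilon> * (p * t)" using assms by auto
  have 4: "(w + 2) * (2 * k) \<le> (w + 2) * (2 * (k * p) + p\<^sup>2)"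
    using assms mult_left_mono[of 1 p k] by (intro mult_left_mono) (auto intro: add_increasing2)
  have 5: "0 \<le> \<epsilon> * (k * w)" using assms by auto
  show ?thesis using 1 2 3 4 5 by (simp add: power2_eq_square field_simps)
qed

context q_gt_one
begin

text \<open>The cut at \<open>n = 0\<close> makes \<open>Abs_fls\<close> legitimate. It loses
  nothing for the functions used below, whose weight vanishes at negative n.\<close>

definition seq_of :: "(int \<times> int \<Rightarrow> complex) \<Rightarrow> int \<Rightarrow> complex fls" where
  "seq_of y k = Abs_fls (\<lambda>n. if n < 0 then 0 else y (k, n))"

lemma seq_of_nth [simp]: "seq_of y k $$ n = (if n < 0 then 0 else y (k, n))"
  unfolding seq_of_def by (rule nth_Abs_fls_lower_bound[of 0]) simp

lemma shift_add: "shift j (\<lambda>k. x k + y k) k = shift j x k + shift j y k"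
  by (simp add: shift_def fls_dilate_add)

lemma shift_diff: "shift j (\<lambda>k. x k - y k) k = shift j x k - shift j y k"
  by (simp add: shift_def fls_dilate_diff)

lemma shift_mult: "shift j (\<lambda>k. a * x k) k = fls_dilate (q powi j) a * shift j x k"
  by (simp add: shift_def fls_dilate_mult)

lemma shift_sum: "shift j (\<lambda>k. \<Sum>i\<in>I. x i k) k = (\<Sum>i\<in>I. shift j (x i) k)"
  by (simp add: shift_def fls_dilate_sum)

lemma norm_shift_nth: "norm (shift j x k $$ n) = Q powr (of_int (j * n)) * norm (x (k - j) $$ n)"
  by (simp add: norm_mult norm_q_powi)

lemma flat_seq_of:
  fixes \<epsilon> :: real and N :: "int \<Rightarrow> int"
  assumes "0 < \<epsilon>" "\<epsilon> < 1" "filterlim N at_top at_top"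
    and b: "\<And>k n. k \<ge> l \<Longrightarrow> n \<ge> 0 \<Longrightarrow> norm (y (k, n)) \<le> 2 * Q powr ((1 - \<epsilon>) * of_int k * of_int n)"
    and N: "\<And>k n. k \<ge> l \<Longrightarrow> n < N k \<Longrightarrow> y (k, n) = 0"
  shows "flat (seq_of y)"
  unfolding flat_def vanishing_def
proof (intro conjI allI)
  have "tempered_by \<epsilon> 1 (seq_of y)"
    using eventually_ge_at_top[of l] eventually_real_of_int_ge[of "log Q 2"]
    unfolding tempered_by_def
    apply eventually_elim
    apply (rule allI)
    subgoal premises elim for k n
    proof -
      have "norm (seq_of y k $$ n) \<le> Q powr (of_int k * ((1 - \<epsilon>) * of_int n + 1))"
      proof (cases "n < 0")
        case False
        have "norm (y (k, n)) \<le> 2 * Q powr ((1 - \<epsilon>) * of_int k * of_int n)"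
          using b[of k n] elim False by simp
        also have "\<dots> = Q powr (log Q 2 + (1 - \<epsilon>) * of_int k * of_int n)"
          using q_gt_1 by (simp add: powr_add)
        also have "\<dots> \<le> Q powr (of_int k * ((1 - \<epsilon>) * of_int n + 1))"
          using elim by (simp add: algebra_simps)
        finally show ?thesis using False by simp
      qed simp
      thus ?thesis by simp
    qed
    done
  thus "tempered (seq_of y)"
    using assms unfolding tempered_def by (intro exI[of _ \<epsilon>] exI[of _ 1]) auto
  fix M
  have "\<forall>\<^sub>F k in at_top. M \<le> N k" using assms(3) by (simp add: filterlim_at_top)
  thus "\<forall>\<^sub>F k in at_top. coeff_below (seq_of y k) M"
    using eventually_ge_at_top[of l]
    by eventually_elim (auto simp: coeff_below_def N)
qed

text \<open>T is the margin in the exponent that swallows the constants of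
  \<open>mult_coeff_bound\<close> and leaves a prescribed contraction factor.\<close>

lemma mult_Q_const_bound:
  fixes C :: real
  assumes "C > 0"
  obtains T where "T \<ge> 0" "Q powr (\<alpha> - T) * (Q / (Q - 1)) \<le> C"
proof
  define \<beta> where "\<beta> = log Q (Q / (Q - 1))"
  show "max 0 (\<alpha> + \<beta> - log Q C) \<ge> 0" by simp
  have "Q powr (\<alpha> - max 0 (\<alpha> + \<beta> - log Q C)) * (Q / (Q - 1)) =
      Q powr (\<alpha> - max 0 (\<alpha> + \<beta> - log Q C) + \<beta>)"
    using q_gt_1 by (simp add: powr_add \<beta>_def)
  also have "\<dots> \<le> Q powr (log Q C)" by (simp add: max_def)
  finally show "Q powr (\<alpha> - max 0 (\<alpha> + \<beta> - log Q C)) * (Q / (Q - 1)) \<le> C"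
    using assms q_gt_1 by simp
qed

text \<open>A function y of \<open>(k, n)\<close> is split along the line \<open>n = c k\<close>.
  The parametrix applies \<open>\<sigma>^(-I)\<close> to the low part, and division by
  \<open>b d\<close> followed by \<open>\<sigma>^(-d)\<close> to the high part. With this ansatz the
  equation becomes \<open>y + R y = g\<close>, where R halves bounds by the kinked weight.\<close>

lemma normalised_scalar_equation:
  fixes b :: "nat \<Rightarrow> complex fls" and d I :: nat
  assumes conv: "\<And>i. i \<le> d \<Longrightarrow> fls_conv_radius (b i) > 0"
    and I: "I \<le> d" "b I = 1"
    and low: "\<And>i. i \<le> d \<Longrightarrow> coeff_below (b i) 0"
    and high: "\<And>i. i \<le> d \<Longrightarrow> I < i \<Longrightarrow> coeff_below (b i) 1"
    and bd: "b d \<noteq> 0"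
    and g: "flat g"
  obtains x where "flat x" "\<forall>\<^sub>F k in at_top. (\<Sum>i\<le>d. b i * shift (int i) x k) = g k"
proof -
  \<comment> \<open>These are the coefficients that act on the high part: moving
    \<open>\<sigma>^i\<close> past \<open>\<sigma>^(-d)\<close> and \<open>inverse (b d)\<close>
    dilates the latter by \<open>q^(i - d)\<close>. In particular \<open>e d = 1\<close>.\<close>
  define e where "e i = b i * fls_dilate (q powi (int i - int d)) (inverse (b d))" for i
  have conv_e: "fls_conv_radius (e i) > 0" if "i \<le> d" for i
  proof -
    have "fls_conv_radius (fls_dilate (q powi (int i - int d)) (inverse (b d))) > 0"
      using conv by (intro fls_conv_radius_dilate_pos fls_conv_radius_inverse_pos) auto
    thus ?thesis
      unfolding e_def using conv[OF that] fls_conv_radius_mult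
      by (metis less_le_trans min_less_iff_conj)
  qed
  obtain \<epsilon>0 where \<epsilon>0: "0 < \<epsilon>0" "\<epsilon>0 < 1"
    "\<forall>\<^sub>F k in at_top. \<forall>n. norm (g k $$ n) \<le> Q powr ((1 - \<epsilon>0) * of_int k * of_int n)"
    by (rule flat_bound[OF g])
  define F where "F p = (if fst p then b (snd p) else e (snd p))" for p :: "bool \<times> nat"
  have conv_F: "fls_conv_radius (F p) > 0" if "p \<in> UNIV \<times> {..d}" for p
    using that conv conv_e by (auto simp: F_def)
  have fin: "finite ((UNIV :: bool set) \<times> {..d})" by simp
  obtain \<mu> \<alpha> :: real and w :: int where w: "\<mu> \<ge> 0" "w \<ge> 0"
    "\<forall>p\<in>UNIV \<times> {..d}. coeff_below (F p) (-w)"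
    "\<forall>p\<in>UNIV \<times> {..d}. \<forall>n. norm (F p $$ n) \<le> Q powr (\<alpha> + \<mu> * of_int (n + w))"
    by (rule germs_common_bound[OF fin conv_F])
  \<comment> \<open>The \<open>b i\<close> have no pole, so their bound is wanted with offset 0
    instead of w; this costs \<open>\<mu> w\<close>.\<close>
  define \<alpha>' where "\<alpha>' = \<alpha> + \<mu> * of_int w"
  have b_bound: "norm (b i $$ n) \<le> Q powr (\<alpha>' + \<mu> * of_int (n + 0))" if "i \<le> d" for i n
    using bspec[OF w(4), of "(True, i)", rule_format, of n] that by (simp add: F_def \<alpha>'_def algebra_simps)
  have e_bound: "norm (e i $$ n) \<le> Q powr (\<alpha>' + \<mu> * of_int (n + w))" if "i \<le> d" for i n
  proof -
    have "norm (e i $$ n) \<le> Q powr (\<alpha> + \<mu> * of_int (n + w))"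
      using bspec[OF w(4), of "(False, i)", rule_format, of n] that by (simp add: F_def)
    also have "\<dots> \<le> Q powr (\<alpha>' + \<mu> * of_int (n + w))" using w by (simp add: \<alpha>'_def)
    finally show ?thesis .
  qed
  have e_below: "coeff_below (e i) (-w)" if "i \<le> d" for i
    using bspec[OF w(3), of "(False, i)"] that by (simp add: F_def)

  \<comment> \<open>Two demands fix c and \<delta>: \<open>\<delta> c = \<eta>\<close> keeps the
    quadratic term a small fraction of \<open>k n\<close>, and \<open>\<delta> c^2 = w + 2\<close>
    is the gain needed in \<open>wexp_high\<close>. Only then is \<epsilon> chosen, with
    \<open>\<epsilon> d c \<le> 1 / 4\<close>, so that for \<open>t < c k\<close> the loss
    \<open>\<epsilon> j t\<close> stays below \<open>k / 4\<close>.\<close>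
  define \<eta> where "\<eta> = \<epsilon>0 / 8"
  define c where "c = (of_int w + 2) / \<eta>"
  define \<delta> where "\<delta> = \<eta> / c"
  define \<epsilon> where "\<epsilon> = min (\<epsilon>0 / 8) (1 / (4 * (real d + 1) * c))"
  have \<eta>: "0 < \<eta>" "\<eta> \<le> 1 / 8" using \<epsilon>0 by (auto simp: \<eta>_def)
  have "16 * \<eta> \<le> of_int w + 2" using \<eta> w(2) by linarith
  hence c16: "c \<ge> 16" using \<eta> unfolding c_def by (subst pos_le_divide_eq) auto
  have \<delta>: "0 < \<delta>" "\<delta> * c = \<eta>" using \<eta> c16 by (auto simp: \<delta>_def)
  have \<delta>c2: "\<delta> * c\<^sup>2 = of_int w + 2"
  proof -
    have "\<delta> * c\<^sup>2 = (\<delta> * c) * c" by (simp add: power2_eq_square)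
    also have "\<dots> = \<eta> * c" by (simp only: \<delta>(2))
    also have "\<dots> = of_int w + 2" using \<eta> by (simp add: c_def)
    finally show ?thesis .
  qed
  have \<epsilon>: "0 < \<epsilon>" "\<epsilon> \<le> 1 / 8" "\<epsilon> \<le> \<epsilon>0 / 8" using \<epsilon>0 c16 by (auto simp: \<epsilon>_def)
  have \<epsilon>dc: "\<epsilon> * (real d * c) \<le> 1 / 4"
  proof -
    have "\<epsilon> * (real d * c) \<le> 1 / (4 * (real d + 1) * c) * (real d * c)"
      using c16 by (intro mult_right_mono) (auto simp: \<epsilon>_def)
    also have "\<dots> \<le> 1 / 4" using c16 by (simp add: divide_simps)
    finally show ?thesis .
  qed
  define E where "E k n = wexp \<epsilon> \<delta> c (of_int k) (of_int n)" for k n :: int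

  have g_below: "\<forall>\<^sub>F k in at_top. coeff_below (g k) M" for M
    using g by (simp add: flat_def vanishing_def)
  obtain N :: "int \<Rightarrow> int" where N': "mono N" "\<forall>k. N k \<ge> 0" "\<forall>k\<ge>0. N k \<le> k"
    "\<forall>k. N k \<le> N (k - int d) + 1" "filterlim N at_top at_top"
    "\<forall>\<^sub>F k in at_top. coeff_below (g k) (N k)"
    by (rule slow_sequence[of "\<lambda>k N. coeff_below (g k) N" d, OF g_below])
  note N = N'(1) N'(2)[rule_format] N'(3)[rule_format] N'(4)[rule_format] N'(5,6)
  \<comment> \<open>At most \<open>2 d\<close> remainder terms occur; with the factor
    \<open>1 / (4 (d + 1))\<close> on each, their sum is at most half the original bound.\<close>
  obtain T where T: "T \<ge> 0" "Q powr (\<alpha>' - T) * (Q / (Q - 1)) \<le> 1 / (4 * (real d + 1))"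
    by (rule mult_Q_const_bound[of "1 / (4 * (real d + 1))" \<alpha>']) simp
  have "\<forall>\<^sub>F k in at_top. k \<ge> 0 \<and> k \<ge> int d \<and> k \<ge> w \<and> of_int k \<ge> 8 * T \<and> of_int k \<ge> 4 * (\<mu> + 1) \<and>
      T / \<epsilon> \<le> of_int (N k) \<and> coeff_below (g k) (N k) \<and>
      (\<forall>n. norm (g k $$ n) \<le> Q powr ((1 - \<epsilon>0) * of_int k * of_int n))"
    using eventually_ge_at_top N(6) \<epsilon>0(3) eventually_real_of_int_ge
      filterlim_compose[OF filterlim_real_of_int_at_top N(5)]
    by (intro eventually_conj) (auto simp: filterlim_at_top)
  then obtain k0 where k0: "\<And>k. k \<ge> k0 \<Longrightarrow> k \<ge> 0 \<and> k \<ge> int d \<and> k \<ge> w \<and>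
      of_int k \<ge> 8 * T \<and> of_int k \<ge> 4 * (\<mu> + 1) \<and>
      T / \<epsilon> \<le> of_int (N k) \<and> coeff_below (g k) (N k) \<and>
      (\<forall>n. norm (g k $$ n) \<le> Q powr ((1 - \<epsilon>0) * of_int k * of_int n))"
    unfolding eventually_at_top_linorder by blast
  \<comment> \<open>The zeros of the weight encode flatness: whatever it bounds vanishes for
    \<open>k < k0\<close> and for \<open>n < N k\<close>.\<close>
  define u where "u p = (if fst p \<ge> k0 \<and> snd p \<ge> N (fst p) then Q powr E (fst p) (snd p) else 0)"
    for p :: "int \<times> int"
  define lo where "lo y p = (if of_int (snd p) < c * of_int (fst p) then y p else 0)"
    for y :: "int \<times> int \<Rightarrow> complex" and p :: "int \<times> int"
  define hi where "hi y p = (if of_int (snd p) < c * of_int (fst p) then 0 else y p)"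
    for y :: "int \<times> int \<Rightarrow> complex" and p :: "int \<times> int"
  \<comment> \<open>The terms \<open>i = I\<close> of the low part and \<open>i = d\<close> of the
    high part reproduce y; S collects the others. The splitting precedes the shift, so which side of
    the line counts is decided at the source index \<open>k - j\<close>, not at k.\<close>
  define S where "S y k = (\<Sum>i\<in>{..d} - {I}. b i * shift (int i - int I) (seq_of (lo y)) k)
      + (\<Sum>i<d. e i * shift (int i - int d) (seq_of (hi y)) k)" for y k
  define R where "R y p = (if fst p \<ge> k0 then S y (fst p) $$ snd p else 0)" for y p

  have shift_seq: "shift j (seq_of y) k $$ n = 0"
    if "\<And>p. norm (y p) \<le> C * u p" "n < N (k - j) \<or> k - j < k0" for y j k n C
  proof -
    have "u (k - j, n) = 0" using that(2) by (auto simp: u_def)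
    hence "y (k - j, n) = 0" using that(1)[of "(k - j, n)"] by simp
    thus ?thesis by simp
  qed
  have lo_le: "norm (lo y p) \<le> C * u p" if "\<And>p. norm (y p) \<le> C * u p" for y C p
    using that[of p] order_trans[OF norm_ge_zero that[of p]] by (simp add: lo_def)
  have hi_le: "norm (hi y p) \<le> C * u p" if "\<And>p. norm (y p) \<le> C * u p" for y C p
    using that[of p] order_trans[OF norm_ge_zero that[of p]] by (simp add: hi_def)

  have low_term: "norm ((b i * shift (int i - int I) (seq_of (lo y)) k) $$ n)
      \<le> C / (4 * (real d + 1)) * u (k, n)"
    if i: "i \<le> d" "i \<noteq> I" and C: "C \<ge> 0" and y: "\<And>p. norm (y p) \<le> C * u p" and k: "k \<ge> k0"
    for i y C k n
  proof -
    define j where "j = int i - int I"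
    define s where "s = (if j > 0 then 1 else 0 :: int)"
    have j: "\<bar>j\<bar> \<le> int d" "j \<noteq> 0" using i I(1) by (auto simp: j_def)
    have kd: "k \<ge> 0" "k \<ge> int d" "of_int k \<ge> 8 * T" "of_int k / 4 \<ge> \<mu> + 1"
      using k0[OF k] by auto
    have bs: "coeff_below (b i) s" using low[OF i(1)] high[OF i(1)] by (auto simp: s_def j_def)
    \<comment> \<open>A shift by \<open>j > 0\<close> may lose one order of vanishing, which the
      zero of \<open>b i\<close> restores.\<close>
    have Nj: "N k \<le> N (k - j) + s"
    proof (cases "j > 0")
      case True
      have "N (k - int d) \<le> N (k - j)" using j N(1) by (auto intro: monoD)
      thus ?thesis using N(4)[of k] True by (simp add: s_def)
    next
      case False
      thus ?thesis using monoD[OF N(1), of k "k - j"] by (simp add: s_def)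
    qed
    show ?thesis
    proof (cases "n < N k")
      case True
      have "coeff_below (shift j (seq_of (lo y)) k) (N (k - j))"
        unfolding coeff_below_def using shift_seq[OF lo_le[OF y]] by blast
      hence "coeff_below (b i * shift j (seq_of (lo y)) k) (s + N (k - j))"
        by (rule coeff_below_mult[OF bs])
      hence "(b i * shift j (seq_of (lo y)) k) $$ n = 0"
        using True Nj by (auto simp: coeff_below_def)
      thus ?thesis using C by (simp add: j_def u_def)
    next
      case False
      have *: "norm (shift j (seq_of (lo y)) k $$ (n - m)) \<le>
          C * Q powr ((E k n - T) - of_int k / 4 * of_int (m + 0))" if m: "m \<ge> s" for m
      proof (cases "n - m < N (k - j) \<or> k - j < k0 \<or> c * of_int (k - j) \<le> of_int (n - m)")
        case True
        have "shift j (seq_of (lo y)) k $$ (n - m) = 0"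
          using True shift_seq[OF lo_le[OF y], of "n - m" k j] by (auto simp: lo_def)
        thus ?thesis using C by simp
      next
        case False
        define t where "t = n - m"
        have t: "t \<ge> N (k - j)" "k - j \<ge> k0" "of_int t < c * of_int (k - j)"
          using False by (auto simp: t_def)
        have t0: "t \<ge> 0" using t(1) N(2)[of "k - j"] by simp
        have m0: "m \<ge> 0" using m by (auto simp: s_def split: if_splits)
        have "norm (shift j (seq_of (lo y)) k $$ t) = Q powr (of_int (j * t)) * norm (lo y (k - j, t))"
          using t0 by (subst norm_shift_nth) simp
        also have "\<dots> \<le> Q powr (of_int (j * t)) * (C * u (k - j, t))"
          using lo_le[OF y] by (intro mult_left_mono) auto
        also have "\<dots> = C * Q powr (E (k - j) t + of_int j * of_int t)"
          using t by (simp add: u_def powr_add)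
        also have "\<dots> \<le> C * Q powr ((E k n - T) - of_int k / 4 * of_int (m + 0))"
        proof (intro mult_left_mono C, unfold Q_powr_le_iff)
          have nm: "of_int n = of_int t + (of_int m :: real)" by (simp add: t_def)
          have "E (k - j) t + of_int j * of_int t \<le> E k n + \<epsilon> * of_int j * of_int t
              - (1 - \<epsilon> - \<delta> * c) * of_int k * of_int m + \<delta> * c * real d * of_int m / 2"
            unfolding E_def nm of_int_diff
            by (rule wexp_low) (use t t0 m0 j kd \<delta>(1) c16 in auto)
          \<comment> \<open>Budget in multiples of \<open>k m\<close>: raising the degree yields
            3/4, the next two estimates use 1/16 and 7/16, and the decay rate 1/4 required for
            \<open>mult_coeff_bound\<close> remains.\<close>
          moreover have "(3 / 4) * (of_int k * of_int m) \<le> (1 - \<epsilon> - \<delta> * c) * (of_int k * of_int m)"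
            using \<epsilon> \<eta> kd m0 unfolding \<delta>(2) by (intro mult_right_mono) auto
          moreover have "\<delta> * c * (real d * of_int m) \<le> 1 / 8 * (of_int k * of_int m)"
            using \<eta> kd m0 unfolding \<delta>(2) by (intro mult_mono) auto
          \<comment> \<open>Two sources of smallness. For \<open>j > 0\<close> the zero of
            \<open>b i\<close> gives \<open>m \<ge> 1\<close>, so \<open>k m\<close> outweighs both
            the loss and T. For \<open>j < 0\<close> the shift itself gains at least
            \<open>\<epsilon> t\<close>, and
            \<open>t \<ge> N (k - j) \<ge> T / \<epsilon>\<close>.\<close>
          moreover have "\<epsilon> * of_int j * of_int t \<le> (7 / 16) * (of_int k * of_int m) - T"
          proof (cases "j > 0")
            case True
            have "\<epsilon> * of_int j * of_int t \<le> \<epsilon> * real d * (c * of_int k)"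
            proof (intro mult_mono)
              have "c * of_int (k - j) \<le> c * of_int k" using True c16 by (intro mult_left_mono) auto
              thus "of_int t \<le> c * of_int k" using t by linarith
            qed (use \<epsilon> j True t0 in auto)
            also have "\<dots> = \<epsilon> * (real d * c) * of_int k" by simp
            also have "\<dots> \<le> 1 / 4 * of_int k" using kd by (intro mult_right_mono \<epsilon>dc) auto
            finally have 1: "\<epsilon> * of_int j * of_int t \<le> 1 / 4 * of_int k" .
            have "of_int k * 1 \<le> of_int k * (of_int m :: real)"
              using kd m True by (intro mult_left_mono) (auto simp: s_def)
            thus ?thesis using 1 kd by linarith
          next
            case False
            hence "j \<le> - 1" using j by simp
            have "T / \<epsilon> \<le> of_int (N (k - j))" using k0[OF t(2)] by simp
            also have "\<dots> \<le> of_int t" using t by simp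
            finally have "T \<le> \<epsilon> * of_int t" using \<epsilon> by (simp add: field_simps)
            moreover have "\<epsilon> * of_int t * of_int j \<le> \<epsilon> * of_int t * (- 1)"
            proof (intro mult_left_mono)
              show "of_int j \<le> (- 1 :: real)" using \<open>j \<le> - 1\<close> by linarith
            qed (use \<epsilon> t0 in auto)
            moreover have "0 \<le> (of_int k :: real) * of_int m" using kd m0 by simp
            ultimately show ?thesis by (simp add: mult.commute mult.left_commute)
          qed
          ultimately show "E (k - j) t + of_int j * of_int t \<le> E k n - T - of_int k / 4 * of_int (m + 0)"
            by (simp add: mult.assoc)
        qed
        finally show ?thesis by (simp add: t_def)
      qed
      have *: "norm (shift j (seq_of (lo y)) k $$ (n - m)) \<le>
          C * Q powr ((E k n - T) - of_int k / 4 * of_int (m + 0))" if "m \<ge> s" for m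
        using * that by blast
      have "norm ((b i * shift j (seq_of (lo y)) k) $$ n) \<le> C * Q powr (E k n - T + \<alpha>') * (Q / (Q - 1))"
        if "s = 0"
        by (rule mult_coeff_bound[where w = 0 and k = "of_int k / 4" and \<mu> = \<mu>])
          (use b_bound[OF i(1)] low[OF i(1)] kd C * that in simp_all)
      moreover have "norm ((b i * shift j (seq_of (lo y)) k) $$ n) \<le> C * Q powr (E k n - T + \<alpha>') * (Q / (Q - 1))"
        if s1: "s = 1"
      proof -
        text \<open>The bound is not available at \<open>m = 0\<close>, where the coefficient of \<open>b i\<close> vanishes, so the
          series is cut off there.\<close>
        define f where "f = seq_of (\<lambda>p. if snd p < n then shift j (seq_of (lo y)) k $$ snd p else 0) 0"
        have fn: "f $$ t = (if t < n then shift j (seq_of (lo y)) k $$ t else 0)" for t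
          by (auto simp: f_def)
        have "norm ((b i * f) $$ n) \<le> C * Q powr (E k n - T + \<alpha>') * (Q / (Q - 1))"
        proof (rule mult_coeff_bound[where w = 0 and k = "of_int k / 4" and \<mu> = \<mu>])
          show "norm (f $$ (n - m)) \<le> C * Q powr (E k n - T - real_of_int k / 4 * real_of_int (m + 0))"
            if "- 0 \<le> m" for m
            using *[of m] that s1 C by (cases "m = 0") (auto simp: fn)
        qed (use b_bound[OF i(1)] low[OF i(1)] kd C in simp_all)
        moreover have "(b i * (shift j (seq_of (lo y)) k - f)) $$ n = 0"
        proof -
          have "coeff_below (shift j (seq_of (lo y)) k - f) n" by (auto simp: coeff_below_def fn)
          with bs have "coeff_below (b i * (shift j (seq_of (lo y)) k - f)) (s + n)"
            by (rule coeff_below_mult)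
          thus ?thesis using s1 by (simp add: coeff_below_def)
        qed
        ultimately show ?thesis by (simp add: algebra_simps)
      qed
      moreover have "s = 0 \<or> s = 1" by (auto simp: s_def)
      ultimately have "norm ((b i * shift j (seq_of (lo y)) k) $$ n) \<le>
          C * Q powr (E k n - T + \<alpha>') * (Q / (Q - 1))" by blast
      also have "\<dots> = (Q powr (\<alpha>' - T) * (Q / (Q - 1))) * (C * Q powr E k n)"
        by (simp add: powr_add[symmetric] algebra_simps)
      also have "\<dots> \<le> 1 / (4 * (real d + 1)) * (C * Q powr E k n)"
        using C by (intro mult_right_mono T) auto
      finally show ?thesis using False k by (simp add: u_def j_def)
    qed
  qed

  have high_term: "norm ((e i * shift (int i - int d) (seq_of (hi y)) k) $$ n)
      \<le> C / (4 * (real d + 1)) * u (k, n)"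
    if i: "i < d" and C: "C \<ge> 0" and y: "\<And>p. norm (y p) \<le> C * u p" and k: "k \<ge> k0"
    for i y C k n
  proof -
    define j where "j = int d - int i"
    have j: "j \<ge> 1" using i by (auto simp: j_def)
    have kd: "k \<ge> 0" "k \<ge> w" "of_int k \<ge> 8 * T" "of_int k / 4 \<ge> \<mu> + 1"
      using k0[OF k] by auto
    have *: "shift (- j) (seq_of (hi y)) k $$ t = 0" if "of_int t < c * of_int (k + j)" for t
      using that by (simp add: hi_def)
    \<comment> \<open>The high part starts at degree \<open>c (k + j)\<close>; even after a pole of
      order w it stays above \<open>k \<ge> N k\<close>.\<close>
    have ck: "of_int k + of_int w \<le> c * of_int (k + j)"
    proof -
      have "of_int k + of_int w \<le> 16 * (of_int k :: real)" using kd by linarith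
      also have "\<dots> \<le> c * of_int (k + j)" using c16 kd j by (intro mult_mono) auto
      finally show ?thesis .
    qed
    show ?thesis
    proof (cases "n < N k")
      case True
      have "coeff_below (shift (- j) (seq_of (hi y)) k) \<lceil>c * of_int (k + j)\<rceil>"
        unfolding coeff_below_def less_ceiling_iff using * by blast
      hence "coeff_below (e i * shift (- j) (seq_of (hi y)) k) (- w + \<lceil>c * of_int (k + j)\<rceil>)"
        by (rule coeff_below_mult[OF e_below[OF less_imp_le[OF i]]])
      moreover have "n < - w + \<lceil>c * of_int (k + j)\<rceil>"
        using True N(3)[OF kd(1)] ck by linarith
      ultimately have "(e i * shift (- j) (seq_of (hi y)) k) $$ n = 0"
        by (simp add: coeff_below_def)
      thus ?thesis using C by (simp add: j_def u_def)
    next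
      case False
      have "norm ((e i * shift (- j) (seq_of (hi y)) k) $$ n) \<le> C * Q powr (E k n - T + \<alpha>') * (Q / (Q - 1))"
      proof (rule mult_coeff_bound[where w = w and k = "of_int k / 4" and \<mu> = \<mu>])
        show "norm (shift (- j) (seq_of (hi y)) k $$ (n - m)) \<le>
            C * Q powr (E k n - T - of_int k / 4 * of_int (m + w))" if m: "- w \<le> m" for m
        proof (cases "n - m < N (k + j) \<or> k + j < k0 \<or> of_int (n - m) < c * of_int (k + j)")
          case True
          have "shift (- j) (seq_of (hi y)) k $$ (n - m) = 0"
            using True shift_seq[OF hi_le[OF y], of "n - m" k "- j"] *[of "n - m"] by fastforce
          thus ?thesis using C by simp
        next
          case False
          define t where "t = n - m"
          have t: "t \<ge> N (k + j)" "k + j \<ge> k0" "of_int t \<ge> c * of_int (k + j)"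
            using False by (auto simp: t_def)
          have t0: "t \<ge> 0" using t(1) N(2)[of "k + j"] by simp
          have tm: "t + m \<ge> 0" using t(3) ck kd m by linarith
          have "norm (shift (- j) (seq_of (hi y)) k $$ t) = Q powr (of_int (- j * t)) * norm (hi y (k + j, t))"
            using t0 by (subst norm_shift_nth) simp
          also have "\<dots> \<le> Q powr (of_int (- j * t)) * (C * u (k + j, t))"
            using hi_le[OF y] by (intro mult_left_mono) auto
          also have "\<dots> = C * Q powr (E (k + j) t - of_int j * of_int t)"
            using t by (simp add: u_def powr_diff powr_minus divide_inverse)
          also have "\<dots> \<le> C * Q powr (E k n - T - of_int k / 4 * of_int (m + w))"
          proof (intro mult_left_mono C, unfold Q_powr_le_iff)
            have nm: "of_int n = of_int t + (of_int m :: real)" by (simp add: t_def)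
            define K :: real where "K = of_int k * of_int (m + w)"
            have "E (k + j) t - of_int j * of_int t \<le> E k n
                - (1 - \<epsilon>) * of_int k * (of_int m + of_int w) - 2 * of_int k"
              unfolding E_def nm of_int_add
              by (rule wexp_high)
                (use t tm m w j kd \<epsilon> \<delta>(1) \<delta>c2 c16 in \<open>auto simp flip: of_int_add\<close>)
            hence "E (k + j) t - of_int j * of_int t \<le> E k n - (1 - \<epsilon>) * K - 2 * of_int k"
              by (simp add: K_def mult.assoc)
            moreover have "1 / 4 * K \<le> (1 - \<epsilon>) * K"
              unfolding K_def using \<epsilon> kd m
              by (intro mult_right_mono) (auto intro!: mult_nonneg_nonneg simp flip: of_int_add)
            moreover have "T \<le> 2 * of_int k" using kd T by linarith
            ultimately show "E (k + j) t - of_int j * of_int t \<le> E k n - T - of_int k / 4 * of_int (m + w)"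
              unfolding times_divide_eq_left K_def[symmetric] by linarith
          qed
          finally show ?thesis by (simp add: t_def)
        qed
      qed (use e_bound[of i] e_below[of i] i kd C in simp_all)
      also have "\<dots> = (Q powr (\<alpha>' - T) * (Q / (Q - 1))) * (C * Q powr E k n)"
        by (simp add: powr_add[symmetric] algebra_simps)
      also have "\<dots> \<le> 1 / (4 * (real d + 1)) * (C * Q powr E k n)"
        using C by (intro mult_right_mono T) auto
      finally show ?thesis using False k by (simp add: u_def j_def)
    qed
  qed

  have E_le: "E k n \<le> (1 - \<epsilon>) * of_int k * of_int n" for k n
    using \<delta>(1) by (simp add: E_def wexp_def)
  \<comment> \<open>The quadratic term is at most \<open>\<eta> / 2\<close> times
    \<open>k n\<close>, and \<open>\<epsilon> + \<eta> / 2 \<le> \<epsilon>0\<close>; so the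
    right-hand side lies below the weight.\<close>
  have g_le_E: "(1 - \<epsilon>0) * of_int k * of_int n \<le> E k n" if "k \<ge> 0" "n \<ge> 0" for k n
  proof -
    have kn: "(0 :: real) \<le> of_int n" "(0 :: real) \<le> c * of_int k" using that c16 by auto
    have "(min (of_int n) (c * of_int k))\<^sup>2 \<le> of_int n * (c * of_int k)"
      unfolding power2_eq_square using kn by (intro mult_mono) auto
    hence "\<delta> / 2 * (min (of_int n) (c * of_int k))\<^sup>2 \<le> \<delta> / 2 * (of_int n * (c * of_int k))"
      using \<delta>(1) by (intro mult_left_mono) auto
    also have "\<dots> = (\<delta> * c) / 2 * (of_int k * of_int n)" by simp
    finally have "(1 - \<epsilon> - \<eta> / 2) * (of_int k * of_int n) \<le> E k n"
      unfolding \<delta>(2) by (simp add: E_def wexp_def algebra_simps)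
    moreover have "(1 - \<epsilon>0) * (of_int k * of_int n) \<le> (1 - \<epsilon> - \<eta> / 2) * (of_int k * of_int n)"
      using \<epsilon> \<epsilon>0 that unfolding \<eta>_def by (intro mult_right_mono) auto
    ultimately show ?thesis by (simp add: mult.assoc)
  qed

  define G where "G p = (if fst p \<ge> k0 then g (fst p) $$ snd p else 0)" for p :: "int \<times> int"
  obtain y where y': "\<forall>p. norm (y p) \<le> 2 * u p" "\<forall>p. y p + R y p = G p"
  proof (rule weighted_neumann[of R u G])
    fix x y :: "int \<times> int \<Rightarrow> complex"
    have "seq_of (lo (\<lambda>p. x p - y p)) = (\<lambda>k. seq_of (lo x) k - seq_of (lo y) k)"
      "seq_of (hi (\<lambda>p. x p - y p)) = (\<lambda>k. seq_of (hi x) k - seq_of (hi y) k)"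
      by (auto simp: fun_eq_iff fls_eq_iff lo_def hi_def)
    hence "S (\<lambda>p. x p - y p) k = S x k - S y k" for k
      by (simp add: S_def shift_diff right_diff_distrib sum_subtractf)
    thus "R (\<lambda>p. x p - y p) = (\<lambda>p. R x p - R y p)" by (auto simp: R_def)
  next
    fix y :: "int \<times> int \<Rightarrow> complex" and C :: real and p :: "int \<times> int"
    assume C: "C \<ge> 0" and y: "\<And>p. norm (y p) \<le> C * u p"
    obtain k n where p: "p = (k, n)" by fastforce
    have u0: "u p \<ge> 0" by (simp add: u_def)
    show "norm (R y p) \<le> C / 2 * u p"
    proof (cases "k \<ge> k0")
      case True
      have "norm (R y p) \<le>
          norm (\<Sum>i\<in>{..d} - {I}. (b i * shift (int i - int I) (seq_of (lo y)) k) $$ n) +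
          norm (\<Sum>i<d. (e i * shift (int i - int d) (seq_of (hi y)) k) $$ n)"
        using True by (simp add: R_def S_def p fls_nth_sum norm_triangle_ineq)
      also have "\<dots> \<le> (\<Sum>i\<in>{..d} - {I}. C / (4 * (real d + 1)) * u (k, n)) +
          (\<Sum>i<d. C / (4 * (real d + 1)) * u (k, n))"
        using True by (intro add_mono sum_norm_le low_term high_term y C) auto
      also have "\<dots> = 2 * real d * (C / (4 * (real d + 1)) * u p)"
        using I(1) by (simp add: p)
      also have "\<dots> = (real d / (real d + 1)) * (C / 2 * u p)"
        by (simp add: divide_simps)
      also have "\<dots> \<le> 1 * (C / 2 * u p)" using C u0 by (intro mult_right_mono) (auto simp: divide_simps)
      finally show ?thesis by simp
    next
      case False
      thus ?thesis using C u0 by (simp add: R_def p)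
    qed
  next
    fix p :: "int \<times> int"
    obtain k n where p: "p = (k, n)" by fastforce
    show "norm (G p) \<le> u p"
    proof (cases "k \<ge> k0 \<and> n \<ge> N k")
      case True
      hence "norm (g k $$ n) \<le> Q powr ((1 - \<epsilon>0) * of_int k * of_int n)" using k0[of k] by blast
      also have "\<dots> \<le> Q powr E k n"
        unfolding Q_powr_le_iff using True k0[of k] N(2)[of k] by (intro g_le_E) auto
      finally show ?thesis using True by (simp add: G_def u_def p)
    next
      case False
      thus ?thesis using k0[of k] by (auto simp: G_def u_def p coeff_below_def)
    qed
  qed (rule that)
  note y = y'[rule_format]

  \<comment> \<open>The fixed point y is only the argument of the parametrix; the solution is its
    image.\<close>
  define X where "X = (\<lambda>k. shift (- int I) (seq_of (lo y)) k +
      shift (- int d) (\<lambda>k. inverse (b d) * seq_of (hi y) k) k)"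
  have flat_part: "flat (seq_of y')" if "\<And>p. norm (y' p) \<le> 2 * u p" for y'
  proof (rule flat_seq_of[where \<epsilon> = \<epsilon> and N = N and l = k0])
    show "norm (y' (k, n)) \<le> 2 * Q powr ((1 - \<epsilon>) * of_int k * of_int n)" if "k \<ge> k0" "n \<ge> 0" for k n
    proof -
      have "norm (y' (k, n)) \<le> 2 * u (k, n)" by fact
      also have "\<dots> \<le> 2 * Q powr E k n" by (simp add: u_def)
      also have "\<dots> \<le> 2 * Q powr ((1 - \<epsilon>) * of_int k * of_int n)" using E_le[of k n] by simp
      finally show ?thesis .
    qed
    show "y' (k, n) = 0" if "k \<ge> k0" "n < N k" for k n
      using \<open>\<And>p. norm (y' p) \<le> 2 * u p\<close>[of "(k, n)"] that by (simp add: u_def)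
  qed (use \<epsilon> N in auto)
  have "flat X"
    unfolding X_def using conv[of d]
    by (intro flat_add flat_shift flat_mult flat_part lo_le hi_le y(1) fls_conv_radius_inverse_pos) auto
  have eq: "(\<Sum>i\<le>d. b i * shift (int i) X k) = g k" if k: "k \<ge> k0" for k
  proof -
    have "shift (int i) X k = shift (int i - int I) (seq_of (lo y)) k +
        fls_dilate (q powi (int i - int d)) (inverse (b d)) * shift (int i - int d) (seq_of (hi y)) k" for i
    proof -
      have "shift (int i) X k = shift (int i) (shift (- int I) (seq_of (lo y))) k +
          shift (int i) (shift (- int d) (\<lambda>k. inverse (b d) * seq_of (hi y) k)) k"
        unfolding X_def by (rule shift_add)
      thus ?thesis by (simp only: shift_shift shift_mult diff_conv_add_uminus)
    qed
    hence "(\<Sum>i\<le>d. b i * shift (int i) X k) =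
        (\<Sum>i\<le>d. b i * shift (int i - int I) (seq_of (lo y)) k) +
        (\<Sum>i\<le>d. e i * shift (int i - int d) (seq_of (hi y)) k)"
      by (simp add: e_def sum.distrib algebra_simps)
    also have "(\<Sum>i\<le>d. b i * shift (int i - int I) (seq_of (lo y)) k) = seq_of (lo y) k +
        (\<Sum>i\<in>{..d} - {I}. b i * shift (int i - int I) (seq_of (lo y)) k)"
      using I by (subst sum.remove[of _ I]) auto
    also have "(\<Sum>i\<le>d. e i * shift (int i - int d) (seq_of (hi y)) k) =
        (\<Sum>i<d. e i * shift (int i - int d) (seq_of (hi y)) k) + seq_of (hi y) k"
      using bd by (simp add: lessThan_Suc_atMost[symmetric] e_def)
    finally have "(\<Sum>i\<le>d. b i * shift (int i) X k) = seq_of (lo y) k + seq_of (hi y) k + S y k"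
      by (simp add: S_def algebra_simps)
    also have "\<dots> = g k"
    proof (rule fls_eqI)
      fix n
      have "seq_of (lo y) k $$ n + seq_of (hi y) k $$ n = y (k, n)"
        using y(1)[of "(k, n)"] N(2)[of k] by (auto simp: lo_def hi_def u_def split: if_splits)
      thus "(seq_of (lo y) k + seq_of (hi y) k + S y k) $$ n = g k $$ n"
        using y(2)[of "(k, n)"] k by (simp add: R_def G_def)
    qed
    finally show ?thesis .
  qed
  have "\<forall>\<^sub>F k in at_top. (\<Sum>i\<le>d. b i * shift (int i) X k) = g k"
    using eventually_ge_at_top[of k0] by eventually_elim (rule eq)
  with \<open>flat X\<close> show ?thesis by (rule that)
qed

text \<open>Division by \<open>a I\<close>, where I is the largest index of minimal valuation among
  the nonzero coefficients: afterwards all valuations are nonnegative, and those beyond I are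
  positive by the maximality of I.\<close>

lemma scalar_equation:
  fixes a :: "nat \<Rightarrow> conv_germ" and d :: nat
  assumes ad: "a d \<noteq> 0" and g: "flat g"
  obtains x where "flat x"
    "\<forall>\<^sub>F k in at_top. (\<Sum>i\<le>d. Rep_conv_germ (a i) * shift (int i) x k) = g k"
proof -
  define sd where "sd i = fls_subdegree (Rep_conv_germ (a i))" for i
  define J where "J = {i. i \<le> d \<and> a i \<noteq> 0}"
  have J: "finite J" "d \<in> J" using ad by (auto simp: J_def)
  define v where "v = Min (sd ` J)"
  have v_le: "v \<le> sd i" if "i \<in> J" for i unfolding v_def using J that by auto
  have "v \<in> sd ` J" unfolding v_def using J by (intro Min_in) auto
  hence ne: "{i \<in> J. sd i = v} \<noteq> {}" by auto
  define I where "I = Max {i \<in> J. sd i = v}"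
  have I: "I \<in> J" "sd I = v" using Max_in[OF _ ne] J unfolding I_def by auto
  have I_max: "i \<le> I" if "i \<in> J" "sd i = v" for i
    unfolding I_def using J that by (intro Max_ge) auto
  have aI: "a I \<noteq> 0" "I \<le> d" using I by (auto simp: J_def)
  define b where "b i = Rep_conv_germ (inverse (a I) * a i)" for i
  have sd_b: "fls_subdegree (b i) = sd i - v" if "i \<in> J" for i
    using that aI I(2) unfolding b_def J_def sd_def
    by (simp add: fls_subdegree_mult)
  have b0: "b i = 0" if "i \<le> d" "i \<notin> J" for i using that by (simp add: b_def J_def)
  have low: "coeff_below (b i) 0" if "i \<le> d" for i
  proof (cases "i \<in> J")
    case True
    thus ?thesis using v_le[OF True] sd_b[OF True] unfolding coeff_below_def by auto
  qed (simp add: b0 that coeff_below_def)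
  have high: "coeff_below (b i) 1" if "i \<le> d" "I < i" for i
  proof (cases "i \<in> J")
    case True
    hence "sd i \<noteq> v" using I_max[of i] that by auto
    thus ?thesis using v_le[OF True] sd_b[OF True] unfolding coeff_below_def by auto
  qed (simp add: b0 that coeff_below_def)
  have bI: "b I = 1" using aI by (simp add: b_def del: Rep_conv_germ_simps) simp
  have "b d \<noteq> 0" using ad aI by (simp add: b_def)
  moreover have conv: "fls_conv_radius (b i) > 0" for i unfolding b_def by (rule Rep_conv_germ_pos)
  moreover have "flat (\<lambda>k. Rep_conv_germ (inverse (a I)) * g k)" by (rule flat_mult[OF Rep_conv_germ_pos g])
  ultimately obtain x where x: "flat x"
    "\<forall>\<^sub>F k in at_top. (\<Sum>i\<le>d. b i * shift (int i) x k) = Rep_conv_germ (inverse (a I)) * g k"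
    using normalised_scalar_equation[of d b I "\<lambda>k. Rep_conv_germ (inverse (a I)) * g k"]
      aI(2) bI low high by blast
  have Rb: "Rep_conv_germ (a i) = Rep_conv_germ (a I) * b i" for i
    using aI by (simp add: b_def)
  show ?thesis
  proof (rule that[OF x(1)])
    show "\<forall>\<^sub>F k in at_top. (\<Sum>i\<le>d. Rep_conv_germ (a i) * shift (int i) x k) = g k"
      using x(2)
    proof eventually_elim
      case (elim k)
      have "(\<Sum>i\<le>d. Rep_conv_germ (a i) * shift (int i) x k) =
          Rep_conv_germ (a I) * (\<Sum>i\<le>d. b i * shift (int i) x k)"
        unfolding sum_distrib_left by (intro sum.cong refl) (subst Rb, rule mult.assoc)
      also have "\<dots> = g k" unfolding elim using aI by simp
      finally show ?case .
    qed
  qed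
qed

end

section \<open>Systems\<close>

text \<open>A basis of T stays independent when v is added, so a linear map can be prescribed to
  vanish on T and not at v. The functional is returned as a vector w.\<close>

lemma annihilator_exists:
  fixes T :: "('a :: field ^ 'n) set"
  assumes "vec.subspace T" "v \<notin> T"
  obtains w :: "'a ^ 'n" where "\<forall>t\<in>T. (\<Sum>i\<in>UNIV. t $ i * w $ i) = 0" "(\<Sum>i\<in>UNIV. v $ i * w $ i) = 1"
proof -
  obtain B where B: "B \<subseteq> T" "vec.independent B" "T \<subseteq> vec.span B"
    by (rule vec.basis_exists[of T])
  have "vec.span B \<subseteq> T" using B(1) assms(1) by (rule vec.span_minimal)
  hence v: "v \<notin> vec.span B" using assms(2) by auto
  hence vB: "v \<notin> B" using vec.span_base by auto
  have ind: "vec.independent (insert v B)" using B(2) v vB by (simp add: vec.independent_insert)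
  \<comment> \<open>The extended map takes values in \<open>'a ^ 'n\<close>; one coordinate of it,
    at an arbitrary index, is the functional.\<close>
  define i0 where "i0 = (undefined :: 'n)"
  obtain f :: "'a ^ 'n \<Rightarrow> 'a ^ 'n" where f: "Vector_Spaces.linear (*s) (*s) f"
    "\<forall>x\<in>insert v B. f x = (if x = v then axis i0 1 else 0)"
    using vec.linear_independent_extend[OF ind, of "\<lambda>x. if x = v then axis i0 1 else 0"] by auto
  define w where "w = matrix f $ i0"
  have fx: "(\<Sum>i\<in>UNIV. x $ i * w $ i) = f x $ i0" for x
  proof -
    have "f x $ i0 = (matrix f *v x) $ i0" by (simp only: matrix_works[OF f(1)])
    also have "\<dots> = (\<Sum>i\<in>UNIV. x $ i * w $ i)"
      by (simp add: matrix_vector_mult_def w_def mult.commute)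
    finally show ?thesis by simp
  qed
  have "f x = 0" if "x \<in> vec.span B" for x
  proof (rule vec.linear_eq_0_on_span[OF f(1) _ that])
    show "f b = 0" if "b \<in> B" for b using f(2) that vB by auto
  qed
  hence "\<forall>t\<in>T. (\<Sum>i\<in>UNIV. t $ i * w $ i) = 0" using B(3) by (auto simp: fx)
  moreover have "(\<Sum>i\<in>UNIV. v $ i * w $ i) = 1" using f(2) by (simp add: fx axis_def)
  ultimately show ?thesis by (rule that)
qed

context q_gt_one
begin

section \<open>Pairings of sequences with row vectors\<close>

definition pair :: "conv_germ ^ 'n \<Rightarrow> ('n \<Rightarrow> int \<Rightarrow> complex fls) \<Rightarrow> int \<Rightarrow> complex fls" where
  "pair l X k = (\<Sum>i\<in>UNIV. Rep_conv_germ (l $ i) * X i k)"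

definition vdil :: "conv_germ ^ 'n \<Rightarrow> conv_germ ^ 'n" where
  "vdil l = (\<chi> i. germ_dilate q (l $ i))"

text \<open>The semilinear operator on row vectors dual to the system: if
  \<open>\<sigma> X = A X\<close>, then \<open>\<sigma> (l X) = (Phi A l) X\<close>. The orbits that
  lead to scalar equations are orbits of this operator.\<close>

definition Phi :: "conv_germ ^ 'n ^ 'n \<Rightarrow> conv_germ ^ 'n \<Rightarrow> conv_germ ^ 'n" where
  "Phi A l = vdil l v* A"

definition resid :: "conv_germ ^ 'n ^ 'n \<Rightarrow> ('n \<Rightarrow> int \<Rightarrow> complex fls) \<Rightarrow>
    ('n \<Rightarrow> int \<Rightarrow> complex fls) \<Rightarrow> 'n \<Rightarrow> int \<Rightarrow> complex fls" where
  "resid A g X i k = shift 1 (X i) k - pair (A $ i) X k - g i k"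

lemma germ_dilate_add: "germ_dilate q (a + b) = germ_dilate q a + germ_dilate q b"
  and germ_dilate_mult: "germ_dilate q (a * b) = germ_dilate q a * germ_dilate q b"
  and germ_dilate_0: "germ_dilate q 0 = 0"
  by (simp_all add: Rep_conv_germ_inject[symmetric] fls_dilate_add fls_dilate_mult)

lemma germ_dilate_1: "germ_dilate q 1 = 1"
  by (simp add: Rep_conv_germ_inject[symmetric] fls_eq_iff)

lemma vdil_add: "vdil (l + m) = vdil l + vdil m"
  and vdil_scale: "vdil (c *s l) = germ_dilate q c *s vdil l"
  and vdil_0: "vdil 0 = 0"
  by (simp_all add: vdil_def vec_eq_iff germ_dilate_add germ_dilate_mult germ_dilate_0)

lemma Phi_add: "Phi A (l + m) = Phi A l + Phi A m"
  and Phi_scale: "Phi A (c *s l) = germ_dilate q c *s Phi A l"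
  and Phi_0: "Phi A 0 = 0"
  by (simp_all add: Phi_def vdil_add vdil_scale vdil_0 vector_matrix_mult_def vec_eq_iff
      sum.distrib sum_distrib_left algebra_simps)

lemma pair_add: "pair (l + m) X k = pair l X k + pair m X k"
  and pair_scale: "pair (c *s l) X k = Rep_conv_germ c * pair l X k"
  and pair_0: "pair 0 X k = 0"
  by (simp_all add: pair_def sum.distrib sum_distrib_left algebra_simps)

lemma pair_sum: "pair (\<Sum>m\<in>M. f m) X k = (\<Sum>m\<in>M. pair (f m) X k)"
  by (induction M rule: infinite_finite_induct) (simp_all add: pair_0 pair_add)

lemma pair_add_right: "pair l (\<lambda>i k. X i k + Z i k) k = pair l X k + pair l Z k"
  by (simp add: pair_def sum.distrib algebra_simps)

lemma flat_pair: "(\<And>i. flat (X i)) \<Longrightarrow> flat (pair l X)"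
  unfolding pair_def[abs_def] by (intro flat_sum flat_mult Rep_conv_germ_pos)

text \<open>Applying \<sigma> to the pairing of l with X dilates l. Tested against
  \<open>vdil l\<close>, the system thus becomes a relation between the pairings of X with l and
  with \<open>Phi A l\<close>.\<close>

lemma pair_resid:
  "pair (vdil l) (resid A g X) k = shift 1 (pair l X) k - pair (Phi A l) X k - pair (vdil l) g k"
proof -
  have "shift 1 (pair l X) k = (\<Sum>i\<in>UNIV. Rep_conv_germ (vdil l $ i) * shift 1 (X i) k)"
    unfolding pair_def[abs_def] shift_sum by (intro sum.cong refl) (simp add: shift_mult vdil_def)
  moreover have "pair (Phi A l) X k = (\<Sum>i\<in>UNIV. Rep_conv_germ (vdil l $ i) * pair (A $ i) X k)"
  proof -
    have "pair (Phi A l) X k =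
        (\<Sum>j\<in>UNIV. \<Sum>i\<in>UNIV. Rep_conv_germ (vdil l $ i) * (Rep_conv_germ (A $ i $ j) * X j k))"
      by (simp add: pair_def Phi_def vector_matrix_mult_def sum_distrib_right sum_distrib_left mult_ac)
    also have "\<dots> = (\<Sum>i\<in>UNIV. \<Sum>j\<in>UNIV. Rep_conv_germ (vdil l $ i) * (Rep_conv_germ (A $ i $ j) * X j k))"
      by (rule sum.swap)
    finally show ?thesis by (simp add: pair_def sum_distrib_left)
  qed
  ultimately show ?thesis
    by (simp add: pair_def resid_def right_diff_distrib sum_subtractf)
qed

text \<open>A correction Z enters linearly, and only through its pairings with l and
  \<open>Phi A l\<close>. So corrections can be found by prescribing pairings.\<close>

lemma pair_resid_add:
  "pair (vdil l) (resid A g (\<lambda>i k. X i k + Z i k)) k =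
    pair (vdil l) (resid A g X) k + shift 1 (pair l Z) k - pair (Phi A l) Z k"
proof -
  have "pair l (\<lambda>i k. X i k + Z i k) = (\<lambda>k. pair l X k + pair l Z k)"
    by (rule ext) (rule pair_add_right)
  thus ?thesis by (simp add: pair_resid shift_add pair_add_right)
qed

text \<open>Since \<open>\<nu> d\<close> is independent of T and its predecessors, some w
  annihilates all of those and pairs to 1 with \<open>\<nu> d\<close>. Adding a flat multiple of w
  corrects the last pairing without disturbing the earlier ones.\<close>

lemma prescribed_pairings:
  fixes \<nu> :: "nat \<Rightarrow> conv_germ ^ 'n"
  assumes T: "vec.subspace T" and z: "\<And>m. flat (z m)"
    and ind: "\<And>m. m < d \<Longrightarrow> \<nu> m \<notin> vec.span (T \<union> \<nu> ` {..<m})"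
  shows "\<exists>Z. (\<forall>i. flat (Z i)) \<and> (\<forall>t\<in>T. \<forall>k. pair t Z k = 0) \<and> (\<forall>m<d. \<forall>k. pair (\<nu> m) Z k = z m k)"
  using ind
proof (induction d)
  case 0
  show ?case by (intro exI[of _ "\<lambda>i k. 0"]) (simp add: flat_zero pair_def)
next
  case (Suc d)
  obtain Z where Z: "\<forall>i. flat (Z i)" "\<forall>t\<in>T. \<forall>k. pair t Z k = 0" "\<forall>m<d. \<forall>k. pair (\<nu> m) Z k = z m k"
    using Suc by auto
  obtain w where w: "\<forall>t\<in>vec.span (T \<union> \<nu> ` {..<d}). (\<Sum>i\<in>UNIV. t $ i * w $ i) = 0"
    "(\<Sum>i\<in>UNIV. \<nu> d $ i * w $ i) = 1"
    by (rule annihilator_exists[OF vec.subspace_span Suc.prems[OF lessI]])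
  define h where "h k = z d k - pair (\<nu> d) Z k" for k
  have h: "flat h" unfolding h_def[abs_def] using Z(1) z by (intro flat_diff flat_pair) auto
  define Z' where "Z' i k = Z i k + Rep_conv_germ (w $ i) * h k" for i k
  have pair_Z': "pair l Z' k = pair l Z k + Rep_conv_germ (\<Sum>i\<in>UNIV. l $ i * w $ i) * h k" for l k
    by (simp add: pair_def Z'_def sum.distrib sum_distrib_right sum_distrib_left algebra_simps)
  have kill: "pair l Z' k = pair l Z k" if "l \<in> T \<union> \<nu> ` {..<d}" for l k
    using bspec[OF w(1) vec.span_base[OF that]] by (simp add: pair_Z')
  show ?case
  proof (intro exI[of _ Z'] conjI allI ballI impI)
    show "flat (Z' i)" for i
      unfolding Z'_def[abs_def] using Z(1) h by (intro flat_add flat_mult Rep_conv_germ_pos) auto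
    show "pair t Z' k = 0" if "t \<in> T" for t k using kill[of t k] that Z(2) by simp
    show "pair (\<nu> m) Z' k = z m k" if "m < Suc d" for m k
    proof (cases "m = d")
      case True
      thus ?thesis by (simp add: pair_Z' w(2) h_def)
    next
      case False
      thus ?thesis using kill[of "\<nu> m" k] that Z(3) by simp
    qed
  qed
qed

lemma span_chain_coefficients:
  fixes \<nu> :: "nat \<Rightarrow> conv_germ ^ 'n"
  assumes "vec.subspace T" "x \<in> vec.span (T \<union> \<nu> ` {..<d})"
  shows "\<exists>t\<in>T. \<exists>c. x = t + (\<Sum>m<d. c m *s \<nu> m)"
  using assms(2)
proof (induction d arbitrary: x)
  case 0
  moreover have "vec.span T = T" using assms(1) by (simp only: vec.span_eq_iff)
  ultimately show ?case by auto
next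
  case (Suc d)
  have "T \<union> \<nu> ` {..<Suc d} = insert (\<nu> d) (T \<union> \<nu> ` {..<d})" by (auto simp: lessThan_Suc)
  then obtain e where "x - e *s \<nu> d \<in> vec.span (T \<union> \<nu> ` {..<d})"
    using Suc.prems by (auto simp: vec.span_insert)
  from Suc.IH[OF this] obtain t c where tc: "t \<in> T" "x - e *s \<nu> d = t + (\<Sum>m<d. c m *s \<nu> m)" by auto
  have "x = t + (\<Sum>m<Suc d. (c(d := e)) m *s \<nu> m)"
    using tc(2) by (simp add: algebra_simps)
  thus ?case using tc(1) by blast
qed

text \<open>Otherwise every step would raise the dimension by one, beyond that of the whole
  space.\<close>

lemma dependent_iterate:
  fixes \<nu> :: "nat \<Rightarrow> conv_germ ^ 'n"
  shows "\<exists>d. \<nu> d \<in> vec.span (T \<union> \<nu> ` {..<d})"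
proof (rule ccontr)
  assume "\<not> ?thesis"
  hence *: "\<nu> d \<notin> vec.span (T \<union> \<nu> ` {..<d})" for d by blast
  have "d \<le> vec.dim (T \<union> \<nu> ` {..<d})" for d
  proof (induction d)
    case (Suc d)
    have "T \<union> \<nu> ` {..<Suc d} = insert (\<nu> d) (T \<union> \<nu> ` {..<d})" by (auto simp: lessThan_Suc)
    thus ?case using Suc * by (simp add: vec.dim_insert)
  qed simp
  from this[of "Suc (vec.dimension TYPE(conv_germ) TYPE('n))"] show False
    using vec.dim_subset_UNIV[of "T \<union> \<nu> ` {..<Suc (vec.dimension TYPE(conv_germ) TYPE('n))}"] by simp
qed

text \<open>The residual is tested against \<open>vdil l\<close>, the combination that arises from
  \<sigma> applied to the pairing with l. Unit vectors are fixed by \<open>vdil\<close>, so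
  \<open>T = UNIV\<close> gives back the whole system.\<close>

definition solves_on :: "conv_germ ^ 'n ^ 'n \<Rightarrow> ('n \<Rightarrow> int \<Rightarrow> complex fls) \<Rightarrow>
    (conv_germ ^ 'n) set \<Rightarrow> ('n \<Rightarrow> int \<Rightarrow> complex fls) \<Rightarrow> bool" where
  "solves_on A g T X \<longleftrightarrow> (\<forall>i. flat (X i)) \<and>
     (\<forall>l\<in>T. \<forall>\<^sub>F k in at_top. pair (vdil l) (resid A g X) k = 0)"

lemma solves_on_span:
  assumes "solves_on A g T X"
  shows "solves_on A g (vec.span T) X"
  unfolding solves_on_def
proof (intro conjI ballI)
  show "\<forall>i. flat (X i)" using assms by (simp add: solves_on_def)
  fix l assume "l \<in> vec.span T"
  thus "\<forall>\<^sub>F k in at_top. pair (vdil l) (resid A g X) k = 0"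
  proof (induction rule: vec.span_induct_alt)
    case base
    show ?case by (simp add: vdil_0 pair_0)
  next
    case (step c x y)
    have "\<forall>\<^sub>F k in at_top. pair (vdil x) (resid A g X) k = 0"
      using assms step(1) by (simp add: solves_on_def)
    thus ?case using step(2)
      by eventually_elim (simp add: vdil_add vdil_scale pair_add pair_scale)
  qed
qed

text \<open>For a \<open>\<Phi>\<close>-stable space \<open>T\<close> of row vectors, the pairings of \<open>X\<close> with \<open>T\<close> satisfy a
  system of their own. Adding the orbit of one vector amounts to one scalar equation.\<close>

lemma solves_on_extend:
  fixes A :: "conv_germ ^ 'n ^ 'n"
  assumes g: "\<And>i. flat (g i)" and T: "vec.subspace T" "Phi A ` T \<subseteq> T" "solves_on A g T X" and l: "l \<notin> T"
  obtains T' X' where "vec.subspace T'" "Phi A ` T' \<subseteq> T'" "solves_on A g T' X'" "T \<subset> T'"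
proof -
  define \<nu> where "\<nu> m = (Phi A ^^ m) l" for m
  define S where "S d = vec.span (T \<union> \<nu> ` {..<d})" for d
  \<comment> \<open>By minimality \<open>\<nu> 0, ..., \<nu> (d - 1)\<close> are independent modulo
    T, so their pairings can be prescribed freely; \<open>\<nu> d\<close> supplies the closing
    relation.\<close>
  define d where "d = (LEAST d. \<nu> d \<in> S d)"
  have d: "\<nu> d \<in> S d" unfolding d_def S_def by (rule LeastI_ex[OF dependent_iterate])
  have ind: "\<nu> m \<notin> S m" if "m < d" for m using not_less_Least[of m] that unfolding d_def by blast
  have "vec.span T = T" using T(1) by (simp only: vec.span_eq_iff)
  hence "S 0 = T" by (simp add: S_def)
  moreover have "\<nu> 0 = l" by (simp add: \<nu>_def)
  ultimately have "d \<noteq> 0" using d l by metis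
  then obtain d' where d': "d = Suc d'" by (cases d) auto
  have \<nu>_Suc: "\<nu> (Suc m) = Phi A (\<nu> m)" for m by (simp add: \<nu>_def)
  obtain t c where tc: "t \<in> T" "\<nu> d = t + (\<Sum>m<d. c m *s \<nu> m)"
    using span_chain_coefficients[OF T(1) d[unfolded S_def]] by auto

  have flat_X: "flat (X i)" for i using T(3) by (simp add: solves_on_def)
  define \<rho> where "\<rho> m = pair (vdil (\<nu> m)) (resid A g X)" for m
  have flat_resid: "flat (resid A g X i)" for i
    unfolding resid_def[abs_def] by (intro flat_diff flat_shift flat_X flat_pair g)
  have \<rho>: "flat (\<rho> m)" for m unfolding \<rho>_def by (intro flat_pair flat_resid)
  \<comment> \<open>The equations at \<open>\<nu> m\<close> force
    \<open>z (m + 1) = \<sigma> (z m) + \<rho> m\<close> on the pairings of the correction. W is the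
    particular solution starting from 0; the general one adds \<open>\<sigma>^m y\<close>, so only y
    is unknown.\<close>
  define W where "W = rec_nat (\<lambda>k. 0) (\<lambda>m x k. shift 1 x k + \<rho> m k)"
  have W0: "W 0 = (\<lambda>k. 0)" and WS: "W (Suc m) = (\<lambda>k. shift 1 (W m) k + \<rho> m k)" for m
    by (simp_all add: W_def)
  have flat_W: "flat (W m)" for m
    by (induction m) (auto simp: W0 WS intro!: flat_zero flat_add flat_shift \<rho>)
  \<comment> \<open>The closing relation \<open>\<nu> d = t + (\<Sum>m<d. c m *s \<nu> m)\<close>,
    read as an equation of order d for y with leading coefficient 1; t drops out because the
    correction pairs to 0 with T.\<close>
  define a where "a m = (if m = d then 1 else - c m)" for m
  have G: "flat (\<lambda>k. (\<Sum>m<d. Rep_conv_germ (c m) * W m k) - W d k)"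
    by (intro flat_diff flat_sum flat_mult flat_W Rep_conv_germ_pos)
  have "a d \<noteq> 0" by (simp add: a_def)
  obtain y where y: "flat y" "\<forall>\<^sub>F k in at_top. (\<Sum>m\<le>d. Rep_conv_germ (a m) * shift (int m) y k) =
      (\<Sum>m<d. Rep_conv_germ (c m) * W m k) - W d k"
    by (rule scalar_equation[of a d, OF \<open>a d \<noteq> 0\<close> G])
  define z where "z m = (\<lambda>k. shift (int m) y k + W m k)" for m
  have z: "flat (z m)" for m unfolding z_def by (intro flat_add flat_shift y(1) flat_W)
  have zS: "z (Suc m) k = shift 1 (z m) k + \<rho> m k" for m k
    by (simp add: z_def WS shift_add shift_shift add.assoc)
  have zd: "\<forall>\<^sub>F k in at_top. z d k = (\<Sum>m<d. Rep_conv_germ (c m) * z m k)"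
    using y(2)
  proof eventually_elim
    case (elim k)
    have "(\<Sum>m\<le>d. Rep_conv_germ (a m) * shift (int m) y k) =
        shift (int d) y k - (\<Sum>m<d. Rep_conv_germ (c m) * shift (int m) y k)"
      by (simp add: lessThan_Suc_atMost[symmetric] a_def sum_negf)
    thus ?case using elim by (simp add: z_def distrib_left sum.distrib algebra_simps)
  qed

  obtain Z where Z: "\<forall>i. flat (Z i)" "\<forall>t\<in>T. \<forall>k. pair t Z k = 0" "\<forall>m<d. \<forall>k. pair (\<nu> m) Z k = z m k"
    using prescribed_pairings[of T z d \<nu>, OF T(1) z ind[unfolded S_def]] by blast
  have pair_\<nu>d: "pair (\<nu> d) Z k = (\<Sum>m<d. Rep_conv_germ (c m) * z m k)" for k
    using Z(2) tc(1) Z(3) by (simp add: tc(2) pair_add pair_sum pair_scale)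
  define X' where "X' = (\<lambda>i k. X i k + Z i k)"
  have "solves_on A g (T \<union> \<nu> ` {..<d}) X'"
    unfolding solves_on_def
  proof (intro conjI allI ballI)
    show "flat (X' i)" for i unfolding X'_def using Z(1) flat_X by (intro flat_add) auto
    fix x assume "x \<in> T \<union> \<nu> ` {..<d}"
    then consider "x \<in> T" | m where "m < d'" "x = \<nu> m" | "x = \<nu> d'"
      using d' by (auto simp: less_Suc_eq)
    thus "\<forall>\<^sub>F k in at_top. pair (vdil x) (resid A g X') k = 0"
    proof cases
      case 1
      \<comment> \<open>Stability of T enters here: \<open>Phi A x\<close> lies in T too, so the
        correction leaves the equations already solved untouched.\<close>
      have "pair x Z = (\<lambda>k. 0)" "pair (Phi A x) Z k = 0" for k
        using Z(2) 1 T(2) by auto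
      hence "pair (vdil x) (resid A g X') k = pair (vdil x) (resid A g X) k" for k
        unfolding X'_def pair_resid_add by (simp add: shift_def)
      thus ?thesis using T(3) 1 by (simp add: solves_on_def)
    next
      case (2 m)
      have "pair (\<nu> m) Z = z m" "pair (\<nu> (Suc m)) Z k = z (Suc m) k" for k
        using Z(3) 2 d' by auto
      hence "pair (vdil x) (resid A g X') k = 0" for k
        unfolding X'_def pair_resid_add 2 by (simp add: \<nu>_Suc[symmetric] zS \<rho>_def)
      thus ?thesis by simp
    next
      \<comment> \<open>Only the last generator meets the closing relation, so this is the one new
        equation that holds merely for large k.\<close>
      case 3
      have "pair (\<nu> d') Z = z d'" using Z(3) d' by auto
      hence "pair (vdil x) (resid A g X') k = z d k - pair (\<nu> d) Z k" for k
        unfolding X'_def pair_resid_add 3 d' by (simp add: \<nu>_Suc[symmetric] zS \<rho>_def)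
      thus ?thesis using zd by (simp add: pair_\<nu>d)
    qed
  qed
  hence sol: "solves_on A g (S d) X'" unfolding S_def by (rule solves_on_span)
  have "Phi A x \<in> S d" if "x \<in> S d" for x
    using that unfolding S_def[of d]
  proof (induction rule: vec.span_induct_alt)
    case base
    show ?case by (simp add: Phi_0 vec.span_zero)
  next
    case (step e x y)
    have "Phi A x \<in> S d"
    proof (cases "x \<in> T")
      case True
      thus ?thesis unfolding S_def using T(2) by (intro vec.span_base) auto
    next
      case False
      then obtain m where m: "m < d" "x = \<nu> m" using step(1) by auto
      show ?thesis
      proof (cases "Suc m = d")
        case True
        thus ?thesis using d m by (simp add: \<nu>_Suc[symmetric])
      next
        case False
        hence "\<nu> (Suc m) \<in> S d" unfolding S_def using m by (intro vec.span_base) auto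
        thus ?thesis by (simp add: m \<nu>_Suc)
      qed
    qed
    thus ?case using step(2) unfolding Phi_add Phi_scale S_def
      by (intro vec.span_add vec.span_scale)
  qed
  hence stable: "Phi A ` S d \<subseteq> S d" by auto
  have "T \<subseteq> S d" "l \<in> S d"
    unfolding S_def using \<open>d \<noteq> 0\<close> \<open>\<nu> 0 = l\<close> by (auto intro!: vec.span_base image_eqI[of l \<nu> 0])
  hence "T \<subset> S d" using l by auto
  show ?thesis
    by (rule that[OF _ stable sol \<open>T \<subset> S d\<close>]) (simp add: S_def)
qed

text \<open>Take a stable subspace of maximal dimension on which the system is solvable, starting
  from \<open>{0}\<close>. A vector outside it would allow an extension, so it is the whole
  space.\<close>

lemma flat_system:
  fixes A :: "conv_germ ^ 'n ^ 'n"
  assumes g: "\<And>i. flat (g i)"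
  obtains X where "\<forall>i. flat (X i)"
    "\<forall>i. \<forall>\<^sub>F k in at_top. shift 1 (X i) k = pair (A $ i) X k + g i k"
proof -
  define P where "P T \<longleftrightarrow> vec.subspace T \<and> Phi A ` T \<subseteq> T \<and> (\<exists>X. solves_on A g T X)" for T
  have "P {0}"
    unfolding P_def solves_on_def
    by (auto simp: Phi_0 vdil_0 pair_0 intro!: exI[of _ "\<lambda>i k. 0"] flat_zero)
  have "\<forall>T. P T \<longrightarrow> vec.dim T < Suc (vec.dimension TYPE(conv_germ) TYPE('n))"
    by (simp add: less_Suc_eq_le vec.dim_subset_UNIV)
  from ex_has_greatest_nat[OF \<open>P {0}\<close> this]
  obtain T where T: "P T" "\<forall>T'. P T' \<longrightarrow> vec.dim T' \<le> vec.dim T" by auto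
  have "T = UNIV"
  proof (rule ccontr)
    assume "T \<noteq> UNIV"
    then obtain l where l: "l \<notin> T" by auto
    obtain X where X: "vec.subspace T" "Phi A ` T \<subseteq> T" "solves_on A g T X"
      using T(1) by (auto simp: P_def)
    obtain T' X' where T': "vec.subspace T'" "Phi A ` T' \<subseteq> T'" "solves_on A g T' X'" "T \<subset> T'"
      by (rule solves_on_extend[OF g X l])
    have "vec.span T \<subset> vec.span T'" using T' X(1) by (metis vec.span_eq_iff)
    hence "vec.dim T < vec.dim T'" by (rule vec.dim_psubset)
    moreover have "P T'" using T' by (auto simp: P_def)
    ultimately show False using T(2) by fastforce
  qed
  then obtain X where X: "\<forall>i. flat (X i)" "\<And>l. \<forall>\<^sub>F k in at_top. pair (vdil l) (resid A g X) k = 0"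
    using T(1) by (auto simp: P_def solves_on_def)
  have "\<forall>\<^sub>F k in at_top. shift 1 (X i) k = pair (A $ i) X k + g i k" for i
  proof -
    have "vdil (axis i 1) = axis i 1"
      by (simp add: vdil_def vec_eq_iff axis_def germ_dilate_0 germ_dilate_1)
    moreover have "pair (axis i 1) Y k = Y i k" for Y k
    proof -
      have "pair (axis i 1) Y k = (\<Sum>j\<in>UNIV. if j = i then Y j k else 0)"
        unfolding pair_def by (intro sum.cong) (auto simp: axis_def)
      thus ?thesis by simp
    qed
    ultimately have "\<forall>\<^sub>F k in at_top. resid A g X i k = 0" using X(2)[of "axis i 1"] by simp
    thus ?thesis by eventually_elim (simp add: resid_def algebra_simps)
  qed
  thus ?thesis using X(1) that by blast
qed

end

section \<open>From sequences to germs\<close>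

lemma coeff_below_0_subdegree: "coeff_below F 0 \<Longrightarrow> fls_subdegree F \<ge> 0"
  by (cases "F = 0") (auto simp: coeff_below_def intro!: fls_subdegree_geI)

lemma eval_fls_sums:
  assumes "coeff_below F 0" "ereal (norm z) < fls_conv_radius F"
  shows "(\<lambda>n. F $$ int n * z ^ n) sums eval_fls F z"
proof -
  have F: "F = fps_to_fls (fls_regpart F)"
    using assms(1) by (auto simp: fls_eq_iff coeff_below_def)
  have "(\<lambda>n. fps_nth (fls_regpart F) n * z ^ n) sums eval_fps (fls_regpart F) z"
    using assms(2) by (intro sums_eval_fps) (simp add: fps_conv_radius_fls_regpart)
  also have "eval_fps (fls_regpart F) z = eval_fls F z"
    using assms(2) by (subst (2) F, subst eval_fps_to_fls) (simp_all add: fps_conv_radius_fls_regpart)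
  finally show ?thesis by simp
qed

lemma eval_fls_dilate:
  assumes "coeff_below F 0" "ereal (norm (c * z)) < fls_conv_radius F"
  shows "eval_fls (fls_dilate c F) z = eval_fls F (c * z)"
proof (rule eval_fls_eq[of 0])
  have *: "coeff_below (fls_dilate c F) 0" using assms(1) by (simp add: coeff_below_def)
  show "0 \<le> fls_subdegree (fls_dilate c F)" "0 \<le> fls_subdegree (fls_dilate c F) \<or> z \<noteq> 0"
    using coeff_below_0_subdegree[OF *] by auto
  show "(\<lambda>n. fls_dilate c F $$ (int n + 0) * z powi (int n + 0)) sums eval_fls F (c * z)"
    using eval_fls_sums[OF assms] by (simp add: power_mult_distrib mult_ac)
qed

lemma eval_fls_sum:
  assumes "finite I" "z \<noteq> 0" "\<And>i. i \<in> I \<Longrightarrow> ereal (norm z) < fls_conv_radius (F i)"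
  shows "ereal (norm z) < fls_conv_radius (sum F I) \<and>
    eval_fls (sum F I) z = (\<Sum>i\<in>I. eval_fls (F i) z)"
  using assms(1,3)
proof (induction I rule: finite_induct)
  case (insert j I)
  hence 1: "ereal (norm z) < fls_conv_radius (F j)" "ereal (norm z) < fls_conv_radius (sum F I)"
    "eval_fls (sum F I) z = (\<Sum>i\<in>I. eval_fls (F i) z)" by auto
  have "ereal (norm z) < min (fls_conv_radius (F j)) (fls_conv_radius (sum F I))" using 1 by simp
  also have "\<dots> \<le> fls_conv_radius (F j + sum F I)" by (rule fls_conv_radius_add)
  finally show ?case using insert 1 assms(2) by (simp add: eval_fls_add)
qed simp

lemma eval_fls_tail:
  assumes "coeff_below F 0" "ereal (norm z) < fls_conv_radius F"
    and b: "\<And>n. n \<ge> M \<Longrightarrow> norm (F $$ int n) \<le> B * a ^ n" and "B \<ge> 0" "a \<ge> 0" "a * norm z \<le> 1 / 2"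
  shows "norm (eval_fls F z - (\<Sum>j<M. F $$ int j * z ^ j)) \<le> 2 * B * (a * norm z) ^ M"
proof -
  have "(\<lambda>n. F $$ int (n + M) * z ^ (n + M)) sums (eval_fls F z - (\<Sum>j<M. F $$ int j * z ^ j))"
    by (rule sums_split_initial_segment[OF eval_fls_sums[OF assms(1,2)]])
  hence eq: "eval_fls F z - (\<Sum>j<M. F $$ int j * z ^ j) = (\<Sum>n. F $$ int (n + M) * z ^ (n + M))"
    by (simp add: sums_iff)
  have le: "norm (F $$ int (n + M) * z ^ (n + M)) \<le> B * (a * norm z) ^ M * (1 / 2) ^ n" for n
  proof -
    have "norm (F $$ int (n + M) * z ^ (n + M)) \<le> B * a ^ (n + M) * norm z ^ (n + M)"
      unfolding norm_mult norm_power using b[of "n + M"] by (intro mult_right_mono) auto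
    also have "\<dots> = B * (a * norm z) ^ M * (a * norm z) ^ n"
      by (simp add: power_add power_mult_distrib)
    also have "\<dots> \<le> B * (a * norm z) ^ M * (1 / 2) ^ n"
      using assms by (intro mult_left_mono power_mono) auto
    finally show ?thesis .
  qed
  have sm: "summable (\<lambda>n. B * (a * norm z) ^ M * (1 / 2) ^ n)"
    by (intro summable_mult summable_geometric) auto
  have "norm (\<Sum>n. F $$ int (n + M) * z ^ (n + M)) \<le> (\<Sum>n. B * (a * norm z) ^ M * (1 / 2) ^ n)"
    by (rule norm_suminf_le[OF le sm])
  also have "\<dots> = B * (a * norm z) ^ M * 2"
    by (subst suminf_mult) (auto simp: suminf_geometric intro!: summable_geometric)
  finally show ?thesis by (simp add: eq)
qed

context q_gt_one
begin

text \<open>A tempered truncation Y of the formal solution has a flat defect, and the flat solution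
  Z of the system with that defect as right-hand side corrects it.\<close>

lemma tempered_formal_solution:
  fixes A :: "conv_germ ^ 'n ^ 'n" and F :: "'n \<Rightarrow> complex fps"
  assumes "\<And>i. fls_dilate q (fps_to_fls (F i)) =
    (\<Sum>j\<in>UNIV. Rep_conv_germ (A $ i $ j) * fps_to_fls (F j))"
  obtains X where "\<forall>i. tempered (X i)" "\<forall>i. vanishing (\<lambda>k. X i k - fps_to_fls (F i))"
    "\<forall>i. \<forall>\<^sub>F k in at_top. shift 1 (X i) k = pair (A $ i) X k"
proof -
  \<comment> \<open>Truncation by the size of the coefficients rather than by degree: the bound
    \<open>Q^k\<close> makes Y tempered however fast the formal series diverges, and each single
    coefficient is kept from some k on.\<close>
  define Y where "Y i k = fps_to_fls (Abs_fps (\<lambda>n.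
      if norm (fps_nth (F i) n) \<le> Q powr of_int k then fps_nth (F i) n else 0))" for i k
  have Y_nth: "Y i k $$ n = (if n \<ge> 0 \<and> norm (fps_nth (F i) (nat n)) \<le> Q powr of_int k
      then fps_nth (F i) (nat n) else 0)" for i k n
    by (simp add: Y_def)
  have tY: "tempered (Y i)" for i
  proof -
    have "tempered_by (1 / 2) 1 (Y i)"
      using eventually_ge_at_top[of 0] unfolding tempered_by_def
      apply eventually_elim
      apply (rule allI)
      subgoal premises elim for k n
      proof (cases "n \<ge> 0")
        case True
        have "norm (Y i k $$ n) \<le> Q powr of_int k" by (simp add: Y_nth)
        also have "\<dots> \<le> Q powr (of_int k * ((1 - 1 / 2) * of_int n + 1))"
          using True elim by (simp add: algebra_simps)
        finally show ?thesis using True by simp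
      qed (simp add: Y_nth)
      done
    thus ?thesis unfolding tempered_def by (intro exI[of _ "1 / 2"] exI[of _ 1]) auto
  qed
  have vY: "vanishing (\<lambda>k. Y i k - fps_to_fls (F i))" for i
    unfolding vanishing_def
  proof
    fix N
    have "\<forall>\<^sub>F k in at_top. \<forall>n\<in>{..<nat N}. norm (fps_nth (F i) n) \<le> Q powr of_int k"
    proof (rule eventually_ball_finite)
      show "\<forall>n\<in>{..<nat N}. \<forall>\<^sub>F k in at_top. norm (fps_nth (F i) n) \<le> Q powr of_int k"
      proof
        fix n
        show "\<forall>\<^sub>F k in at_top. norm (fps_nth (F i) n) \<le> Q powr of_int k"
        proof (cases "fps_nth (F i) n = 0")
          case False
          show ?thesis
            using eventually_real_of_int_ge[of "log Q (norm (fps_nth (F i) n))"]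
          proof eventually_elim
            case (elim k)
            have "norm (fps_nth (F i) n) = Q powr (log Q (norm (fps_nth (F i) n)))"
              using False q_gt_1 by simp
            also have "\<dots> \<le> Q powr of_int k" using elim by simp
            finally show ?case .
          qed
        qed simp
      qed
    qed simp
    thus "\<forall>\<^sub>F k in at_top. coeff_below (Y i k - fps_to_fls (F i)) N"
    proof eventually_elim
      case (elim k)
      show ?case unfolding coeff_below_def
      proof (intro allI impI)
        fix n assume "n < N"
        thus "(Y i k - fps_to_fls (F i)) $$ n = 0" using elim by (auto simp: Y_nth)
      qed
    qed
  qed
  define g where "g i k = pair (A $ i) Y k - shift 1 (Y i) k" for i k
  have fg: "flat (g i)" for i
    unfolding flat_def
  proof
    show "tempered (g i)"
      unfolding g_def[abs_def] pair_def
      by (intro tempered_diff tempered_sum tempered_mult tempered_shift tY Rep_conv_germ_pos)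
    \<comment> \<open>By the formal equation the defect of Y equals that of \<open>Y - F\<close>,
      which has vanishing components.\<close>
    have "g i k = (\<Sum>j\<in>UNIV. Rep_conv_germ (A $ i $ j) * (Y j k - fps_to_fls (F j)))
        - shift 1 (\<lambda>k. Y i k - fps_to_fls (F i)) k" for k
      using assms[of i]
      by (simp add: g_def pair_def shift_def fls_dilate_diff right_diff_distrib sum_subtractf)
    hence "g i = (\<lambda>k. (\<Sum>j\<in>UNIV. Rep_conv_germ (A $ i $ j) * (Y j k - fps_to_fls (F j)))
        - shift 1 (\<lambda>k. Y i k - fps_to_fls (F i)) k)" by (rule ext)
    moreover have "vanishing (\<lambda>k. (\<Sum>j\<in>UNIV. Rep_conv_germ (A $ i $ j) * (Y j k - fps_to_fls (F j)))
        - shift 1 (\<lambda>k. Y i k - fps_to_fls (F i)) k)"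
      by (intro vanishing_diff vanishing_sum vanishing_mult vanishing_shift vY)
    ultimately show "vanishing (g i)" by simp
  qed
  obtain Z where Z: "\<forall>i. flat (Z i)" "\<forall>i. \<forall>\<^sub>F k in at_top. shift 1 (Z i) k = pair (A $ i) Z k + g i k"
    by (rule flat_system[of g A, OF fg])
  show ?thesis
  proof (rule that[of "\<lambda>i k. Y i k + Z i k"])
    show "\<forall>i. tempered (\<lambda>k. Y i k + Z i k)"
      using Z(1) tY by (auto simp: flat_def intro: tempered_add)
    show "\<forall>i. vanishing (\<lambda>k. Y i k + Z i k - fps_to_fls (F i))"
    proof
      fix i
      have "vanishing (\<lambda>k. (Y i k - fps_to_fls (F i)) + Z i k)"
        using Z(1) vY by (intro vanishing_add) (auto simp: flat_def)
      thus "vanishing (\<lambda>k. Y i k + Z i k - fps_to_fls (F i))" by (simp add: algebra_simps)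
    qed
    show "\<forall>i. \<forall>\<^sub>F k in at_top. shift 1 (\<lambda>k. Y i k + Z i k) k = pair (A $ i) (\<lambda>i k. Y i k + Z i k) k"
    proof
      fix i
      show "\<forall>\<^sub>F k in at_top. shift 1 (\<lambda>k. Y i k + Z i k) k = pair (A $ i) (\<lambda>i k. Y i k + Z i k) k"
        using spec[OF Z(2), of i]
        by eventually_elim (simp add: shift_add pair_add_right g_def)
    qed
  qed
qed

lemma fls_conv_radius_ge_powr:
  assumes "\<And>n. norm (F $$ int n) \<le> B * a ^ n" "a > 0"
  shows "fls_conv_radius F \<ge> ereal (1 / a)"
  unfolding fls_conv_radius_def fps_conv_radius_def
proof (rule conv_radius_geI_ex')
  fix r assume r: "0 < r" "ereal r < ereal (1 / a)"
  have ar: "a * r < 1" using r assms(2) by (simp add: field_simps)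
  show "summable (\<lambda>n. fps_nth (fls_regpart F) n * of_real r ^ n)"
  proof (rule summable_comparison_test')
    show "summable (\<lambda>n. B * (a * r) ^ n)"
      using ar r assms(2) by (intro summable_mult summable_geometric) (auto simp: abs_mult)
    fix n :: nat
    show "norm (fps_nth (fls_regpart F) n * of_real r ^ n) \<le> B * (a * r) ^ n"
      using mult_right_mono[OF assms(1)[of n], of "r ^ n"] r
      by (simp add: norm_mult norm_power power_mult_distrib mult.assoc)
  qed
qed

lemma Eq_proj_div: "Eq_proj q (z / q ^ k) = Eq_proj q z"
proof -
  have "q powi j * (z / q ^ k) = q powi (j - int k) * z" for j
    by (simp add: power_int_diff)
  moreover have "range (\<lambda>j. q powi (j - int k) * z) = range (\<lambda>j. q powi j * z)"
  proof (intro equalityI subsetI)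
    fix y assume "y \<in> range (\<lambda>j. q powi j * z)"
    then obtain j where "y = q powi j * z" by auto
    thus "y \<in> range (\<lambda>j. q powi (j - int k) * z)"
      by (intro range_eqI[of _ _ "j + int k"]) simp
  qed auto
  ultimately show ?thesis by (simp add: Eq_proj_def)
qed

section \<open>Domains of the solution and the asymptotic estimate\<close>

definition piece :: "complex set \<Rightarrow> nat \<Rightarrow> complex set" where
  "piece U0 k = (\<lambda>z. z / q ^ k) ` U0"

text \<open>The part of the k-th piece inside the disc where the k-th series converges. The
  parameter s leaves room for multiplication by q.\<close>

definition spiral :: "complex set \<Rightarrow> real \<Rightarrow> real \<Rightarrow> nat \<Rightarrow> complex set" where
  "spiral U0 \<epsilon> s k = piece U0 k \<inter> {z. norm z < Q powr ((\<epsilon> - 1) * real k - s)}"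

lemma mem_piece_iff: "z \<in> piece U0 k \<longleftrightarrow> z * q ^ k \<in> U0"
  by (auto simp: piece_def image_iff intro!: bexI[of _ "z * q ^ k"])

lemma open_piece: "open U0 \<Longrightarrow> open (piece U0 k)"
proof -
  assume "open U0"
  hence "open ((\<lambda>z. z * q ^ k) -` U0)" by (intro open_vimage continuous_intros) auto
  also have "(\<lambda>z. z * q ^ k) -` U0 = piece U0 k" by (auto simp: mem_piece_iff)
  finally show ?thesis .
qed

lemma open_spiral: "open U0 \<Longrightarrow> open (spiral U0 \<epsilon> s k)"
  unfolding spiral_def by (intro open_Int open_piece open_Collect_less continuous_intros)

text \<open>Division by q shrinks a point by \<open>Q\<close> but the admissible radius only by
  \<open>Q^(1 - \<epsilon>)\<close>, hence invariance. The same comparison shows that every orbit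
  enters the domain: \<open>|w| Q^(-k)\<close> falls below \<open>Q^((\<epsilon> - 1) k - s)\<close>
  for large k.\<close>

lemma spirals_over:
  assumes "open U0" "0 \<notin> (\<Union>k. piece U0 k)" "0 < \<epsilon>" "\<epsilon> < 1"
  shows "(\<Union>k\<in>{\<kappa>..}. spiral U0 \<epsilon> s k) \<in> invariant_opens_over q (Eq_proj q ` (\<Union>k. piece U0 k))"
    (is "?V \<in> _")
proof -
  have "z / q \<in> ?V" if z: "z \<in> ?V" for z
  proof -
    obtain k where k: "k \<ge> \<kappa>" "z \<in> piece U0 k" "norm z < Q powr ((\<epsilon> - 1) * real k - s)"
      using z by (auto simp: spiral_def)
    have "norm (z / q) < Q powr ((\<epsilon> - 1) * real k - s) / Q"
      using k(3) by (simp add: norm_divide divide_strict_right_mono)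
    also have "\<dots> = Q powr ((\<epsilon> - 1) * real k - s - 1)" using q_gt_1 by (simp add: powr_diff)
    also have "\<dots> \<le> Q powr ((\<epsilon> - 1) * real (Suc k) - s)" using assms by (simp add: algebra_simps)
    finally have "z / q \<in> spiral U0 \<epsilon> s (Suc k)" using k(2) by (simp add: spiral_def mem_piece_iff)
    thus ?thesis using k(1) by (intro UN_I[of "Suc k"]) auto
  qed
  moreover have "open ?V" using assms(1) by (intro open_UN ballI open_spiral)
  moreover have "0 \<notin> ?V" using assms(2) by (auto simp: spiral_def)
  ultimately have "q_invariant_open q ?V"
    unfolding q_invariant_open_def by blast
  moreover have "Eq_proj q u \<in> Eq_proj q ` ?V" if u: "u \<in> piece U0 k" for u k
  proof -
    define w where "w = u * q ^ k"
    have w: "w \<in> U0" using u by (simp add: w_def mem_piece_iff)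
    have "w \<in> piece U0 0" using w by (simp add: mem_piece_iff)
    hence "w \<noteq> 0" using assms(2) by auto
    obtain m :: nat where m: "m \<ge> \<kappa>" "log Q (norm w) + s < \<epsilon> * real m"
    proof -
      obtain m0 :: nat where m0: "(log Q (norm w) + s) / \<epsilon> < real m0"
        using reals_Archimedean2 by blast
      have "log Q (norm w) + s < \<epsilon> * real m0" using m0 assms(3) by (simp add: field_simps)
      also have "\<dots> \<le> \<epsilon> * real (max m0 \<kappa>)" using assms(3) by (intro mult_left_mono) auto
      finally show ?thesis by (intro that[of "max m0 \<kappa>"]) auto
    qed
    have "norm (w / q ^ m) = Q powr (log Q (norm w) - real m)"
      using \<open>w \<noteq> 0\<close> q_gt_1 by (simp add: norm_divide norm_power powr_diff powr_realpow)
    also have "\<dots> < Q powr ((\<epsilon> - 1) * real m - s)"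
      using m(2) q_gt_1 by (simp add: algebra_simps)
    finally have "w / q ^ m \<in> spiral U0 \<epsilon> s m" using w by (simp add: spiral_def mem_piece_iff)
    moreover have "Eq_proj q u = Eq_proj q (w / q ^ m)"
      using Eq_proj_div[of w m] Eq_proj_div[of w k] by (simp add: w_def)
    ultimately show ?thesis using m(1) by blast
  qed
  ultimately show ?thesis
    unfolding invariant_opens_over_def by (auto simp: spiral_def)
qed

lemma compact_q_quotient: "compact K \<Longrightarrow> compact ((\<lambda>z. z / q ^ l) ` K)"
  by (intro compact_continuous_image continuous_intros) auto

text \<open>On a strict subset, points of the k-th piece have modulus comparable to
  \<open>Q^(-k)\<close>. The tail of the k-th series beyond degree M is then of order
  \<open>Q^(k v - \<epsilon> k M)\<close>, hence of order \<open>|z|^m\<close> if M is large, and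
  below degree M the series agrees with F for large k.\<close>

lemma sequence_asymptotic:
  fixes \<kappa> :: nat
  assumes U0: "open U0" "0 \<notin> (\<Union>k. piece U0 k)" and \<epsilon>: "0 < \<epsilon>" "\<epsilon> < 1" and v: "v \<ge> 0"
    and xb_all: "\<forall>k\<ge>\<kappa>. \<forall>n. norm (x (int k) $$ n) \<le> Q powr (real k * ((1 - \<epsilon>) * of_int n + v))"
    and x0_all: "\<forall>k\<ge>\<kappa>. coeff_below (x (int k)) 0"
    and van: "vanishing (\<lambda>k. x k - fps_to_fls F)"
    and f_all: "\<forall>k\<ge>\<kappa>. \<forall>z\<in>piece U0 k. f z = eval_fls (x (int k)) z"
  defines "V \<equiv> \<Union>k\<in>{\<kappa>..}. spiral U0 \<epsilon> 0 k"
  shows "\<And>k. k \<ge> \<kappa> \<Longrightarrow> fls_conv_radius (x (int k)) \<ge> ereal (Q powr ((\<epsilon> - 1) * real k))"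
    and "f holomorphic_on V" and "q_asymptotic q V f F"
proof -
  note xb = xb_all[rule_format] and x0 = x0_all[rule_format] and f = f_all[rule_format]
  have xb': "norm (x (int k) $$ int n) \<le> Q powr (real k * v) * (Q powr ((1 - \<epsilon>) * real k)) ^ n"
    if "k \<ge> \<kappa>" for k n
    using xb[OF that, of "int n"]
    by (simp add: powr_power powr_add[symmetric] algebra_simps)
  show rad: "fls_conv_radius (x (int k)) \<ge> ereal (Q powr ((\<epsilon> - 1) * real k))" if "k \<ge> \<kappa>" for k
  proof -
    have "fls_conv_radius (x (int k)) \<ge> ereal (1 / Q powr ((1 - \<epsilon>) * real k))"
      by (rule fls_conv_radius_ge_powr[OF xb'[OF that]]) simp
    also have "1 / Q powr ((1 - \<epsilon>) * real k) = Q powr - ((1 - \<epsilon>) * real k)"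
      by (simp add: powr_minus divide_inverse)
    also have "- ((1 - \<epsilon>) * real k) = (\<epsilon> - 1) * real k" by (simp add: algebra_simps)
    finally show ?thesis .
  qed
  show hol: "f holomorphic_on V"
    unfolding V_def
  proof (rule holomorphic_on_UN_open)
    fix k assume k: "k \<in> {\<kappa>..}"
    have "eval_fls (x (int k)) holomorphic_on spiral U0 \<epsilon> 0 k"
    proof (rule holomorphic_on_eval_fls)
      have "z \<in> eball 0 (fls_conv_radius (x (int k))) - {0}" if "z \<in> spiral U0 \<epsilon> 0 k" for z
      proof -
        have "ereal (norm z) < ereal (Q powr ((\<epsilon> - 1) * real k))"
          using that by (simp add: spiral_def)
        also have "\<dots> \<le> fls_conv_radius (x (int k))" using rad[of k] k by simp
        finally show ?thesis using that U0(2) by (auto simp: spiral_def)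
      qed
      thus "spiral U0 \<epsilon> 0 k \<subseteq> eball 0 (fls_conv_radius (x (int k))) -
          (if 0 \<le> fls_subdegree (x (int k)) then {} else {0})" by auto
    qed
    thus "f holomorphic_on spiral U0 \<epsilon> 0 k"
      by (rule holomorphic_transform) (use f k in \<open>auto simp: spiral_def\<close>)
    show "open (spiral U0 \<epsilon> 0 k)" by (rule open_spiral[OF U0(1)])
  qed
  have V_inv: "z / q ^ l \<in> V" if "z \<in> V" for z l
  proof (induction l)
    case (Suc l)
    have "(\<lambda>z. z / q) ` V \<subseteq> V"
      using spirals_over[OF U0 \<epsilon>] unfolding V_def invariant_opens_over_def q_invariant_open_def by auto
    hence "z / q ^ l / q \<in> V" using Suc by blast
    thus ?case by (simp add: mult.commute)
  qed (use that in simp)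
  have V0: "0 \<notin> V" using U0(2) by (auto simp: V_def spiral_def)

  show "q_asymptotic q V f F"
    unfolding q_asymptotic_def
  proof (intro allI impI)
    fix m K assume "invariant_strict_subset q V K"
    then obtain K' where K': "compact K'" "K' \<subseteq> V" "K = (\<Union>l. (\<lambda>z. z / q ^ l) ` K')"
      by (auto simp: invariant_strict_subset_def)
    define h where "h z = (f z - (\<Sum>j<m. fps_nth F j * z ^ j)) / z ^ m" for z
    have h_cont: "continuous_on V h"
      unfolding h_def using V0
      by (intro continuous_intros holomorphic_on_imp_continuous_on hol) auto
    \<comment> \<open>By compactness finitely many pieces contain K'. So \<open>w / q^l\<close> lies
      in piece \<open>k' + l\<close> with \<open>k' \<le> L\<close>, and its modulus is compared
      with \<open>Q^(-(k' + l))\<close> by constants independent of l.\<close>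
    obtain C where C: "C \<subseteq> {\<kappa>..}" "finite C" "K' \<subseteq> (\<Union>k\<in>C. spiral U0 \<epsilon> 0 k)"
      by (rule compactE_image[OF K'(1) open_spiral[OF U0(1)] K'(2)[unfolded V_def]])
    define L where "L = Max (insert 0 C)"
    have L: "k \<le> L" if "k \<in> C" for k using C(2) that by (simp add: L_def)
    obtain R where R: "R > 0" "\<And>w. w \<in> K' \<Longrightarrow> norm w \<le> R"
      using compact_imp_bounded[OF K'(1)] by (auto simp: bounded_pos)
    obtain r where r: "r > 0" "\<And>w. w \<in> K' \<Longrightarrow> r \<le> norm w"
    proof -
      have "0 \<notin> K'" using K'(2) V0 by auto
      then obtain d where "d > 0" "\<forall>w\<in>K'. d \<le> dist 0 w"
        using separate_point_closed[OF compact_imp_closed[OF K'(1)]] by blast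
      thus ?thesis using that by auto
    qed
    define R' where "R' = R * Q ^ L"
    have R': "R' > 0" using R by (simp add: R'_def)
    \<comment> \<open>Agreement up to degree m would not suffice: the estimate loses v and keeps
      only \<epsilon> per degree. The choice \<open>\<epsilon> M \<ge> m + v\<close> makes up for
      both.\<close>
    obtain M :: nat where M: "M \<ge> m" "real m + v \<le> \<epsilon> * real M"
    proof -
      obtain M0 :: nat where M0: "(real m + v) / \<epsilon> < real M0" using reals_Archimedean2 by blast
      have "real m + v \<le> \<epsilon> * real M0" using M0 \<epsilon> by (simp add: field_simps)
      also have "\<dots> \<le> \<epsilon> * real (max M0 m)" using \<epsilon> by (intro mult_left_mono) auto
      finally show ?thesis by (intro that[of "max M0 m"]) auto
    qed
    have "\<forall>\<^sub>F k in at_top. coeff_below (x k - fps_to_fls F) (int M) \<and> of_int k \<ge> log Q (2 * R') / \<epsilon>"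
      using van eventually_real_of_int_ge unfolding vanishing_def by (intro eventually_conj) auto
    then obtain k1 where k1: "\<And>k. k \<ge> k1 \<Longrightarrow> coeff_below (x k - fps_to_fls F) (int M) \<and>
        of_int k \<ge> log Q (2 * R') / \<epsilon>"
      unfolding eventually_at_top_linorder by blast
    define k2 where "k2 = nat k1"
    \<comment> \<open>The first summand bounds the tail beyond M, the second the terms of F between
      m and M.\<close>
    define B where "B = 2 * R' ^ M / r ^ m + (\<Sum>j\<in>{m..<M}. norm (fps_nth F j) * R' ^ (j - m))"
    have far: "norm (h (w / q ^ l)) \<le> B" if w: "w \<in> K'" and l: "l \<ge> k2" for w l
    proof -
      define z where "z = w / q ^ l"
      obtain k' where k': "k' \<in> C" "w \<in> spiral U0 \<epsilon> 0 k'" using C(3) w by auto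
      define k where "k = k' + l"
      have k: "k \<ge> \<kappa>" "int k \<ge> k1" using C(1) k' l by (auto simp: k_def k2_def)
      have w': "w * q ^ k' \<in> U0" "norm w \<le> R" "r \<le> norm w" "k' \<le> L"
        using k' L R(2)[OF w] r(2)[OF w] by (auto simp: spiral_def mem_piece_iff)
      have zk: "z \<in> piece U0 k"
        using w' by (simp add: z_def k_def mem_piece_iff power_add)
      have "z \<in> V" unfolding z_def using w K'(2) by (intro V_inv) auto
      hence "z \<noteq> 0" using V0 by auto
      have nz: "norm z = norm w * Q ^ k' / Q ^ k"
        by (simp add: z_def k_def norm_divide norm_power power_add)
      have Qk: "Q ^ k = Q powr real k" by (simp add: powr_realpow)
      have "norm w * Q ^ k' \<le> R * Q ^ L"
        using w' q_gt_1 R by (intro mult_mono power_increasing) auto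
      hence z_up: "norm z \<le> R' * Q powr (- real k)"
        unfolding nz R'_def Qk powr_minus divide_inverse by (intro mult_right_mono) auto
      have "1 * r \<le> Q ^ k' * norm w"
        using w' q_gt_1 r by (intro mult_mono one_le_power) auto
      hence z_lo: "r * Q powr (- real k) \<le> norm z"
        unfolding nz Qk powr_minus divide_inverse by (intro mult_right_mono) (auto simp: mult.commute)
      have z_R': "norm z \<le> R'"
      proof -
        have "Q powr (- real k) \<le> Q powr 0" unfolding Q_powr_le_iff by simp
        hence "R' * Q powr (- real k) \<le> R' * 1" using R' by (intro mult_left_mono) auto
        thus ?thesis using z_up by simp
      qed
      have az: "Q powr ((1 - \<epsilon>) * real k) * norm z \<le> R' * Q powr (- \<epsilon> * real k)"
      proof -
        have "Q powr ((1 - \<epsilon>) * real k) * norm z \<le> Q powr ((1 - \<epsilon>) * real k) * (R' * Q powr (- real k))"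
          using z_up by (intro mult_left_mono) auto
        also have "\<dots> = R' * Q powr ((1 - \<epsilon>) * real k + - real k)" by (simp only: powr_add mult_ac)
        also have "(1 - \<epsilon>) * real k + - real k = - \<epsilon> * real k" by (simp add: algebra_simps)
        finally show ?thesis .
      qed
      have half: "R' * Q powr (- \<epsilon> * real k) \<le> 1 / 2"
      proof -
        have "log Q (2 * R') \<le> \<epsilon> * real k" using k1[OF k(2)] \<epsilon> by (simp add: field_simps)
        hence "Q powr (log Q (2 * R')) \<le> Q powr (\<epsilon> * real k)" by simp
        hence "2 * R' \<le> Q powr (\<epsilon> * real k)" using R' q_gt_1 by simp
        thus ?thesis by (simp add: powr_minus field_simps)
      qed
      have xF: "x (int k) $$ int j = fps_nth F j" if "j < M" for j
        using k1[OF k(2)] that by (simp add: coeff_below_def)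
      have conv: "ereal (norm z) < fls_conv_radius (x (int k))"
      proof -
        have "Q powr ((1 - \<epsilon>) * real k) * norm z < 1" using az half by linarith
        hence "norm z < 1 / Q powr ((1 - \<epsilon>) * real k)" by (simp add: field_simps)
        also have "\<dots> = Q powr - ((1 - \<epsilon>) * real k)" by (simp add: powr_minus divide_inverse)
        also have "- ((1 - \<epsilon>) * real k) = (\<epsilon> - 1) * real k" by (simp add: algebra_simps)
        finally have "norm z < Q powr ((\<epsilon> - 1) * real k)" .
        thus ?thesis using rad[OF k(1)] by (meson ereal_less_eq(3) less_ereal.simps(1) less_le_trans)
      qed
      have "norm (eval_fls (x (int k)) z - (\<Sum>j<M. x (int k) $$ int j * z ^ j)) \<le>
          2 * Q powr (real k * v) * (Q powr ((1 - \<epsilon>) * real k) * norm z) ^ M"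
        by (rule eval_fls_tail[OF x0[OF k(1)] conv xb'[OF k(1)]]) (use az half in auto)
      also have "(\<Sum>j<M. x (int k) $$ int j * z ^ j) = (\<Sum>j<M. fps_nth F j * z ^ j)"
        by (intro sum.cong) (auto simp: xF)
      also have "eval_fls (x (int k)) z = f z" using f[OF k(1) zk] by simp
      also have "2 * Q powr (real k * v) * (Q powr ((1 - \<epsilon>) * real k) * norm z) ^ M \<le>
          2 * Q powr (real k * v) * (R' * Q powr (- \<epsilon> * real k)) ^ M"
        using az by (intro mult_left_mono power_mono) auto
      also have "\<dots> = 2 * R' ^ M * Q powr (real k * v - \<epsilon> * real k * real M)"
      proof -
        have "(Q powr (- \<epsilon> * real k)) ^ M = Q powr (- \<epsilon> * real k * real M)"
          using powr_power[of Q "- \<epsilon> * real k" M] by (simp only: Q_pos less_imp_neq[OF Q_pos, symmetric] simp_thms mult_ac)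
        moreover have "Q powr (real k * v - \<epsilon> * real k * real M) =
            Q powr (real k * v) * Q powr (- \<epsilon> * real k * real M)"
          by (simp add: powr_add[symmetric] algebra_simps)
        ultimately show ?thesis by (simp only: power_mult_distrib mult_ac)
      qed
      also have "\<dots> \<le> 2 * R' ^ M * Q powr (- real k * real m)"
      proof (intro mult_left_mono, unfold Q_powr_le_iff)
        have "real k * (real m + v) \<le> real k * (\<epsilon> * real M)" using M(2) by (intro mult_left_mono) auto
        thus "real k * v - \<epsilon> * real k * real M \<le> - real k * real m" by (simp add: algebra_simps)
      qed (use R' in auto)
      finally have 1: "norm (f z - (\<Sum>j<M. fps_nth F j * z ^ j)) \<le> 2 * R' ^ M * Q powr (- real k * real m)" .
      have 2: "norm ((f z - (\<Sum>j<M. fps_nth F j * z ^ j)) / z ^ m) \<le> 2 * R' ^ M / r ^ m"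
      proof -
        have zm: "r ^ m * Q powr (- real k * real m) \<le> norm z ^ m"
        proof -
          have "(r * Q powr (- real k)) ^ m \<le> norm z ^ m" using z_lo r by (intro power_mono) auto
          thus ?thesis by (simp add: power_mult_distrib powr_power mult.commute)
        qed
        have "norm ((f z - (\<Sum>j<M. fps_nth F j * z ^ j)) / z ^ m) \<le>
            2 * R' ^ M * Q powr (- real k * real m) / (r ^ m * Q powr (- real k * real m))"
          unfolding norm_divide norm_power using 1 zm r R' by (intro frac_le) auto
        thus ?thesis by simp
      qed
      have 3: "norm ((\<Sum>j\<in>{m..<M}. fps_nth F j * z ^ j) / z ^ m) \<le>
          (\<Sum>j\<in>{m..<M}. norm (fps_nth F j) * R' ^ (j - m))"
      proof -
        have "(\<Sum>j\<in>{m..<M}. fps_nth F j * z ^ j) / z ^ m = (\<Sum>j\<in>{m..<M}. fps_nth F j * z ^ (j - m))"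
          unfolding sum_divide_distrib using \<open>z \<noteq> 0\<close> by (intro sum.cong) (auto simp: power_diff)
        also have "norm \<dots> \<le> (\<Sum>j\<in>{m..<M}. norm (fps_nth F j) * R' ^ (j - m))"
          using z_R' by (intro sum_norm_le) (auto simp: norm_mult norm_power intro!: mult_left_mono power_mono)
        finally show ?thesis .
      qed
      have "{..<M} = {..<m} \<union> {m..<M}" using M(1) by auto
      hence "(\<Sum>j<M. fps_nth F j * z ^ j) = (\<Sum>j<m. fps_nth F j * z ^ j) + (\<Sum>j\<in>{m..<M}. fps_nth F j * z ^ j)"
        by (simp add: sum.union_disjoint ivl_disj_int)
      hence "h z = (f z - (\<Sum>j<M. fps_nth F j * z ^ j)) / z ^ m + (\<Sum>j\<in>{m..<M}. fps_nth F j * z ^ j) / z ^ m"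
        by (simp add: h_def add_divide_distrib[symmetric])
      thus ?thesis unfolding B_def z_def[symmetric]
        using 2 3 norm_triangle_le[OF add_mono[OF 2 3]] by simp
    qed
    \<comment> \<open>The remaining finitely many translates form a compact set, where continuity of
      \<open>h\<close> suffices.\<close>
    have near: "compact (\<Union>l<k2. (\<lambda>z. z / q ^ l) ` K')"
      by (intro compact_UN compact_q_quotient K'(1)) auto
    have "(\<Union>l<k2. (\<lambda>z. z / q ^ l) ` K') \<subseteq> V" using K'(2) V_inv by auto
    hence "bounded (h ` (\<Union>l<k2. (\<lambda>z. z / q ^ l) ` K'))"
      by (intro compact_imp_bounded compact_continuous_image near continuous_on_subset[OF h_cont])
    moreover have "h ` K \<subseteq> h ` (\<Union>l<k2. (\<lambda>z. z / q ^ l) ` K') \<union> cball 0 B"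
    proof
      fix y assume "y \<in> h ` K"
      then obtain w l where wl: "w \<in> K'" "y = h (w / q ^ l)" using K'(3) by auto
      show "y \<in> h ` (\<Union>l<k2. (\<lambda>z. z / q ^ l) ` K') \<union> cball 0 B"
        using wl far[of w l] by (cases "l < k2") auto
    qed
    ultimately have "bounded (h ` K)"
      by (meson bounded_Un bounded_cball bounded_subset)
    thus "bounded ((\<lambda>z. (f z - (\<Sum>j<m. fps_nth F j * z ^ j)) / z ^ m) ` K)"
      by (simp add: h_def)
  qed
qed

end

lemma merom_mat_germs:
  fixes A :: "complex \<Rightarrow> complex ^ 'n ^ 'n"
  assumes "merom_mat A"
  obtains G :: "conv_germ ^ 'n ^ 'n"
  where "\<forall>i j. Rep_conv_germ (G $ i $ j) = laurent_expansion (\<lambda>z. A z $ i $ j) 0"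
    "\<forall>\<^sub>F z in at 0. \<forall>i j. ereal (norm z) < fls_conv_radius (Rep_conv_germ (G $ i $ j)) \<and>
      eval_fls (Rep_conv_germ (G $ i $ j)) z = A z $ i $ j"
proof -
  define G :: "conv_germ ^ 'n ^ 'n"
    where "G = (\<chi> i j. Abs_conv_germ (laurent_expansion (\<lambda>z. A z $ i $ j) 0))"
  have lau: "(\<lambda>z. A z $ i $ j) has_laurent_expansion laurent_expansion (\<lambda>z. A z $ i $ j) 0" for i j
    using assms unfolding merom_mat_def meromorphic_on_def' by auto
  have Rep: "Rep_conv_germ (G $ i $ j) = laurent_expansion (\<lambda>z. A z $ i $ j) 0" for i j
    using lau[of i j] by (simp add: G_def Abs_conv_germ_inverse has_laurent_expansion_def)
  have "\<forall>\<^sub>F z :: complex in at 0. ereal (norm z) < fls_conv_radius (Rep_conv_germ (G $ i $ j))" for i j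
  proof -
    obtain r where r: "0 < r" "ereal r < fls_conv_radius (Rep_conv_germ (G $ i $ j))"
      using ereal_dense2[OF Rep_conv_germ_pos[of "G $ i $ j"]] by (auto simp: zero_ereal_def)
    have "\<forall>\<^sub>F z :: complex in at 0. norm z < r"
      unfolding eventually_at using r(1) by (intro exI[of _ r]) auto
    thus ?thesis
    proof eventually_elim
      case (elim z)
      hence "ereal (norm z) < ereal r" by simp
      thus ?case using r(2) by (rule less_trans)
    qed
  qed
  moreover have "\<forall>\<^sub>F z in at 0. eval_fls (Rep_conv_germ (G $ i $ j)) z = A z $ i $ j" for i j
    using lau[of i j] unfolding Rep has_laurent_expansion_def by blast
  ultimately have "\<forall>\<^sub>F z in at 0. \<forall>i j. ereal (norm z) < fls_conv_radius (Rep_conv_germ (G $ i $ j)) \<and>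
      eval_fls (Rep_conv_germ (G $ i $ j)) z = A z $ i $ j"
    by (intro eventually_all_finite eventually_conj)
  thus ?thesis using Rep by (intro that[of G]) auto
qed

lemma germ_class_in_asymp_germs:
  assumes "V \<in> invariant_opens_over q Uinf" "f \<in> asymp_alg q V"
  shows "(V, f) \<in> germ_rel q Uinf `` {(V, f)}"
    and "germ_rel q Uinf `` {(V, f)} \<in> asymp_germs q Uinf"
proof -
  show "(V, f) \<in> germ_rel q Uinf `` {(V, f)}"
    using assms by (auto simp: germ_rel_def intro!: bexI[of _ V])
  show "germ_rel q Uinf `` {(V, f)} \<in> asymp_germs q Uinf"
    unfolding asymp_germs_def using assms by (intro quotientI) auto
qed

text \<open>On the k-th piece the recursion between the series with indices \<open>k - 1\<close> and
  k, evaluated at z, is the functional equation between \<open>q * z\<close> and z.\<close>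

lemma (in q_gt_one) asymptotic_solution_exists:
  fixes A :: "complex \<Rightarrow> complex^'n^'n" and F :: "complex fps^'n"
  assumes mero: "merom_mat A" and sol: "formal_solution q A F" and U: "adequate q U"
  obtains V W f where "V \<in> invariant_opens_over q (Eq_proj q ` U)"
    "W \<in> invariant_opens_over q (Eq_proj q ` U)"
    "\<forall>i. f i holomorphic_on V" "\<forall>i. q_asymptotic q V (f i) (F $ i)"
    "\<forall>z\<in>W. z \<in> V \<and> q * z \<in> V \<and> (\<chi> i. f i (q * z)) = A z *v (\<chi> i. f i z)"
proof -
  obtain U0 where U0: "0 \<notin> U" "open U0" "disjoint_family (piece U0)" "U = (\<Union>k. piece U0 k)"
    using U unfolding adequate_def piece_def[abs_def] by blast
  have z0: "0 \<notin> (\<Union>k. piece U0 k)" using U0 by simp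
  obtain G :: "conv_germ ^ 'n ^ 'n"
    where G: "\<forall>i j. Rep_conv_germ (G $ i $ j) = laurent_expansion (\<lambda>z. A z $ i $ j) 0"
    "\<forall>\<^sub>F z in at 0. \<forall>i j. ereal (norm z) < fls_conv_radius (Rep_conv_germ (G $ i $ j)) \<and>
      eval_fls (Rep_conv_germ (G $ i $ j)) z = A z $ i $ j"
    by (rule merom_mat_germs[OF mero])
  obtain r where r: "r > 0" "\<And>z i j. z \<noteq> 0 \<Longrightarrow> norm z < r \<Longrightarrow>
      ereal (norm z) < fls_conv_radius (Rep_conv_germ (G $ i $ j)) \<and>
      eval_fls (Rep_conv_germ (G $ i $ j)) z = A z $ i $ j"
    using G(2) unfolding eventually_at by auto
  have formal: "fls_dilate q (fps_to_fls (F $ i)) =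
      (\<Sum>j\<in>UNIV. Rep_conv_germ (G $ i $ j) * fps_to_fls (F $ j))" for i
  proof -
    have "fps_to_fls (fps_compose (F $ i) (fps_const q * fps_X)) =
        (\<Sum>j\<in>UNIV. laurent_expansion (\<lambda>z. A z $ i $ j) 0 * fps_to_fls (F $ j))"
      using sol unfolding formal_solution_def by (simp add: vec_eq_iff matrix_vector_mult_def)
    moreover have "fls_dilate q (fps_to_fls (F $ i)) = fps_to_fls (fps_compose (F $ i) (fps_const q * fps_X))"
      by (auto simp: fls_eq_iff fps_compose_linear power_int_def)
    ultimately show ?thesis using G(1) by simp
  qed
  obtain X where X: "\<forall>i. tempered (X i)" "\<forall>i. vanishing (\<lambda>k. X i k - fps_to_fls (F $ i))"
    "\<forall>i. \<forall>\<^sub>F k in at_top. shift 1 (X i) k = pair (G $ i) X k"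
    by (rule tempered_formal_solution[of "\<lambda>i. F $ i" G, OF formal])
  have tX: "tempered (X i)" for i using X(1) by blast
  obtain \<epsilon> v where \<epsilon>: "0 < \<epsilon>" "\<epsilon> < 1" "v \<ge> 0" and tb: "\<And>i. i \<in> UNIV \<Longrightarrow> tempered_by \<epsilon> v (X i)"
    by (rule tempered_common[of "UNIV :: 'n set" X, OF finite tX]) (rule that)
  \<comment> \<open>The last condition means \<open>Q^((\<epsilon> - 1) k) \<le> r\<close>: the
    domain then lies where the Laurent expansions represent A.\<close>
  have "\<forall>\<^sub>F k in at_top. \<forall>i. (\<forall>n. norm (X i k $$ n) \<le> Q powr (of_int k * ((1 - \<epsilon>) * of_int n + v)) \<and>
     (of_int n < -v \<longrightarrow> X i k $$ n = 0)) \<and> coeff_below (X i k - fps_to_fls (F $ i)) 0 \<and>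
     shift 1 (X i) k = pair (G $ i) X k \<and> - log Q r / (1 - \<epsilon>) \<le> of_int k"
    using tb X(2,3) eventually_real_of_int_ge unfolding vanishing_def tempered_by_def
    by (intro eventually_all_finite eventually_conj) auto
  then obtain k1 where k1: "\<And>k i. k \<ge> k1 \<Longrightarrow> (\<forall>n. norm (X i k $$ n) \<le> Q powr (of_int k * ((1 - \<epsilon>) * of_int n + v)) \<and>
     (of_int n < -v \<longrightarrow> X i k $$ n = 0)) \<and> coeff_below (X i k - fps_to_fls (F $ i)) 0 \<and>
     shift 1 (X i) k = pair (G $ i) X k \<and> - log Q r / (1 - \<epsilon>) \<le> of_int k"
    unfolding eventually_at_top_linorder by blast
  define \<kappa> where "\<kappa> = nat k1"
  have \<kappa>: "int k \<ge> k1" if "k \<ge> \<kappa>" for k using that by (simp add: \<kappa>_def)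
  \<comment> \<open>Disjointness of the pieces makes the index unique, so the series can be glued
    without any compatibility between them.\<close>
  define f where "f i z = eval_fls (X i (int (THE k. z \<in> piece U0 k))) z" for i z
  have f_eq: "f i z = eval_fls (X i (int k)) z" if "z \<in> piece U0 k" for i k z
  proof -
    have "(THE k. z \<in> piece U0 k) = k"
      using that U0(3) unfolding disjoint_family_on_def by (intro the_equality) blast+
    thus ?thesis by (simp add: f_def)
  qed
  have Xb: "\<forall>k\<ge>\<kappa>. \<forall>n. norm (X i (int k) $$ n) \<le> Q powr (real k * ((1 - \<epsilon>) * of_int n + v))" for i
    using k1[OF \<kappa>, of _ i] by simp
  have X0: "\<forall>k\<ge>\<kappa>. coeff_below (X i (int k)) 0" for i
    using k1[OF \<kappa>, of _ i] by (simp add: coeff_below_def)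
  have van: "vanishing (\<lambda>k. X i k - fps_to_fls (F $ i))" for i using X(2) by blast
  have f_all: "\<forall>k\<ge>\<kappa>. \<forall>z\<in>piece U0 k. f i z = eval_fls (X i (int k)) z" for i using f_eq by blast
  note asym = sequence_asymptotic[OF U0(2) z0 \<epsilon> Xb X0 van f_all]
  define V where "V = (\<Union>k\<in>{\<kappa>..}. spiral U0 \<epsilon> 0 k)"
  \<comment> \<open>Starting one piece later and with \<open>s = 1\<close> ensures that both z and
    \<open>q * z\<close> lie in V.\<close>
  define W where "W = (\<Union>k\<in>{Suc \<kappa>..}. spiral U0 \<epsilon> 1 k)"
  have inW: "z \<in> V \<and> q * z \<in> V \<and> (\<chi> i. f i (q * z)) = A z *v (\<chi> i. f i z)" if z: "z \<in> W" for z
  proof -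
    obtain k where k: "k \<ge> Suc \<kappa>" "z \<in> piece U0 k" "norm z < Q powr ((\<epsilon> - 1) * real k - 1)"
      using z by (auto simp: W_def spiral_def)
    obtain l where l: "k = Suc l" "l \<ge> \<kappa>" using k(1) by (cases k) auto
    have "z \<noteq> 0" using k(2) z0 by auto
    have "Q powr ((\<epsilon> - 1) * real k - 1) \<le> Q powr ((\<epsilon> - 1) * real k)" by simp
    hence nz: "norm z < Q powr ((\<epsilon> - 1) * real k)" using k(3) by linarith
    have "norm (q * z) < Q * Q powr ((\<epsilon> - 1) * real k - 1)"
      using k(3) unfolding norm_mult by (intro mult_strict_left_mono) auto
    also have "\<dots> = Q powr ((\<epsilon> - 1) * real k)" using q_gt_1 by (simp add: powr_diff)
    also have "\<dots> \<le> Q powr ((\<epsilon> - 1) * real l)" using \<epsilon> l by (simp add: algebra_simps)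
    finally have nqz: "norm (q * z) < Q powr ((\<epsilon> - 1) * real l)" .
    have qz: "q * z \<in> piece U0 l" using k(2) l by (simp add: mem_piece_iff mult_ac)
    have zV: "z \<in> V" unfolding V_def using k nz by (intro UN_I[of k]) (auto simp: spiral_def)
    have qzV: "q * z \<in> V" unfolding V_def using qz nqz l by (intro UN_I[of l]) (auto simp: spiral_def)
    have zr: "norm z < r"
    proof -
      have "- log Q r / (1 - \<epsilon>) \<le> real k" using k1[of "int k"] \<kappa>[of k] k(1) by simp
      hence "(\<epsilon> - 1) * real k \<le> log Q r" using \<epsilon> by (simp add: field_simps)
      hence "Q powr ((\<epsilon> - 1) * real k) \<le> Q powr (log Q r)" by simp
      thus ?thesis using nz r(1) q_gt_1 by simp
    qed
    have conv_q: "ereal (norm (q * z)) < fls_conv_radius (X i (int l))" for i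
      using nqz asym(1)[OF l(2), of i] by (meson ereal_less_eq(3) less_ereal.simps(1) less_le_trans)
    have conv: "ereal (norm z) < fls_conv_radius (X i (int k))" for i
      using nz asym(1)[of k i] k(1) by (meson Suc_leD less_ereal.simps(1) less_le_trans)
    have "f i (q * z) = (A z *v (\<chi> i. f i z)) $ i" for i
    proof -
      have prod: "ereal (norm z) < fls_conv_radius (Rep_conv_germ (G $ i $ j) * X j (int k))" for j
      proof -
        have "ereal (norm z) < min (fls_conv_radius (Rep_conv_germ (G $ i $ j))) (fls_conv_radius (X j (int k)))"
          using r(2)[OF \<open>z \<noteq> 0\<close> zr] conv by simp
        also have "\<dots> \<le> fls_conv_radius (Rep_conv_germ (G $ i $ j) * X j (int k))"
          by (rule fls_conv_radius_mult)
        finally show ?thesis .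
      qed
      have "f i (q * z) = eval_fls (fls_dilate q (X i (int l))) z"
        using f_eq[OF qz] eval_fls_dilate[OF X0[rule_format, OF l(2)] conv_q] by simp
      also have "fls_dilate q (X i (int l)) = shift 1 (X i) (int k)" by (simp add: shift_def l)
      also have "\<dots> = (\<Sum>j\<in>UNIV. Rep_conv_germ (G $ i $ j) * X j (int k))"
        using k1[of "int k" i] \<kappa>[of k] k(1) by (simp add: pair_def)
      also have "eval_fls \<dots> z = (\<Sum>j\<in>UNIV. eval_fls (Rep_conv_germ (G $ i $ j) * X j (int k)) z)"
        using eval_fls_sum[OF finite \<open>z \<noteq> 0\<close>, of UNIV "\<lambda>j. Rep_conv_germ (G $ i $ j) * X j (int k)"] prod by simp
      also have "\<dots> = (\<Sum>j\<in>UNIV. A z $ i $ j * f j z)"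
        using r(2)[OF \<open>z \<noteq> 0\<close> zr] conv \<open>z \<noteq> 0\<close>
        by (intro sum.cong refl) (simp add: eval_fls_mult f_eq[OF k(2)])
      finally show ?thesis by (simp add: matrix_vector_mult_def)
    qed
    thus ?thesis using zV qzV by (simp add: vec_eq_iff)
  qed
  show ?thesis
  proof (rule that[of V W f])
    show "V \<in> invariant_opens_over q (Eq_proj q ` U)" "W \<in> invariant_opens_over q (Eq_proj q ` U)"
      unfolding V_def W_def U0(4) by (rule spirals_over[OF U0(2) z0 \<epsilon>(1,2)])+
    show "\<forall>i. f i holomorphic_on V" "\<forall>i. q_asymptotic q V (f i) (F $ i)"
      unfolding V_def using asym(2,3) by auto
    show "\<forall>z\<in>W. z \<in> V \<and> q * z \<in> V \<and> (\<chi> i. f i (q * z)) = A z *v (\<chi> i. f i z)"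
      using inW by blast
  qed
qed

theorem theorem4p2p1:
  fixes q :: complex
    and A :: "complex \<Rightarrow> complex^'n^'n"
    and Xhat :: "complex fps^'n"
    and U :: "complex set"
  assumes "norm q > 1"
    and "merom_GL A"
    and "formal_solution q A Xhat"
    and "adequate q U"
  shows "\<exists>X :: section_germ^'n.
           (\<forall>i. X $ i \<in> asymp_germs q (Eq_proj q ` U)) \<and>
           germ_solution q (Eq_proj q ` U) A X \<and>
           (\<forall>i. germ_asymptotic q (X $ i) (Xhat $ i))"
proof -
  interpret q_gt_one q by standard (rule assms(1))
  let ?Uinf = "Eq_proj q ` U"
  have "merom_mat A" using assms(2) by (simp add: merom_GL_def)
  then obtain V W f where V: "V \<in> invariant_opens_over q ?Uinf" and W: "W \<in> invariant_opens_over q ?Uinf"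
    and hol: "\<forall>i. f i holomorphic_on V" and asy: "\<forall>i. q_asymptotic q V (f i) (Xhat $ i)"
    and eq: "\<forall>z\<in>W. z \<in> V \<and> q * z \<in> V \<and> (\<chi> i. f i (q * z)) = A z *v (\<chi> i. f i z)"
    by (rule asymptotic_solution_exists[OF _ assms(3,4)])
  have alg: "f i \<in> asymp_alg q V" for i using hol asy by (auto simp: asymp_alg_def)
  define X :: "section_germ^'n" where "X = (\<chi> i. germ_rel q ?Uinf `` {(V, f i)})"
  have mem: "(V, f i) \<in> X $ i" for i
    using germ_class_in_asymp_germs(1)[OF V alg] by (simp add: X_def)
  have "X $ i \<in> asymp_germs q ?Uinf" for i
    using germ_class_in_asymp_germs(2)[OF V alg] by (simp add: X_def)
  moreover have "germ_solution q ?Uinf A X"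
    unfolding germ_solution_def
    by (intro exI[of _ "\<lambda>_. V"] exI[of _ f] conjI allI mem bexI[OF _ W]) (use eq in auto)
  moreover have "germ_asymptotic q (X $ i) (Xhat $ i)" for i
    unfolding germ_asymptotic_def using mem[of i] asy by blast
  ultimately show ?thesis by blast
qed

end
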